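(* Let $n$ take values only in an infinite set of odd square-free integers greater than $1$ such that \[ \frac{(\log n)^7}{p_n}\to 0 \quad\text{as } n\to\infty, \] where $p_n$ is the smallest prime factor of $n$, and let $r$ be real. Let $J(z)=\sum_{j=1}^{n-1}\left(\frac{j}{n}\right)z^j$ be the character polynomial of degree $n-1$ and define \[ V(z)=\sum_{\substack{0\le j\le n-1\\ \gcd(j,n)>1}}\left(\frac{j}{n/\gcd(j,n)}\right) z^j. \] Then \[ \lim_{n\to\infty}F(J_r+V_r)=f(r). \]
   Context: For real $\alpha\ge1$ and $A\in\mathbb{C}[z]$, $\|A\|_\alpha=\left(\frac{1}{2\pi}\int_0^{2\pi}|A(e^{i\theta})|^\alpha d\theta\right)^{1/\alpha}$. The merit factor of $A$ is $F(A)=\frac{\|A\|_2^4}{\|A\|_4^4-\|A\|_2^4}$. For a polynomial $A$ of degree at most $n-1$ and real $r$, the rotation is $A_r(z)=z^{-\lfloor nr\rfloor}A(z)\bmod (z^n-1)$. $\left(\frac{\cdot}{m}\right)$ denotes the Jacobi symbol modulo an odd positive integer $m$ (with $\left(\frac{\cdot}{1}\right)\equiv 1$). The function $f$ is $1$-periodic with $f(r)=\dfrac{1}{\frac16+8\left(|r|-\frac14\right)^2}$ for $-\frac12<r\le\frac12$. *)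

theory Defs
  imports "HOL-Analysis.Analysis" "HOL-Number_Theory.Number_Theory"
    "HOL-Computational_Algebra.Polynomial" "HOL-Computational_Algebra.Squarefree"
begin

definition jacobi :: "int \<Rightarrow> nat \<Rightarrow> int" where
  "jacobi a m = (\<Prod>p\<in>prime_factors m. Legendre a (int p) ^ multiplicity p m)"

definition Lnorm :: "real \<Rightarrow> complex poly \<Rightarrow> real" where
  "Lnorm \<alpha> A = ((1 / (2 * pi)) *
      integral {0..2*pi} (\<lambda>\<theta>. norm (poly A (cis \<theta>)) powr \<alpha>)) powr (1 / \<alpha>)"

definition merit_factor :: "complex poly \<Rightarrow> real" where
  "merit_factor A = Lnorm 2 A ^ 4 / (Lnorm 4 A ^ 4 - Lnorm 2 A ^ 4)"

text \<open>Rotation A_r(z) = z^(-floor(n r)) A(z) mod (z^n - 1), for A of degree at most n-1: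
  the coefficient of z^k (0 \<le> k < n) is the coefficient of z^((k + floor(n r)) mod n) of A.\<close>
definition rotation :: "nat \<Rightarrow> real \<Rightarrow> complex poly \<Rightarrow> complex poly" where
  "rotation n r A = (\<Sum>k<n. Polynomial.monom (Polynomial.coeff A (nat ((int k + \<lfloor>real n * r\<rfloor>) mod int n))) k)"

definition char_poly_J :: "nat \<Rightarrow> complex poly" where
  "char_poly_J n = (\<Sum>j\<in>{1..n-1}. Polynomial.monom (of_int (jacobi (int j) n)) j)"

definition poly_V :: "nat \<Rightarrow> complex poly" where
  "poly_V n = (\<Sum>j\<in>{j. j \<le> n - 1 \<and> gcd j n > 1}.
                 Polynomial.monom (of_int (jacobi (int j) (n div gcd j n))) j)"

text \<open>1-periodic f with f r = 1/(1/6 + 8(|r| - 1/4)^2) on (-1/2, 1/2].\<close>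
definition f_lim :: "real \<Rightarrow> real" where
  "f_lim r = (let s = r - of_int \<lceil>r - 1/2\<rceil> in 1 / (1/6 + 8 * (\<bar>s\<bar> - 1/4)^2))"

definition smallest_prime_factor :: "nat \<Rightarrow> nat" where
  "smallest_prime_factor n = Min (prime_factors n)"

end

theory Submission
  imports Defs
begin

text \<open>
  The coefficients of \<open>J + V\<close> form the \<open>n\<close>-periodic sequence \<open>x j = (\<Prod>p | p dvd n. u\<^sub>p j)\<close> of signs, where
  \<open>u\<^sub>p\<close> is the Legendre symbol modulo \<open>p\<close> with the value \<open>0\<close> replaced by \<open>1\<close>. The fourth power of the \<open>L\<^sup>4\<close> norm of
  the rotated polynomial is the mean of \<open>|F|\<^sup>4\<close> over the \<open>2n\<close>-th roots of unity, where \<open>F\<close> is the Fourier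
  transform of \<open>x\<close> cut off to an interval \<open>I\<close> of length \<open>n\<close>.

  For a cut-off \<open>\<phi>\<close> with Fourier coefficients \<open>\<kappa>\<close> this mean is a quadrilinear form in \<open>\<kappa>\<close> whose
  coefficients are four-point correlations of the Fourier transform of \<open>x\<close>. They factor over the primes
  dividing \<open>n\<close>, and each factor is close to \<open>1\<close> if the four points pair up and \<open>O(p\<^bsup>-1/4\<^esup>)\<close> otherwise, by
  Mordell's elementary bound for character sums of cubic polynomials. If \<open>\<kappa>\<close> is absolutely summable, only the pairings
  survive; this covers trapezoidal \<open>\<phi>\<close>. The difference between the indicator of \<open>I\<close> and a
  trapezoid is a sum of two truncated narrow tents, and truncation is bounded on \<open>L\<^sup>4\<close> by M. Riesz' theorem, so the
  error made by smoothing is negligible as well. No logarithmic loss occurs. The contribution of the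
  pairings for \<open>I\<close> itself is computed with Parseval's identity.
\<close>

subsection \<open>Sums of periodic functions\<close>

text \<open>Period 2n is used instead of n because the frequencies i1 + i2 - i3 - i4 met in |F|^4
  are all smaller than 2n in absolute value. The mean over the 2n-th roots of unity is therefore the
  exact integral, and an interval of length n has an autocorrelation without wrap-around. The
  obstacle is the indicator of the interval: its Fourier coefficients decay only like 1/m, their
  absolute sum grows like log n, and the error of the quadrilinear form involves the fourth power of
  that sum. Ramps of length about \<delta> n keep the sum below 1 + 2/\<delta>, so \<delta> can be
  held fixed while n grows. The hypothesis on the smallest prime factor q of n is used in the form
  1/q -> 0 and omega(n) / sqrt q -> 0, with omega(n) the number of primes dividing n: the local
  errors of all these primes multiply up, whereas a single prime already makes an unpaired
  correlation small. Frequencies beyond q/2 go into a tail, since distinct integers of that size may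
  be congruent modulo a prime. In the normalised fourth moment the even frequencies give 1/2 and the
  odd ones 2/3 plus a square depending on r; the excess over 1 is 1/f(r).\<close>

lemma periodic_mod:
  fixes f :: "int \<Rightarrow> 'a"
  assumes per: "\<And>k. f (k + N) = f k"
  shows "f (k mod N) = f k"
proof -
  have pos: "f (k + int j * N) = f k" for k j
  proof (induction j)
    case (Suc j)
    then show ?case using per[of "k + int j * N"] by (simp add: algebra_simps)
  qed simp
  have all: "f (k + q * N) = f k" for k q
  proof (cases "q \<ge> 0")
    case True
    then show ?thesis using pos[of k "nat q"] by simp
  next
    case False
    then show ?thesis using pos[of "k + q * N" "nat (-q)"] by simp
  qed
  have "f k = f (k mod N + k div N * N)" by simp
  then show ?thesis using all by metis
qed

lemma periodic_cong:
  fixes f :: "int \<Rightarrow> 'a"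
  assumes "\<And>k. f (k + N) = f k" "N dvd a - b"
  shows "f a = f b"
  using periodic_mod[of f N, OF assms(1)] assms(2) by (metis mod_eq_dvd_iff)

lemma sum_period_range:
  fixes f :: "int \<Rightarrow> 'a::comm_monoid_add"
  assumes per: "\<And>k. f (k + N) = f k" and "N > 0"
  shows "(\<Sum>k\<in>{a..<a+N}. f k) = (\<Sum>k\<in>{0..<N}. f k)"
proof (rule sum.reindex_bij_witness[of _ "\<lambda>j. a + (j - a) mod N" "\<lambda>k. k mod N"])
  fix k assume "k \<in> {a..<a+N}"
  then have "(k mod N - a) mod N = k - a"
    by (metis (no_types, lifting) atLeastLessThan_iff diff_ge_0_iff_ge diff_less_eq add.commute
        mod_diff_left_eq mod_pos_pos_trivial)
  then show "a + (k mod N - a) mod N = k" by simp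
  show "k mod N \<in> {0..<N}" using \<open>N > 0\<close> by simp
  show "f (k mod N) = f k" by (rule periodic_mod[of f N, OF per])
next
  fix j assume j: "j \<in> {0..<N}"
  show "(a + (j - a) mod N) mod N = j" using j by (simp add: mod_add_right_eq)
  show "a + (j - a) mod N \<in> {a..<a+N}" using \<open>N > 0\<close> by simp
qed

lemma sum_period_translate:
  fixes f :: "int \<Rightarrow> 'a::comm_monoid_add"
  assumes per: "\<And>k. f (k + N) = f k" and "N > 0"
  shows "(\<Sum>k\<in>{0..<N}. f (k + c)) = (\<Sum>k\<in>{0..<N}. f k)"
proof -
  have "(\<Sum>k\<in>{0..<N}. f (k + c)) = (\<Sum>k\<in>{c..<c+N}. f k)"
    by (rule sum.reindex_bij_witness[of _ "\<lambda>k. k - c" "\<lambda>k. k + c"]) auto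
  also have "\<dots> = (\<Sum>k\<in>{0..<N}. f k)" by (rule sum_period_range[of f, OF per \<open>N > 0\<close>])
  finally show ?thesis .
qed

lemma sum_period_dilate:
  fixes f :: "int \<Rightarrow> 'a::comm_monoid_add"
  assumes per: "\<And>k. f (k + N) = f k" and "N > 0" and "coprime c N"
  shows "(\<Sum>k\<in>{0..<N}. f (c * k)) = (\<Sum>k\<in>{0..<N}. f k)"
proof -
  have inj: "inj_on (\<lambda>k. (c * k) mod N) {0..<N}"
  proof (rule inj_onI)
    fix x y assume xy: "x \<in> {0..<N}" "y \<in> {0..<N}" "(c * x) mod N = (c * y) mod N"
    then have "N dvd c * (x - y)" by (simp add: mod_eq_dvd_iff right_diff_distrib)
    then have "N dvd x - y" using \<open>coprime c N\<close>
      by (simp add: coprime_commute coprime_dvd_mult_right_iff)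
    then have "x mod N = y mod N" by (simp add: mod_eq_dvd_iff)
    then show "x = y" using xy by simp
  qed
  have sub: "(\<lambda>k. (c * k) mod N) ` {0..<N} \<subseteq> {0..<N}" using \<open>N > 0\<close> by auto
  have "(\<lambda>k. (c * k) mod N) ` {0..<N} = {0..<N}"
    using inj sub by (intro card_subset_eq) (auto simp: card_image)
  then have "bij_betw (\<lambda>k. (c * k) mod N) {0..<N} {0..<N}" using inj by (simp add: bij_betw_def)
  then have "(\<Sum>k\<in>{0..<N}. f ((c * k) mod N)) = (\<Sum>k\<in>{0..<N}. f k)"
    by (rule sum.reindex_bij_betw)
  then show ?thesis by (simp add: periodic_mod[of f N, OF per])
qed

text \<open>The Chinese remainder theorem with representatives \<open>b * u + a * v\<close>: in this
  form an additive character modulo \<open>a * b\<close> splits into a character of \<open>u\<close>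
  modulo \<open>a\<close> times one of \<open>v\<close> modulo \<open>b\<close>.\<close>

lemma sum_period_crt:
  fixes f :: "int \<Rightarrow> 'a::comm_monoid_add"
  assumes per: "\<And>k. f (k + a * b) = f k" and "a > 0" "b > 0" and cop: "coprime a b"
  shows "(\<Sum>k\<in>{0..<a*b}. f k) = (\<Sum>u\<in>{0..<a}. \<Sum>v\<in>{0..<b}. f (b * u + a * v))"
proof -
  let ?g = "\<lambda>(u, v). (b * u + a * v) mod (a * b)"
  have pos: "a * b > 0" using assms by simp
  have key: "u = u'" if "0 \<le> u" "u < a" "0 \<le> u'" "u' < a" "a dvd b * (u - u')" "coprime a b" for u u' a b :: int
  proof -
    have "a dvd u - u'" using that by (simp add: coprime_dvd_mult_right_iff)
    then have "u mod a = u' mod a" by (simp add: mod_eq_dvd_iff)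
    then show ?thesis using that by simp
  qed
  have inj: "inj_on ?g ({0..<a} \<times> {0..<b})"
  proof (rule inj_onI, clarsimp)
    fix u v u' v' assume *: "0 \<le> u" "u < a" "0 \<le> v" "v < b" "0 \<le> u'" "u' < a" "0 \<le> v'" "v' < b"
      and "(b * u + a * v) mod (a * b) = (b * u' + a * v') mod (a * b)"
    then have d: "a * b dvd b * (u - u') + a * (v - v')"
      by (simp add: mod_eq_dvd_iff algebra_simps)
    have "a dvd b * (u - u') + a * (v - v')" "b dvd b * (u - u') + a * (v - v')"
      using d by (auto dest: dvd_mult_left dvd_mult_right)
    then have "a dvd b * (u - u')" "b dvd a * (v - v')"
      by (simp_all add: dvd_add_left_iff dvd_add_right_iff)
    then show "u = u' \<and> v = v'"
      using key[of u a u' b] key[of v b v' a] * cop by (simp add: coprime_commute)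
  qed
  have "?g ` ({0..<a} \<times> {0..<b}) = {0..<a*b}"
    using inj pos \<open>a > 0\<close> \<open>b > 0\<close>
    by (intro card_subset_eq) (auto simp: card_image nat_mult_distrib)
  then have "bij_betw ?g ({0..<a} \<times> {0..<b}) {0..<a*b}" using inj by (simp add: bij_betw_def)
  then have "(\<Sum>k\<in>{0..<a*b}. f k) = (\<Sum>x\<in>{0..<a} \<times> {0..<b}. f (?g x))"
    by (rule sum.reindex_bij_betw[symmetric])
  also have "\<dots> = (\<Sum>(u, v)\<in>{0..<a} \<times> {0..<b}. f (b * u + a * v))"
    by (intro sum.cong) (auto simp: periodic_mod[of f "a * b", OF per])
  finally show ?thesis by (simp add: sum.cartesian_product)
qed

text \<open>On \<open>b * u + a * v\<close> the first function sees only \<open>b * u\<close> and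
  the second only \<open>a * v\<close>; the units \<open>b\<close> and \<open>a\<close> then
  disappear by dilation.\<close>

lemma sum_period_product:
  fixes f g :: "int \<Rightarrow> 'a::comm_semiring_0"
  assumes perf: "\<And>k. f (k + a) = f k" and perg: "\<And>k. g (k + b) = g k"
    and "a > 0" "b > 0" and cop: "coprime a b"
  shows "(\<Sum>k\<in>{0..<a*b}. f k * g k) = (\<Sum>k\<in>{0..<a}. f k) * (\<Sum>k\<in>{0..<b}. g k)"
proof -
  have f: "f k = f l" if "a dvd k - l" for k l using periodic_cong[of f a, OF perf that] .
  have g: "g k = g l" if "b dvd k - l" for k l using periodic_cong[of g b, OF perg that] .
  have "(\<Sum>k\<in>{0..<a*b}. f k * g k)
      = (\<Sum>u\<in>{0..<a}. \<Sum>v\<in>{0..<b}. f (b * u + a * v) * g (b * u + a * v))"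
    using assms f g by (intro sum_period_crt) (auto intro!: arg_cong2[where f="(*)"] f g)
  also have "\<dots> = (\<Sum>u\<in>{0..<a}. \<Sum>v\<in>{0..<b}. f (b * u) * g (a * v))"
    by (intro sum.cong arg_cong2[where f="(*)"] f g) auto
  also have "\<dots> = (\<Sum>u\<in>{0..<a}. f (b * u)) * (\<Sum>v\<in>{0..<b}. g (a * v))"
    by (simp add: sum_product)
  also have "\<dots> = (\<Sum>k\<in>{0..<a}. f k) * (\<Sum>k\<in>{0..<b}. g k)"
    using assms by (simp add: sum_period_dilate coprime_commute)
  finally show ?thesis .
qed

subsection \<open>Discrete Fourier analysis on residues\<close>

definition ee :: "int \<Rightarrow> int \<Rightarrow> complex" where
  "ee N k = cis (2 * pi * of_int k / of_int N)"

lemma ee_0 [simp]: "ee N 0 = 1" by (simp add: ee_def)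

lemma norm_ee [simp]: "norm (ee N k) = 1" by (simp add: ee_def)

lemma ee_add: "ee N (a + b) = ee N a * ee N b"
  by (simp add: ee_def cis_mult ring_distribs add_divide_distrib)

lemma cnj_ee: "cnj (ee N k) = ee N (- k)" by (simp add: ee_def cis_cnj)

lemma ee_self [simp]: "N \<noteq> 0 \<Longrightarrow> ee N N = 1" by (simp add: ee_def)

lemma ee_period: "N \<noteq> 0 \<Longrightarrow> ee N (k + N) = ee N k" by (simp add: ee_add)

lemma ee_cancel: "c \<noteq> 0 \<Longrightarrow> ee (c * N) (c * k) = ee N k"
  by (simp add: ee_def mult.assoc)

lemma ee_dvd: "N \<noteq> 0 \<Longrightarrow> N dvd k \<Longrightarrow> ee N k = 1"
  using periodic_cong[of "ee N" N k 0] by (simp add: ee_period)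

lemma ee_cong: "N \<noteq> 0 \<Longrightarrow> N dvd a - b \<Longrightarrow> ee N a = ee N b"
  using periodic_cong[of "ee N" N a b] by (simp add: ee_period)

lemma ee_eq_1_iff: assumes "N > 0" shows "ee N k = 1 \<longleftrightarrow> N dvd k"
proof
  assume "ee N k = 1"
  then have "cos (2 * pi * of_int k / of_int N) = 1" by (simp add: ee_def complex_eq_iff)
  then obtain j :: int where "2 * pi * of_int k / of_int N = of_int j * 2 * pi"
    by (auto simp: cos_one_2pi_int)
  then have "real_of_int k = of_int (j * N)" using assms by (simp add: field_simps)
  then show "N dvd k" by (metis dvd_triv_right of_int_eq_iff)
qed (use assms ee_dvd in auto)

lemma ee_power: "ee N (int k * m) = ee N m ^ k"
  by (induction k) (auto simp: ee_add algebra_simps)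

lemma ee_sum: assumes "N > 0"
  shows "(\<Sum>k\<in>{0..<N}. ee N (k * m)) = (if N dvd m then of_int N else 0)"
proof (cases "N dvd m")
  case True
  then show ?thesis using assms by (simp add: ee_dvd)
next
  case False
  let ?s = "\<Sum>k\<in>{0..<N}. ee N (k * m)"
  have per: "ee N ((k + N) * m) = ee N (k * m)" for k
    using assms by (simp add: ring_distribs ee_add ee_dvd)
  have "?s = (\<Sum>k\<in>{0..<N}. ee N ((k + 1) * m))"
    using sum_period_translate[of "\<lambda>k. ee N (k * m)" N 1] per assms by simp
  also have "\<dots> = ee N m * ?s" by (simp add: ring_distribs ee_add sum_distrib_left mult.commute)
  finally have "(1 - ee N m) * ?s = 0" by (simp add: algebra_simps)
  moreover have "ee N m \<noteq> 1" using ee_eq_1_iff[OF assms] False by simp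
  ultimately show ?thesis using False by simp
qed

definition fcoeff :: "int \<Rightarrow> (int \<Rightarrow> complex) \<Rightarrow> int \<Rightarrow> complex" where
  "fcoeff N f m = (\<Sum>j\<in>{0..<N}. f j * ee N (- (j * m))) / of_int N"

lemma fcoeff_period: "N > 0 \<Longrightarrow> fcoeff N f (m + N) = fcoeff N f m"
  unfolding fcoeff_def
  by (intro arg_cong2[where f="(/)"] sum.cong refl)
     (auto simp: algebra_simps intro!: ee_cong)

lemma fcoeff_diff: "fcoeff N (\<lambda>j. f j - g j) m = fcoeff N f m - fcoeff N g m"
  by (simp add: fcoeff_def sum_subtractf left_diff_distrib diff_divide_distrib)

text \<open>The frequency window may start anywhere; it will be \<open>{-n..<n}\<close>, so that a
  small absolute value means a low frequency.\<close>

lemma fourier_inversion: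
  assumes "N > 0" and per: "\<And>k. f (k + N) = f k"
  shows "f j = (\<Sum>m\<in>{a..<a+N}. fcoeff N f m * ee N (j * m))"
proof -
  have "(\<Sum>m\<in>{a..<a+N}. fcoeff N f m * ee N (j * m)) = (\<Sum>m\<in>{0..<N}. fcoeff N f m * ee N (j * m))"
    using assms(1) by (intro sum_period_range) (auto simp: fcoeff_period ring_distribs ee_add ee_dvd)
  also have "\<dots> = (\<Sum>m\<in>{0..<N}. \<Sum>i\<in>{0..<N}. f i / of_int N * ee N (m * (j - i)))"
    by (intro sum.cong refl, unfold fcoeff_def sum_distrib_right sum_divide_distrib, intro sum.cong refl)
       (simp add: ee_add[symmetric] algebra_simps)
  also have "\<dots> = (\<Sum>i\<in>{0..<N}. f i / of_int N * (\<Sum>m\<in>{0..<N}. ee N (m * (j - i))))"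
    by (subst sum.swap) (simp add: sum_distrib_left)
  also have "\<dots> = (\<Sum>i\<in>{0..<N}. if N dvd j - i then f i else 0)"
    using assms(1) by (intro sum.cong) (auto simp: ee_sum)
  also have "\<dots> = (\<Sum>i\<in>{j..<j+N}. if N dvd j - i then f i else 0)"
    using assms(1) by (intro sum_period_range[symmetric]) (simp_all add: per mod_eq_dvd_iff[symmetric])
  also have "\<dots> = (\<Sum>i\<in>{j..<j+N}. if i = j then f i else 0)"
  proof (intro sum.cong refl)
    fix i assume i: "i \<in> {j..<j+N}"
    have "\<not> N dvd i - j" if "i \<noteq> j" using i that by (intro zdvd_not_zless) auto
    then have "N dvd j - i \<longleftrightarrow> i = j" by (auto simp: dvd_diff_commute)
    then show "(if N dvd j - i then f i else 0) = (if i = j then f i else 0)" by simp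
  qed
  also have "\<dots> = f j" using assms(1) by simp
  finally show ?thesis by simp
qed

text \<open>The second function is transformed with the opposite sign and without conjugation.
  Taking the conjugate of \<open>f\<close> for \<open>g\<close> gives Parseval's identity; taking
  the reflection of \<open>f\<close> gives the sum of the squared coefficients.\<close>

lemma parseval_bilinear:
  assumes "N > 0" and per: "\<And>k. f (k + N) = f k"
  shows "(\<Sum>m\<in>{a..<a+N}. fcoeff N f m * (\<Sum>j\<in>{0..<N}. g j * ee N (j * m))) = (\<Sum>j\<in>{0..<N}. f j * g j)"
proof -
  have "(\<Sum>m\<in>{a..<a+N}. fcoeff N f m * (\<Sum>j\<in>{0..<N}. g j * ee N (j * m)))
      = (\<Sum>j\<in>{0..<N}. (\<Sum>m\<in>{a..<a+N}. fcoeff N f m * ee N (j * m)) * g j)"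
    by (simp add: sum_distrib_left sum_distrib_right) (subst sum.swap, simp add: mult_ac)
  then show ?thesis by (simp add: fourier_inversion[of N f, OF assms, where a=a, symmetric])
qed

lemma parseval:
  assumes "N > 0" and per: "\<And>k. f (k + N) = f k"
  shows "(\<Sum>m\<in>{a..<a+N}. (norm (fcoeff N f m))^2) = (\<Sum>j\<in>{0..<N}. (norm (f j))^2) / of_int N"
proof -
  have "(\<Sum>m\<in>{a..<a+N}. fcoeff N f m * (\<Sum>j\<in>{0..<N}. cnj (f j) * ee N (j * m)))
      = (\<Sum>m\<in>{a..<a+N}. of_int N * (of_real ((norm (fcoeff N f m))^2)))"
    using assms(1) by (intro sum.cong refl) (simp add: complex_norm_square fcoeff_def cnj_ee del: of_real_power)
  moreover have "(\<Sum>j\<in>{0..<N}. f j * cnj (f j)) = of_real (\<Sum>j\<in>{0..<N}. (norm (f j))^2)"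
    by (simp add: complex_norm_square del: of_real_power)
  ultimately have "complex_of_real (of_int N * (\<Sum>m\<in>{a..<a+N}. (norm (fcoeff N f m))^2))
     = of_real (\<Sum>j\<in>{0..<N}. (norm (f j))^2)"
    using parseval_bilinear[of N f, OF assms, where a=a and g="\<lambda>j. cnj (f j)"] by (simp add: sum_distrib_left)
  then have "of_int N * (\<Sum>m\<in>{a..<a+N}. (norm (fcoeff N f m))^2) = (\<Sum>j\<in>{0..<N}. (norm (f j))^2)"
    using of_real_eq_iff by blast
  then show ?thesis using assms(1) by (simp add: field_simps)
qed

subsection \<open>The quadratic character\<close>

lemma sum_prod4:
  fixes f g h k :: "_ \<Rightarrow> 'a::comm_semiring_0"
  shows "(\<Sum>a\<in>A. f a) * (\<Sum>b\<in>B. g b) * (\<Sum>c\<in>C. h c) * (\<Sum>d\<in>D. k d)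
    = (\<Sum>a\<in>A. \<Sum>b\<in>B. \<Sum>c\<in>C. \<Sum>d\<in>D. f a * g b * h c * k d)"
proof -
  have "(\<Sum>a\<in>A. f a) * (\<Sum>b\<in>B. g b) * (\<Sum>c\<in>C. h c) * (\<Sum>d\<in>D. k d)
     = (\<Sum>a\<in>A. f a * (\<Sum>b\<in>B. g b * (\<Sum>c\<in>C. h c * (\<Sum>d\<in>D. k d))))"
    by (simp only: mult.assoc sum_distrib_right)
  then show ?thesis by (simp only: sum_distrib_left mult.assoc)
qed

lemma Legendre_cong: "p dvd a - b \<Longrightarrow> Legendre a p = Legendre b p"
proof -
  assume "p dvd a - b"
  then have "a mod p = b mod p" by (simp add: mod_eq_dvd_iff)
  then show ?thesis by (simp add: Legendre_def QuadRes_def cong_def)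
qed

lemma Legendre_period: "Legendre (a + p) p = Legendre a p"
  by (rule Legendre_cong) simp

lemma Legendre_eq_0_iff: "Legendre a p = 0 \<longleftrightarrow> p dvd a"
  by (simp add: Legendre_def cong_0_iff)

lemma Legendre_abs_le: "\<bar>Legendre a p\<bar> \<le> 1"
  by (simp add: Legendre_def)

lemma Legendre_one: "p > 1 \<Longrightarrow> Legendre 1 p = 1"
  by (auto simp: Legendre_def QuadRes_def cong_0_iff intro!: exI[of _ 1])

lemma Legendre_sq: "\<not> p dvd a \<Longrightarrow> Legendre a p * Legendre a p = 1"
  by (auto simp: Legendre_def cong_0_iff)

text \<open>Euler's criterion makes both sides congruent modulo \<open>p\<close>; they differ by at
  most 2, which is less than \<open>p\<close>.\<close>

lemma Legendre_mult:
  fixes p :: int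
  assumes "prime p" "p > 2"
  shows "Legendre (a * b) p = Legendre a p * Legendre b p"
proof -
  define q where "q = nat p"
  have q: "prime q" "2 < q" "int q = p" using assms by (auto simp: q_def)
  have "[Legendre (a * b) p = (a * b) ^ ((q - 1) div 2)] (mod p)"
    using euler_criterion[OF q(1,2), of "a * b"] q(3) by simp
  moreover have "[Legendre a p * Legendre b p = a ^ ((q - 1) div 2) * b ^ ((q - 1) div 2)] (mod p)"
    using euler_criterion[OF q(1,2)] q(3) by (intro cong_mult) simp_all
  ultimately have "[Legendre (a * b) p = Legendre a p * Legendre b p] (mod p)"
    by (metis cong_sym cong_trans power_mult_distrib)
  then have "p dvd Legendre (a * b) p - Legendre a p * Legendre b p"
    by (simp add: cong_iff_dvd_diff)
  moreover have "\<bar>Legendre (a * b) p - Legendre a p * Legendre b p\<bar> \<le> 2"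
    by (simp add: Legendre_def)
  ultimately show ?thesis
    using assms(2) dvd_imp_le_int[of "Legendre (a * b) p - Legendre a p * Legendre b p" p] by fastforce
qed

text \<open>Squaring identifies 1 and -1, so it is not injective on the nonzero residues and misses
  one of them.\<close>

lemma exists_nonresidue:
  fixes p :: int
  assumes "prime p" "p > 2"
  shows "\<exists>g. Legendre g p = -1"
proof -
  let ?R = "{1..<p}" and ?sq = "\<lambda>y. y\<^sup>2 mod p"
  have "?sq 1 = ?sq (p - 1)"
    by (simp add: power2_eq_square mod_eq_dvd_iff algebra_simps)
  then have "\<not> inj_on ?sq ?R" using assms(2) inj_onD[of ?sq ?R 1 "p - 1"] by auto
  then have "card (?sq ` ?R) < card ?R"
    by (meson card_image_le eq_card_imp_inj_on finite_atLeastLessThan_int nat_less_le)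
  then have "\<not> ?R \<subseteq> ?sq ` ?R" by (meson card_mono finite_atLeastLessThan_int finite_imageI leD)
  then obtain g where g: "g \<in> ?R" "g \<notin> ?sq ` ?R" by blast
  have nd: "\<not> p dvd g" using g(1) zdvd_not_zless[of g p] by auto
  have "\<not> QuadRes p g"
  proof
    assume "QuadRes p g"
    then obtain y where y: "y\<^sup>2 mod p = g mod p" by (auto simp: QuadRes_def cong_def)
    have "\<not> p dvd y" using y nd assms(1) by (metis dvd_0_right dvd_power mod_0_imp_dvd dvd_imp_mod_0 dvd_trans pos2)
    then have "y mod p \<noteq> 0" by (simp add: dvd_eq_mod_eq_0)
    moreover have "0 \<le> y mod p" "y mod p < p" using assms(2) by simp_all
    ultimately have "y mod p \<in> ?R" by simp
    moreover have "?sq (y mod p) = g" using y g(1) by (simp add: power_mod)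
    ultimately show False using g(2) by blast
  qed
  then show ?thesis using nd by (auto simp: Legendre_def cong_0_iff)
qed

lemma prime_coprime_int: "prime p \<Longrightarrow> \<not> p dvd c \<Longrightarrow> coprime c p" for p :: int
  using prime_imp_coprime[of p c] by (simp add: coprime_commute)

text \<open>Dilation by a nonresidue permutes the residues and changes the sign of the sum.\<close>

lemma Legendre_sum:
  fixes p :: int
  assumes "prime p" "p > 2"
  shows "(\<Sum>t\<in>{0..<p}. Legendre t p) = 0"
proof -
  obtain g where g: "Legendre g p = -1" using exists_nonresidue[OF assms] by blast
  then have "\<not> p dvd g" using Legendre_eq_0_iff[of g p] by simp
  then have "(\<Sum>t\<in>{0..<p}. Legendre (g * t) p) = (\<Sum>t\<in>{0..<p}. Legendre t p)"
    using assms by (intro sum_period_dilate[of "\<lambda>t. Legendre t p"] prime_coprime_int)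
      (auto simp: Legendre_period)
  then show ?thesis using g by (simp add: Legendre_mult[OF assms] sum_negf)
qed

lemma Legendre_sum_affine:
  fixes p :: int
  assumes "prime p" "p > 2" "\<not> p dvd a"
  shows "(\<Sum>t\<in>{0..<p}. Legendre (b + t * a) p) = 0"
proof -
  have "(\<Sum>t\<in>{0..<p}. Legendre (b + t * a) p) = (\<Sum>t\<in>{0..<p}. Legendre (a * t + b) p)"
    by (simp add: add.commute mult.commute)
  also have "\<dots> = (\<Sum>t\<in>{0..<p}. Legendre (t + b) p)"
    using assms Legendre_period[of "_ + b" p]
    by (intro sum_period_dilate[of "\<lambda>t. Legendre (t + b) p"] prime_coprime_int) (auto simp: algebra_simps)
  also have "\<dots> = (\<Sum>t\<in>{0..<p}. Legendre t p)"
    using assms by (intro sum_period_translate) (auto simp: Legendre_period)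
  finally show ?thesis using Legendre_sum[OF assms(1,2)] by simp
qed

text \<open>Dilating \<open>t\<close> by \<open>b\<close> shows that the correlation is the same for
  all shifts prime to \<open>p\<close>. Over all shifts the correlations add up to 0, and shift 0
  contributes \<open>p - 1\<close>.\<close>

lemma Legendre_correlation:
  fixes p :: int
  assumes p: "prime p" "p > 2" and a: "\<not> p dvd a"
  shows "(\<Sum>t\<in>{0..<p}. Legendre t p * Legendre (t + a) p) = -1"
proof -
  let ?c = "\<lambda>b. \<Sum>t\<in>{0..<p}. Legendre t p * Legendre (t + b) p"
  have c1: "?c b = ?c 1" if b: "\<not> p dvd b" for b
  proof -
    have per: "Legendre (k + p) p * Legendre (k + p + b) p = Legendre k p * Legendre (k + b) p" for k
      by (intro arg_cong2[where f="(*)"] Legendre_cong) auto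
    have "?c b = (\<Sum>t\<in>{0..<p}. Legendre (b * t) p * Legendre (b * t + b) p)"
      using p b by (intro sum_period_dilate[of "\<lambda>t. Legendre t p * Legendre (t + b) p", symmetric]
          prime_coprime_int per) auto
    also have "\<dots> = (\<Sum>t\<in>{0..<p}. (Legendre b p * Legendre b p) * (Legendre t p * Legendre (t + 1) p))"
    proof (intro sum.cong refl)
      fix t
      have "b * t + b = b * (t + 1)" by (simp add: algebra_simps)
      then show "Legendre (b * t) p * Legendre (b * t + b) p
        = (Legendre b p * Legendre b p) * (Legendre t p * Legendre (t + 1) p)"
        by (simp only: Legendre_mult[OF p] mult_ac)
    qed
    finally show ?thesis using Legendre_sq[OF b] by simp
  qed
  have nd: "\<not> p dvd b" if "b \<in> {1..<p}" for b using that zdvd_not_zless[of b p] by auto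
  have "{0..<p} = insert 0 {1..<p}" using p by auto
  then have R: "sum f {0..<p} = f 0 + sum f {1..<p}" for f :: "int \<Rightarrow> int" by simp
  have "(\<Sum>b\<in>{0..<p}. ?c b) = (\<Sum>t\<in>{0..<p}. Legendre t p * (\<Sum>b\<in>{0..<p}. Legendre (t + b * 1) p))"
    by (subst sum.swap) (simp add: sum_distrib_left)
  also have "\<dots> = 0" using p not_prime_unit[of p] by (subst Legendre_sum_affine) auto
  finally have "?c 0 + (\<Sum>b\<in>{1..<p}. ?c b) = 0" using R[of ?c] by simp
  moreover have "(\<Sum>b\<in>{1..<p}. ?c b) = (\<Sum>b\<in>{1..<p}. ?c 1)" by (intro sum.cong refl c1 nd)
  moreover have "?c 0 = p - 1"
  proof -
    have "?c 0 = (\<Sum>t\<in>{1..<p}. Legendre t p * Legendre t p)"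
      by (subst R) (simp add: Legendre_eq_0_iff)
    also have "\<dots> = (\<Sum>t\<in>{1..<p}. 1)" using nd Legendre_sq by (intro sum.cong) auto
    finally show ?thesis using p by simp
  qed
  ultimately have "(p - 1) * (1 + ?c 1) = 0" using p by (simp add: algebra_simps)
  then have "?c 1 = -1" using p by auto
  then show ?thesis using c1[OF a] by simp
qed

subsection \<open>Mordell's bound for four-point character sums\<close>

definition cubic :: "int \<times> int \<times> int \<times> int \<Rightarrow> int \<Rightarrow> int" where
  "cubic = (\<lambda>(A, B, C, D) s. A * s^3 + B * s^2 + C * s + D)"

lemma sum4_period_translate:
  fixes G :: "int \<times> int \<times> int \<times> int \<Rightarrow> int"
  assumes "N > 0"
    and "\<And>A B C D. G (A + N, B, C, D) = G (A, B, C, D)" "\<And>A B C D. G (A, B + N, C, D) = G (A, B, C, D)"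
    and "\<And>A B C D. G (A, B, C + N, D) = G (A, B, C, D)" "\<And>A B C D. G (A, B, C, D + N) = G (A, B, C, D)"
  shows "(\<Sum>(A, B, C, D)\<in>{0..<N}\<times>{0..<N}\<times>{0..<N}\<times>{0..<N}. G (A + a, B + b, C + c, D + d))
    = (\<Sum>x\<in>{0..<N}\<times>{0..<N}\<times>{0..<N}\<times>{0..<N}. G x)"
proof -
  let ?R = "{0..<N}"
  have "(\<Sum>(A, B, C, D)\<in>?R\<times>?R\<times>?R\<times>?R. G (A + a, B + b, C + c, D + d))
     = (\<Sum>A\<in>?R. \<Sum>B\<in>?R. \<Sum>C\<in>?R. \<Sum>D\<in>?R. G (A + a, B + b, C + c, D + d))"
    by (simp add: sum.cartesian_product)
  also have "\<dots> = (\<Sum>A\<in>?R. \<Sum>B\<in>?R. \<Sum>C\<in>?R. \<Sum>D\<in>?R. G (A + a, B + b, C + c, D))"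
    using assms by (intro sum.cong refl sum_period_translate[of "\<lambda>D. G (_, _, _, D)"]) auto
  also have "\<dots> = (\<Sum>A\<in>?R. \<Sum>B\<in>?R. \<Sum>C\<in>?R. \<Sum>D\<in>?R. G (A + a, B + b, C, D))"
    using assms by (intro sum.cong refl sum_period_translate[of "\<lambda>C. \<Sum>D\<in>?R. G (_, _, C, D)"]) auto
  also have "\<dots> = (\<Sum>A\<in>?R. \<Sum>B\<in>?R. \<Sum>C\<in>?R. \<Sum>D\<in>?R. G (A + a, B, C, D))"
    using assms by (intro sum.cong refl sum_period_translate[of "\<lambda>B. \<Sum>C\<in>?R. \<Sum>D\<in>?R. G (_, B, C, D)"]) auto
  also have "\<dots> = (\<Sum>A\<in>?R. \<Sum>B\<in>?R. \<Sum>C\<in>?R. \<Sum>D\<in>?R. G (A, B, C, D))"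
    using assms by (intro sum_period_translate[of "\<lambda>A. \<Sum>B\<in>?R. \<Sum>C\<in>?R. \<Sum>D\<in>?R. G (A, B, C, D)"]) auto
  finally show ?thesis by (simp add: sum.cartesian_product)
qed

text \<open>The reason why only pairings survive on average: if \<open>s1\<close> is isolated (the
  other points may coincide), the value at \<open>s1\<close> can be moved without touching the
  others, and averaging over the multiple \<open>l\<close> produces a complete Legendre sum over an
  affine function.\<close>

lemma cubic_family_cancel:
  fixes p :: int
  assumes p: "prime p" "p > 2"
    and s: "s1 \<in> {0..<p}" "s2 \<in> {0..<p}" "s3 \<in> {0..<p}" "s4 \<in> {0..<p}" "s1 \<noteq> s2" "s1 \<noteq> s3" "s1 \<noteq> s4"
  shows "(\<Sum>x\<in>{0..<p}\<times>{0..<p}\<times>{0..<p}\<times>{0..<p}.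
    Legendre (cubic x s1) p * Legendre (cubic x s2) p * Legendre (cubic x s3) p * Legendre (cubic x s4) p) = 0"
proof -
  let ?Q = "{0..<p}\<times>{0..<p}\<times>{0..<p}\<times>{0..<p}"
  let ?G = "\<lambda>x. Legendre (cubic x s1) p * Legendre (cubic x s2) p * Legendre (cubic x s3) p * Legendre (cubic x s4) p"
  let ?r = "\<lambda>x. Legendre (cubic x s2) p * Legendre (cubic x s3) p * Legendre (cubic x s4) p"
  define e where "e = (s1 - s2) * (s1 - s3) * (s1 - s4)"
  have nd: "\<not> p dvd s1 - t" if "t \<in> {0..<p}" "s1 \<noteq> t" for t
    using that s(1) dvd_imp_le_int[of "s1 - t" p] by auto
  have e: "\<not> p dvd e" unfolding e_def using nd s p by (simp add: prime_dvd_mult_iff)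
  have per: "?G (A + p, B, C, D) = ?G (A, B, C, D)" "?G (A, B + p, C, D) = ?G (A, B, C, D)"
    "?G (A, B, C + p, D) = ?G (A, B, C, D)" "?G (A, B, C, D + p) = ?G (A, B, C, D)" for A B C D
    by (intro arg_cong2[where f="(*)"] Legendre_cong; simp add: cubic_def algebra_simps)+
  \<comment> \<open>Adding \<open>l * (s - s2) * (s - s3) * (s - s4)\<close> to the cubic only changes its value at \<open>s1\<close>.\<close>
  have shift: "(\<Sum>x\<in>?Q. ?G x) = (\<Sum>x\<in>?Q. Legendre (cubic x s1 + l * e) p * ?r x)" for l
  proof -
    have "(\<Sum>x\<in>?Q. ?G x) = (\<Sum>(A, B, C, D)\<in>?Q. ?G (A + l, B + l * (- s2 - s3 - s4),
        C + l * (s2 * s3 + s2 * s4 + s3 * s4), D + l * (- s2 * s3 * s4)))"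
      using p by (intro sum4_period_translate[of p ?G, symmetric] per) auto
    also have "\<dots> = (\<Sum>x\<in>?Q. Legendre (cubic x s1 + l * e) p * ?r x)"
      by (intro sum.cong refl, clarify, unfold mult.assoc, intro arg_cong2[where f="(*)"] arg_cong2[where f=Legendre] refl)
         (simp_all add: cubic_def e_def power3_eq_cube power2_eq_square algebra_simps)
    finally show ?thesis .
  qed
  have "p * (\<Sum>x\<in>?Q. ?G x) = (\<Sum>l\<in>{0..<p}. \<Sum>x\<in>?Q. ?G x)" using p by simp
  also have "\<dots> = (\<Sum>l\<in>{0..<p}. \<Sum>x\<in>?Q. Legendre (cubic x s1 + l * e) p * ?r x)"
    by (intro sum.cong refl shift)
  also have "\<dots> = (\<Sum>x\<in>?Q. (\<Sum>l\<in>{0..<p}. Legendre (cubic x s1 + l * e) p) * ?r x)"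
    by (subst sum.swap) (simp add: sum_distrib_right)
  also have "\<dots> = 0" by (simp add: Legendre_sum_affine[OF p e])
  finally show ?thesis using p by simp
qed

text \<open>Four points that do not pair up include an isolated one, so their contribution vanishes.
  Each of the three pairings leaves \<open>p^2\<close> choices of points, each bounded trivially by
  \<open>p^4\<close>.\<close>

lemma cubic_fourth_moment:
  fixes p :: int
  assumes p: "prime p" "p > 2"
  shows "(\<Sum>x\<in>{0..<p}\<times>{0..<p}\<times>{0..<p}\<times>{0..<p}. (\<Sum>s\<in>{0..<p}. Legendre (cubic x s) p)^4) \<le> 3 * p^6"
proof -
  let ?R = "{0..<p}"
  let ?Q = "?R\<times>?R\<times>?R\<times>?R"
  let ?L = "\<lambda>x s. Legendre (cubic x s) p"
  define W where "W s1 s2 s3 s4 = (\<Sum>x\<in>?Q. ?L x s1 * ?L x s2 * ?L x s3 * ?L x s4)" for s1 s2 s3 s4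
  define ob :: "int \<Rightarrow> int \<Rightarrow> int" where "ob a b = (if a = b then 1 else 0)" for a b
  have W_perm: "W s1 s2 s3 s4 = W s2 s1 s3 s4" "W s1 s2 s3 s4 = W s3 s1 s2 s4" "W s1 s2 s3 s4 = W s4 s1 s2 s3" for s1 s2 s3 s4
    by (simp_all add: W_def mult_ac)
  have W_le: "W s1 s2 s3 s4 \<le> p^4" for s1 s2 s3 s4
  proof -
    have "W s1 s2 s3 s4 \<le> (\<Sum>x\<in>?Q. 1)"
      unfolding W_def
    proof (intro sum_mono)
      fix x
      have "\<bar>?L x s1 * ?L x s2 * ?L x s3 * ?L x s4\<bar> \<le> 1 * 1 * 1 * 1"
        unfolding abs_mult by (intro mult_mono Legendre_abs_le) auto
      then show "?L x s1 * ?L x s2 * ?L x s3 * ?L x s4 \<le> 1" by linarith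
    qed
    also have "\<dots> = p^4" using p by (simp add: card_cartesian_product power4_eq_xxxx)
    finally show ?thesis .
  qed
  have W: "W s1 s2 s3 s4 \<le> p^4 * (ob s1 s2 * ob s3 s4 + ob s1 s3 * ob s2 s4 + ob s1 s4 * ob s2 s3)"
    if s: "s1 \<in> ?R" "s2 \<in> ?R" "s3 \<in> ?R" "s4 \<in> ?R" for s1 s2 s3 s4
  proof (cases "(s1 = s2 \<and> s3 = s4) \<or> (s1 = s3 \<and> s2 = s4) \<or> (s1 = s4 \<and> s2 = s3)")
    case True
    then have "1 \<le> ob s1 s2 * ob s3 s4 + ob s1 s3 * ob s2 s4 + ob s1 s4 * ob s2 s3"
      by (auto simp: ob_def)
    then have "p^4 * 1 \<le> p^4 * (ob s1 s2 * ob s3 s4 + ob s1 s3 * ob s2 s4 + ob s1 s4 * ob s2 s3)"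
      using p by (intro mult_left_mono) auto
    then show ?thesis using W_le[of s1 s2 s3 s4] by linarith
  next
    case False
    have van: "W a b c d = 0" if "a \<in> ?R" "b \<in> ?R" "c \<in> ?R" "d \<in> ?R" "a \<noteq> b" "a \<noteq> c" "a \<noteq> d" for a b c d
      unfolding W_def using cubic_family_cancel[OF p that] .
    have "W s1 s2 s3 s4 = 0"
      using False van[of s1 s2 s3 s4] van[of s2 s1 s3 s4] van[of s3 s1 s2 s4] van[of s4 s1 s2 s3] s W_perm[of s1 s2 s3 s4]
      by metis
    then show ?thesis using p by (simp add: ob_def)
  qed
  have "(\<Sum>x\<in>?Q. (\<Sum>s\<in>?R. ?L x s)^4)
     = (\<Sum>x\<in>?Q. \<Sum>(s1, s2, s3, s4)\<in>?Q. ?L x s1 * ?L x s2 * ?L x s3 * ?L x s4)"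
    by (intro sum.cong refl) (simp only: power4_eq_xxxx sum_prod4, simp add: sum.cartesian_product)
  also have "\<dots> = (\<Sum>(s1, s2, s3, s4)\<in>?Q. W s1 s2 s3 s4)"
    by (subst sum.swap) (auto simp: W_def intro!: sum.cong)
  also have "\<dots> \<le> (\<Sum>(s1, s2, s3, s4)\<in>?Q. p^4 * (ob s1 s2 * ob s3 s4 + ob s1 s3 * ob s2 s4 + ob s1 s4 * ob s2 s3))"
    by (intro sum_mono) (use W in auto)
  also have "\<dots> = p^4 * (\<Sum>s1\<in>?R. \<Sum>s2\<in>?R. \<Sum>s3\<in>?R. \<Sum>s4\<in>?R.
      ob s1 s2 * ob s3 s4 + ob s1 s3 * ob s2 s4 + ob s1 s4 * ob s2 s3)"
    by (simp add: sum.cartesian_product sum_distrib_left case_prod_unfold)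
  also have "(\<Sum>s1\<in>?R. \<Sum>s2\<in>?R. \<Sum>s3\<in>?R. \<Sum>s4\<in>?R.
      ob s1 s2 * ob s3 s4 + ob s1 s3 * ob s2 s4 + ob s1 s4 * ob s2 s3) = 3 * p^2"
  proof -
    have o: "(\<Sum>b\<in>?R. ob a b) = 1" if "a \<in> ?R" for a using that by (simp add: ob_def)
    have "(\<Sum>s1\<in>?R. \<Sum>s2\<in>?R. \<Sum>s3\<in>?R. \<Sum>s4\<in>?R. ob s1 s2 * ob s3 s4) = p^2"
      using p by (simp add: sum_distrib_left[symmetric] sum_distrib_right[symmetric] o power2_eq_square)
    moreover have "(\<Sum>s1\<in>?R. \<Sum>s2\<in>?R. \<Sum>s3\<in>?R. \<Sum>s4\<in>?R. ob s1 s3 * ob s2 s4) = p^2"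
      using p by (simp add: sum_distrib_left[symmetric] sum_distrib_right[symmetric] o power2_eq_square)
    moreover have "(\<Sum>s1\<in>?R. \<Sum>s2\<in>?R. \<Sum>s3\<in>?R. \<Sum>s4\<in>?R. ob s1 s4 * ob s2 s3) = p^2"
      using p by (simp add: sum_distrib_left[symmetric] sum_distrib_right[symmetric] o power2_eq_square)
    ultimately show ?thesis by (simp add: sum.distrib)
  qed
  finally show ?thesis by (simp add: power_add[symmetric] algebra_simps)
qed

lemma prime_linear_root:
  fixes p :: int
  assumes "prime p" "\<not> p dvd a"
  shows "\<exists>s\<in>{0..<p}. p dvd a * s + b"
proof -
  have "coprime a p" using assms prime_coprime_int by blast
  then obtain x where "[a * x = 1] (mod p)" using cong_solve_coprime_int by blast
  then have "p dvd a * x - 1" by (simp add: cong_iff_dvd_diff)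
  then have "p dvd (a * x - 1) * (- b)" by (rule dvd_mult2)
  then have "p dvd a * (- b * x) + b" by (simp add: algebra_simps)
  moreover have "p dvd a * (- b * x) - a * ((- b * x) mod p)"
    by (metis dvd_minus_mod dvd_mult right_diff_distrib)
  ultimately have "p dvd (a * (- b * x) + b) - (a * (- b * x) - a * ((- b * x) mod p))"
    by (rule dvd_diff)
  then have "p dvd a * ((- b * x) mod p) + b" by (simp add: algebra_simps)
  moreover have "(- b * x) mod p \<in> {0..<p}" using prime_gt_0_int[OF assms(1)] by simp
  ultimately show ?thesis by blast
qed

lemma residue_eqI: "x \<in> {0..<p} \<Longrightarrow> y \<in> {0..<p} \<Longrightarrow> p dvd x - y \<Longrightarrow> x = y" for p x y :: int
  using mod_eq_dvd_iff[of x p y] by simp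

text \<open>Mordell's averaging: the affine substitutions of a given cubic, up to multiples, form a large part of the family
  whose fourth moment is known, and all of them have the same character sum up to sign.\<close>
lemma cubic_character_sum:
  fixes p b c d :: int
  assumes p: "prime p" "p > 2" and nd: "\<not> p dvd b" "\<not> p dvd c" "\<not> p dvd d"
    and bc: "\<not> p dvd b - c"
  shows "(p - 1)^2 * (\<Sum>s\<in>{0..<p}. Legendre ((1 + b * s) * (1 + c * s) * (1 + d * s)) p)^4 \<le> 27 * p^5"
proof -
  let ?R = "{0..<p}"
  let ?Q = "?R\<times>?R\<times>?R\<times>?R"
  define f where "f s = (1 + b * s) * (1 + c * s) * (1 + d * s)" for s
  define V where "V = (\<Sum>s\<in>?R. Legendre (f s) p)"
  define X where "X = {1..<p} \<times> {1..<p} \<times> ?R"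
  define g where "g x = (\<Sum>s\<in>?R. Legendre (cubic x s) p)^4" for x
  \<comment> \<open>The coefficients of \<open>D * f (\<alpha> * s + \<beta>)\<close> as a
    polynomial in \<open>s\<close>, from the cubic one down to the constant one, reduced modulo
    \<open>p\<close>.\<close>
  define \<Psi> where "\<Psi> = (\<lambda>(D, \<alpha>, \<beta>).
     ((D * (b * \<alpha>) * (c * \<alpha>) * (d * \<alpha>)) mod p,
      (D * ((1 + b * \<beta>) * (c * \<alpha>) * (d * \<alpha>) + (b * \<alpha>) * (1 + c * \<beta>) * (d * \<alpha>) + (b * \<alpha>) * (c * \<alpha>) * (1 + d * \<beta>))) mod p,
      (D * ((1 + b * \<beta>) * (1 + c * \<beta>) * (d * \<alpha>) + (1 + b * \<beta>) * (c * \<alpha>) * (1 + d * \<beta>) + (b * \<alpha>) * (1 + c * \<beta>) * (1 + d * \<beta>))) mod p,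
      (D * (1 + b * \<beta>) * (1 + c * \<beta>) * (1 + d * \<beta>)) mod p))"
  have p1: "p > 1" using p by simp
  have unit: "\<not> p dvd x" if "x \<in> {1..<p}" for x using that zdvd_not_zless[of x p] by auto
  have expand: "(D * b1 * c1 * d1) * s^3 + (D * (b0 * c1 * d1 + b1 * c0 * d1 + b1 * c1 * d0)) * s^2
      + (D * (b0 * c0 * d1 + b0 * c1 * d0 + b1 * c0 * d0)) * s + (D * b0 * c0 * d0)
      = D * ((b0 + b1 * s) * (c0 + c1 * s) * (d0 + d1 * s))" for b0 b1 c0 c1 d0 d1 s D :: int
    by (simp add: algebra_simps power2_eq_square power3_eq_cube)
  have \<Psi>_val: "p dvd D * f (\<alpha> * s + \<beta>) - cubic (\<Psi> (D, \<alpha>, \<beta>)) s" for D \<alpha> \<beta> s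
  proof -
    have m: "[x mod p = x] (mod p)" for x by simp
    have "[cubic (\<Psi> (D, \<alpha>, \<beta>)) s = (D * (b * \<alpha>) * (c * \<alpha>) * (d * \<alpha>)) * s^3
      + (D * ((1 + b * \<beta>) * (c * \<alpha>) * (d * \<alpha>) + (b * \<alpha>) * (1 + c * \<beta>) * (d * \<alpha>) + (b * \<alpha>) * (c * \<alpha>) * (1 + d * \<beta>))) * s^2
      + (D * ((1 + b * \<beta>) * (1 + c * \<beta>) * (d * \<alpha>) + (1 + b * \<beta>) * (c * \<alpha>) * (1 + d * \<beta>) + (b * \<alpha>) * (1 + c * \<beta>) * (1 + d * \<beta>))) * s
      + (D * (1 + b * \<beta>) * (1 + c * \<beta>) * (1 + d * \<beta>))] (mod p)"
      unfolding \<Psi>_def cubic_def prod.case by (intro cong_add cong_mult m cong_refl)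
    moreover have "(D * (b * \<alpha>) * (c * \<alpha>) * (d * \<alpha>)) * s^3
      + (D * ((1 + b * \<beta>) * (c * \<alpha>) * (d * \<alpha>) + (b * \<alpha>) * (1 + c * \<beta>) * (d * \<alpha>) + (b * \<alpha>) * (c * \<alpha>) * (1 + d * \<beta>))) * s^2
      + (D * ((1 + b * \<beta>) * (1 + c * \<beta>) * (d * \<alpha>) + (1 + b * \<beta>) * (c * \<alpha>) * (1 + d * \<beta>) + (b * \<alpha>) * (1 + c * \<beta>) * (1 + d * \<beta>))) * s
      + (D * (1 + b * \<beta>) * (1 + c * \<beta>) * (1 + d * \<beta>)) = D * f (\<alpha> * s + \<beta>)"
    proof -
      have e: "1 + e * (\<alpha> * s + \<beta>) = (1 + e * \<beta>) + (e * \<alpha>) * s" for e by (simp add: algebra_simps)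
      show ?thesis unfolding f_def e by (rule expand)
    qed
    ultimately have "[cubic (\<Psi> (D, \<alpha>, \<beta>)) s = D * f (\<alpha> * s + \<beta>)] (mod p)" by simp
    then show ?thesis by (metis cong_iff_dvd_diff cong_sym)
  qed
  have \<Psi>_Q: "\<Psi> x \<in> ?Q" for x using p by (cases x) (simp add: \<Psi>_def)
  have g\<Psi>: "g (\<Psi> x) = V^4" if "x \<in> X" for x
  proof -
    obtain D \<alpha> \<beta> where x: "x = (D, \<alpha>, \<beta>)" by (cases x)
    then have u: "\<not> p dvd D" "\<not> p dvd \<alpha>" using that unit by (auto simp: X_def)
    have perf: "p dvd f (s + p) - f s" for s
    proof -
      have "[f (s + p) = f s] (mod p)" unfolding f_def
        by (intro cong_mult cong_add cong_refl) (simp add: cong_def)+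
      then show ?thesis by (simp add: cong_iff_dvd_diff)
    qed
    have "(\<Sum>s\<in>?R. Legendre (cubic (\<Psi> x) s) p) = (\<Sum>s\<in>?R. Legendre (D * f (\<alpha> * s + \<beta>)) p)"
      unfolding x by (intro sum.cong refl Legendre_cong[symmetric] \<Psi>_val)
    also have "\<dots> = Legendre D p * (\<Sum>s\<in>?R. Legendre (f (\<alpha> * s + \<beta>)) p)"
      by (simp add: Legendre_mult[OF p] sum_distrib_left)
    also have "(\<Sum>s\<in>?R. Legendre (f (\<alpha> * s + \<beta>)) p) = (\<Sum>s\<in>?R. Legendre (f (s + \<beta>)) p)"
      using p u(2) perf[of "_ + \<beta>"]
      by (intro sum_period_dilate[of "\<lambda>s. Legendre (f (s + \<beta>)) p"] prime_coprime_int Legendre_cong)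
         (auto simp: algebra_simps)
    also have "\<dots> = V" unfolding V_def
      using p perf by (intro sum_period_translate[of "\<lambda>s. Legendre (f s) p"] Legendre_cong) auto
    finally have "g (\<Psi> x) = (Legendre D p * Legendre D p)^2 * V^4"
      by (simp add: g_def power_mult_distrib power2_eq_square power4_eq_xxxx)
    then show ?thesis using Legendre_sq[OF u(1)] by simp
  qed
  \<comment> \<open>Affine substitutions move the roots. All cubics of a fibre share the at most
    three zeros of \<open>\<Psi> x0\<close>; which zero belongs to \<open>b\<close> and which to
    \<open>c\<close> fixes \<open>\<alpha>\<close> and \<open>\<beta>\<close>, because
    \<open>b\<close> and \<open>c\<close> differ modulo \<open>p\<close>, and the leading
    coefficient then fixes \<open>D\<close>. Hence at most 3 * 3 elements.\<close>
  have fibre: "card {x \<in> X. \<Psi> x = \<Psi> x0} \<le> 9" if x0: "x0 \<in> X" for x0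
  proof -
    define root where "root e \<alpha> \<beta> = (SOME s. s \<in> ?R \<and> p dvd e * \<alpha> * s + (1 + e * \<beta>))" for e \<alpha> \<beta>
    have root: "root e \<alpha> \<beta> \<in> ?R \<and> p dvd e * \<alpha> * root e \<alpha> \<beta> + (1 + e * \<beta>)"
      if "\<not> p dvd e" "\<not> p dvd \<alpha>" for e \<alpha> \<beta>
      unfolding root_def
      by (rule someI_ex, use prime_linear_root[of p "e * \<alpha>" "1 + e * \<beta>"] that p prime_dvd_mult_iff[of p e \<alpha>] in blast)
    obtain D0 \<alpha>0 \<beta>0 where x0_eq: "x0 = (D0, \<alpha>0, \<beta>0)" by (cases x0)
    have u0: "\<not> p dvd D0" "\<not> p dvd \<alpha>0" using x0 unit by (auto simp: X_def x0_eq)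
    let ?Z = "{root b \<alpha>0 \<beta>0, root c \<alpha>0 \<beta>0, root d \<alpha>0 \<beta>0}"
    have inZ: "s \<in> ?Z" if s: "s \<in> ?R" "p dvd cubic (\<Psi> x0) s" for s
    proof -
      have uniq: "s = root e \<alpha>0 \<beta>0" if e: "\<not> p dvd e" and z: "p dvd 1 + e * (\<alpha>0 * s + \<beta>0)" for e
      proof -
        have "p dvd (1 + e * (\<alpha>0 * s + \<beta>0)) - (e * \<alpha>0 * root e \<alpha>0 \<beta>0 + (1 + e * \<beta>0))"
          using z root[OF e u0(2)] by (intro dvd_diff) auto
        then have "p dvd e * (\<alpha>0 * (s - root e \<alpha>0 \<beta>0))" by (simp add: algebra_simps)
        then have "p dvd s - root e \<alpha>0 \<beta>0" using e u0(2) p by (simp add: prime_dvd_mult_iff)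
        then show ?thesis using s(1) root[OF e u0(2)] by (intro residue_eqI) auto
      qed
      have "p dvd D0 * f (\<alpha>0 * s + \<beta>0)"
        using s(2) \<Psi>_val[of D0 \<alpha>0 s \<beta>0] unfolding x0_eq by (metis diff_add_cancel dvd_add)
      then have "p dvd 1 + b * (\<alpha>0 * s + \<beta>0) \<or> p dvd 1 + c * (\<alpha>0 * s + \<beta>0) \<or> p dvd 1 + d * (\<alpha>0 * s + \<beta>0)"
        using p u0 by (auto simp: f_def prime_dvd_mult_iff)
      then show ?thesis using uniq nd by blast
    qed
    let ?F = "{x \<in> X. \<Psi> x = \<Psi> x0}"
    let ?h = "\<lambda>(D, \<alpha>, \<beta>). (root b \<alpha> \<beta>, root c \<alpha> \<beta>)"
    have "(root b \<alpha> \<beta>, root c \<alpha> \<beta>) \<in> ?Z \<times> ?Z"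
      if a: "(D, \<alpha>, \<beta>) \<in> X" "\<Psi> (D, \<alpha>, \<beta>) = \<Psi> x0" for D \<alpha> \<beta>
    proof -
      have u: "\<not> p dvd \<alpha>" using a(1) unit by (auto simp: X_def)
      have "p dvd cubic (\<Psi> x0) (root e \<alpha> \<beta>)" if e: "e = b \<or> e = c" for e
      proof -
        have "p dvd 1 + e * (\<alpha> * root e \<alpha> \<beta> + \<beta>)" using root[of e \<alpha> \<beta>] e nd u by (auto simp: algebra_simps)
        then have "p dvd D * f (\<alpha> * root e \<alpha> \<beta> + \<beta>)" using e by (auto simp: f_def)
        then show ?thesis using \<Psi>_val[of D \<alpha> "root e \<alpha> \<beta>" \<beta>] a(2) by (metis dvd_diff_right_iff)
      qed
      then show "(root b \<alpha> \<beta>, root c \<alpha> \<beta>) \<in> ?Z \<times> ?Z"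
        using root[OF nd(1) u] root[OF nd(2) u] by (intro SigmaI inZ) auto
    qed
    then have "?h ` ?F \<subseteq> ?Z \<times> ?Z" by (intro image_subsetI) (auto simp only: mem_Collect_eq prod.case split: prod.splits)
    moreover have "inj_on ?h ?F"
    proof (rule inj_onI)
      fix x y assume xy: "x \<in> ?F" "y \<in> ?F" "?h x = ?h y"
      obtain D \<alpha> \<beta> where x: "x = (D, \<alpha>, \<beta>)" by (cases x)
      obtain D' \<alpha>' \<beta>' where y: "y = (D', \<alpha>', \<beta>')" by (cases y)
      have a: "(D, \<alpha>, \<beta>) \<in> X" "\<Psi> (D, \<alpha>, \<beta>) = \<Psi> x0" "(D', \<alpha>', \<beta>') \<in> X" "\<Psi> (D', \<alpha>', \<beta>') = \<Psi> x0"
        and eq: "root b \<alpha> \<beta> = root b \<alpha>' \<beta>'" "root c \<alpha> \<beta> = root c \<alpha>' \<beta>'"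
        using xy unfolding x y by simp_all
      have u: "\<not> p dvd \<alpha>" "\<not> p dvd \<alpha>'" using a unit by (auto simp: X_def)
      define s t where "s = root b \<alpha> \<beta>" and "t = root c \<alpha> \<beta>"
      have s: "p dvd b * \<alpha> * s + (1 + b * \<beta>)" "p dvd b * \<alpha>' * s + (1 + b * \<beta>')"
        using root[OF nd(1) u(1), of \<beta>] root[OF nd(1) u(2), of \<beta>'] unfolding s_def eq(1) by auto
      have t: "p dvd c * \<alpha> * t + (1 + c * \<beta>)" "p dvd c * \<alpha>' * t + (1 + c * \<beta>')"
        using root[OF nd(2) u(1), of \<beta>] root[OF nd(2) u(2), of \<beta>'] unfolding t_def eq(2) by auto
      have "p dvd b * ((\<alpha> - \<alpha>') * s + (\<beta> - \<beta>'))" using dvd_diff[OF s] by (simp add: algebra_simps)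
      then have s': "p dvd (\<alpha> - \<alpha>') * s + (\<beta> - \<beta>')" using nd p by (simp add: prime_dvd_mult_iff)
      have "p dvd c * ((\<alpha> - \<alpha>') * t + (\<beta> - \<beta>'))" using dvd_diff[OF t] by (simp add: algebra_simps)
      then have t': "p dvd (\<alpha> - \<alpha>') * t + (\<beta> - \<beta>')" using nd p by (simp add: prime_dvd_mult_iff)
      have st: "\<not> p dvd s - t"
      proof
        assume "p dvd s - t"
        moreover have "c * (b * \<alpha> * s + (1 + b * \<beta>)) - b * (c * \<alpha> * t + (1 + c * \<beta>)) - b * c * \<alpha> * (s - t) = c - b"
          by (simp add: algebra_simps)
        ultimately have "p dvd c - b" using s(1) t(1) by (metis dvd_diff dvd_mult)
        then show False using bc by (simp add: dvd_diff_commute)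
      qed
      have "p dvd (\<alpha> - \<alpha>') * (s - t)" using dvd_diff[OF s' t'] by (simp add: algebra_simps)
      then have "p dvd \<alpha> - \<alpha>'" using st p by (simp add: prime_dvd_mult_iff)
      then have \<alpha>: "\<alpha> = \<alpha>'" using a by (intro residue_eqI[of _ p]) (auto simp: X_def)
      then have "p dvd \<beta> - \<beta>'" using s' by simp
      then have \<beta>: "\<beta> = \<beta>'" using a by (intro residue_eqI[of _ p]) (auto simp: X_def)
      have "fst (\<Psi> (D, \<alpha>, \<beta>)) = fst (\<Psi> (D', \<alpha>, \<beta>'))" using a(2,4) \<alpha> by simp
      then have "(D * (b * \<alpha>) * (c * \<alpha>) * (d * \<alpha>)) mod p = (D' * (b * \<alpha>) * (c * \<alpha>) * (d * \<alpha>)) mod p"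
        by (simp add: \<Psi>_def)
      then have "p dvd (D - D') * ((b * \<alpha>) * (c * \<alpha>) * (d * \<alpha>))"
        by (simp add: mod_eq_dvd_iff algebra_simps)
      then have "p dvd D - D'" using u nd p by (simp add: prime_dvd_mult_iff)
      then have "D = D'" using a by (intro residue_eqI[of _ p]) (auto simp: X_def)
      then show "x = y" using \<alpha> \<beta> by (simp add: x y)
    qed
    ultimately have "card ?F \<le> card (?Z \<times> ?Z)" by (intro card_inj_on_le[of ?h]) auto
    also have "\<dots> \<le> 3 * 3" unfolding card_cartesian_product
      by (intro mult_le_mono) (simp_all add: card_insert_if)
    finally show ?thesis by simp
  qed
  have finX: "finite X" by (simp add: X_def)
  \<comment> \<open>Double counting: all \<open>(p - 1)^2 * p\<close> substitutions have the same
    fourth power \<open>V^4\<close>. The fibres cost a factor 9 and the fourth moment a factor 3,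
    whence 27.\<close>
  have "(p - 1)^2 * p * V^4 = (\<Sum>x\<in>X. g (\<Psi> x))"
    using g\<Psi> p1 by (simp add: X_def card_cartesian_product power2_eq_square)
  also have "\<dots> = (\<Sum>y\<in>\<Psi> ` X. \<Sum>x\<in>{x \<in> X. \<Psi> x = y}. g (\<Psi> x))"
    by (rule sum.image_gen[OF finX])
  also have "\<dots> = (\<Sum>y\<in>\<Psi> ` X. int (card {x \<in> X. \<Psi> x = y}) * g y)"
    by (intro sum.cong refl) simp
  also have "\<dots> \<le> (\<Sum>y\<in>\<Psi> ` X. 9 * g y)"
    using fibre by (intro sum_mono mult_right_mono) (auto simp: g_def)
  also have "\<dots> \<le> (\<Sum>y\<in>?Q. 9 * g y)"
    by (intro sum_mono2 image_subsetI \<Psi>_Q) (auto simp: g_def)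
  also have "\<dots> = 9 * (\<Sum>y\<in>?Q. g y)" by (simp add: sum_distrib_left)
  also have "\<dots> \<le> 9 * (3 * p^6)" using cubic_fourth_moment[OF p] unfolding g_def by (intro mult_left_mono) auto
  finally have "p * ((p - 1)^2 * V^4) \<le> p * (27 * p^5)" by (simp add: algebra_simps eval_nat_numeral)
  then show ?thesis using p unfolding V_def f_def by simp
qed

text \<open>After translating \<open>a1\<close> to 0, the inversion of \<open>t\<close> splits off
  the fourth power of \<open>t\<close> and turns the quartic into the cubic of Mordell's bound. The
  point \<open>a4\<close> may coincide with \<open>a2\<close> or \<open>a3\<close>.\<close>

lemma four_point_sum:
  fixes p :: int
  assumes p: "prime p" "p > 2"
    and d: "\<not> p dvd a2 - a1" "\<not> p dvd a3 - a1" "\<not> p dvd a4 - a1" "\<not> p dvd a2 - a3"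
  shows "\<bar>real_of_int (\<Sum>t\<in>{0..<p}. Legendre (t + a1) p * Legendre (t + a2) p * Legendre (t + a3) p * Legendre (t + a4) p)\<bar>
    \<le> 4 * of_int p powr (3/4)"
proof -
  let ?L = "\<lambda>t. Legendre t p"
  define b c d where "b = a2 - a1" and "c = a3 - a1" and "d = a4 - a1"
  have nd: "\<not> p dvd b" "\<not> p dvd c" "\<not> p dvd d" "\<not> p dvd b - c" using d by (simp_all add: b_def c_def d_def)
  define V where "V = (\<Sum>s\<in>{0..<p}. ?L ((1 + b * s) * (1 + c * s) * (1 + d * s)))"
  have unit: "\<not> p dvd x" if "x \<in> {1..<p}" for x using that zdvd_not_zless[of x p] by auto
  have "{0..<p} = insert 0 {1..<p}" using p by auto
  then have R: "sum f {0..<p} = f 0 + sum f {1..<p}" for f :: "int \<Rightarrow> int" by simp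
  define \<iota> where "\<iota> t = (SOME s. s \<in> {0..<p} \<and> p dvd t * s + -1)" for t
  have \<iota>0: "\<iota> t \<in> {0..<p} \<and> p dvd t * \<iota> t + -1" if "t \<in> {1..<p}" for t
    unfolding \<iota>_def by (rule someI_ex, use prime_linear_root[of p t "-1"] p(1) unit[OF that] in blast)
  have \<iota>: "\<iota> t \<in> {1..<p}" "p dvd t * \<iota> t - 1" if "t \<in> {1..<p}" for t
  proof -
    show a: "p dvd t * \<iota> t - 1" using \<iota>0[OF that] by simp
    have "\<iota> t \<noteq> 0" using a p not_prime_unit[of p] by auto
    then show "\<iota> t \<in> {1..<p}" using \<iota>0[OF that] by auto
  qed
  have inv: "\<iota> (\<iota> t) = t" if t: "t \<in> {1..<p}" for t
  proof -
    have "t * (\<iota> t * \<iota> (\<iota> t) - 1) - \<iota> (\<iota> t) * (t * \<iota> t - 1) = \<iota> (\<iota> t) - t" by (simp add: algebra_simps)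
    moreover have "p dvd t * (\<iota> t * \<iota> (\<iota> t) - 1) - \<iota> (\<iota> t) * (t * \<iota> t - 1)"
      using \<iota>(2)[OF t] \<iota>(2)[OF \<iota>(1)[OF t]] by (meson dvd_diff dvd_mult)
    ultimately show ?thesis using \<iota>(1)[OF \<iota>(1)[OF t]] t by (intro residue_eqI[of _ p]) auto
  qed
  let ?F = "\<lambda>t. ?L t * ?L (t + b) * ?L (t + c) * ?L (t + d)"
  have "(\<Sum>t\<in>{0..<p}. ?L (t + a1) * ?L (t + a2) * ?L (t + a3) * ?L (t + a4)) = (\<Sum>t\<in>{0..<p}. ?F (t + a1))"
    by (simp add: b_def c_def d_def)
  also have "\<dots> = (\<Sum>t\<in>{0..<p}. ?F t)"
    using p by (intro sum_period_translate[of ?F] arg_cong2[where f="(*)"] Legendre_cong) auto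
  also have "\<dots> = (\<Sum>t\<in>{1..<p}. ?F t)" by (subst R) (simp add: Legendre_eq_0_iff)
  also have "\<dots> = (\<Sum>s\<in>{1..<p}. ?L ((1 + b * s) * (1 + c * s) * (1 + d * s)))"
  proof (rule sum.reindex_bij_witness[of _ \<iota> \<iota>])
    fix t assume t: "t \<in> {1..<p}"
    show "\<iota> (\<iota> t) = t" "\<iota> (\<iota> t) = t" "\<iota> t \<in> {1..<p}" "\<iota> t \<in> {1..<p}" using inv \<iota> t by auto
    define s where "s = \<iota> t"
    have s: "s \<in> {1..<p}" "p dvd t * s - 1" using \<iota>[OF t] by (auto simp: s_def)
    have one: "?L (t * s) = 1" using Legendre_cong[OF s(2)] Legendre_one p by simp
    have L: "?L (1 + e * s) = ?L (t + e) * ?L s" for e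
    proof -
      have "p dvd (1 + e * s) - (t + e) * s" using s(2) by (simp add: algebra_simps dvd_diff_commute)
      then show ?thesis using Legendre_cong Legendre_mult[OF p] by metis
    qed
    have "?L s * ?L s = 1" using Legendre_sq unit s by blast
    moreover have "?L t = ?L s"
    proof -
      have "?L t * ?L s = 1" using one Legendre_mult[OF p] by simp
      then show ?thesis using \<open>?L s * ?L s = 1\<close> by (metis mult.assoc mult.commute mult_1)
    qed
    ultimately show "?L ((1 + b * \<iota> t) * (1 + c * \<iota> t) * (1 + d * \<iota> t)) = ?F t"
      unfolding s_def[symmetric] by (simp add: Legendre_mult[OF p] L mult_ac)
  qed
  \<comment> \<open>The cubic sum includes \<open>s = 0\<close>, which is not the inverse of any
    \<open>t\<close> and contributes 1.\<close>
  also have "\<dots> = V - 1" unfolding V_def using R[of "\<lambda>s. ?L ((1 + b * s) * (1 + c * s) * (1 + d * s))"] Legendre_one[of p] p by simp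
  finally have S: "(\<Sum>t\<in>{0..<p}. ?L (t + a1) * ?L (t + a2) * ?L (t + a3) * ?L (t + a4)) = V - 1" .
  have "(p - 1)^2 * V^4 \<le> 27 * p^5" using cubic_character_sum[OF p nd] by (simp add: V_def)
  then have "real_of_int ((p - 1)^2 * V^4) \<le> real_of_int (27 * p^5)" by (simp only: of_int_le_iff)
  then have V: "(real_of_int p - 1)^2 * real_of_int V^4 \<le> 27 * real_of_int p^5" by simp
  have p3: "real_of_int p \<ge> 3" using p by simp
  \<comment> \<open>For \<open>p >= 3\<close> one has \<open>p - 1 >= 2 / 3 * p\<close>. Then 27 * 9
    / 4 < 81 = 3^4, and the extra point \<open>s = 0\<close> raises the constant from 3 to
    4.\<close>
  have "(2 / 3 * real_of_int p)^2 * real_of_int V^4 \<le> (real_of_int p - 1)^2 * real_of_int V^4"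
    using p3 by (intro mult_right_mono power_mono) auto
  moreover have "(2 / 3 * real_of_int p)^2 * real_of_int V^4 = 4 / 9 * (real_of_int p^2 * real_of_int V^4)"
    by (simp add: power_mult_distrib power2_eq_square)
  moreover have "real_of_int p^5 = real_of_int p^2 * real_of_int p^3" by (simp add: power_add[symmetric])
  moreover have "0 \<le> real_of_int p^2 * real_of_int p^3" using p3 by simp
  ultimately have "real_of_int p^2 * (real_of_int V^4) \<le> real_of_int p^2 * (81 * real_of_int p^3)"
    using V by linarith
  then have "real_of_int V^4 \<le> 81 * real_of_int p^3" using p3 by simp
  also have "\<dots> = (3 * real_of_int p powr (3/4))^4"
    using p3 by (simp add: power_mult_distrib powr_power)
  finally have "\<bar>real_of_int V\<bar>^4 \<le> (3 * real_of_int p powr (3/4))^4" by simp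
  then have "\<bar>real_of_int V\<bar> \<le> 3 * real_of_int p powr (3/4)"
    by (subst (asm) power_mono_iff) auto
  moreover have "1 \<le> real_of_int p powr (3/4)" using p3 by (intro ge_one_powr_ge_zero) auto
  ultimately show ?thesis unfolding S by simp
qed

subsection \<open>Gauss sums and the Fourier transform of the sequence\<close>

lemma norm_Legendre_sq: "(norm (of_int (Legendre t p) :: complex))^2 = (if p dvd t then 0 else 1)"
  by (simp add: Legendre_def cong_0_iff)

text \<open>Twisting by \<open>k\<close> multiplies the Gauss sum by the Legendre symbol of
  \<open>k\<close>, so the transform has constant modulus off the multiples of \<open>p\<close> and
  vanishes on them. Parseval's identity then forces the modulus of \<open>G\<close>.\<close>

lemma gauss_sum:
  fixes p :: int
  assumes p: "prime p" "p > 2"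
  obtains G :: complex where "(norm G)^2 = of_int p"
    and "\<And>k. (\<Sum>u\<in>{0..<p}. of_int (Legendre u p) * ee p (u * k)) = of_int (Legendre k p) * G"
proof
  define G where "G = (\<Sum>u\<in>{0..<p}. of_int (Legendre u p) * ee p u)"
  have p0: "p > 0" using p by simp
  show tw: "(\<Sum>u\<in>{0..<p}. of_int (Legendre u p) * ee p (u * k)) = of_int (Legendre k p) * G" for k
  proof (cases "p dvd k")
    case True
    have "(\<Sum>u\<in>{0..<p}. of_int (Legendre u p) * ee p (u * k)) = of_int (\<Sum>u\<in>{0..<p}. Legendre u p)"
      using True p0 by (simp add: ee_dvd)
    then show ?thesis using Legendre_sum[OF p] True Legendre_eq_0_iff[of k p] by simp
  next
    case False
    have "G = (\<Sum>u\<in>{0..<p}. of_int (Legendre (k * u) p) * ee p (k * u))"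
      unfolding G_def using p0 p False
      by (intro sum_period_dilate[of "\<lambda>u. of_int (Legendre u p) * ee p u", symmetric] prime_coprime_int)
         (auto simp: Legendre_period ee_period)
    also have "\<dots> = of_int (Legendre k p) * (\<Sum>u\<in>{0..<p}. of_int (Legendre u p) * ee p (u * k))"
      by (simp add: Legendre_mult[OF p] sum_distrib_left mult_ac)
    finally have "of_int (Legendre k p) * G
      = of_int (Legendre k p * Legendre k p) * (\<Sum>u\<in>{0..<p}. of_int (Legendre u p) * ee p (u * k))" by simp
    then show ?thesis using Legendre_sq[OF False] by simp
  qed
  let ?f = "\<lambda>t. of_int (Legendre t p) :: complex"
  have cnt: "(\<Sum>t\<in>{0..<p}. (if p dvd t then 0 else 1 :: real)) = of_int p - 1"
  proof -
    have "{0..<p} = insert 0 {1..<p}" using p by auto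
    moreover have "(\<Sum>t\<in>{1..<p}. (if p dvd t then 0 else 1 :: real)) = (\<Sum>t\<in>{1..<p}. 1)"
      by (intro sum.cong refl) (use zdvd_not_zless in auto)
    ultimately show ?thesis using p by simp
  qed
  have fc: "fcoeff p ?f m = of_int (Legendre (- m) p) * G / of_int p" for m
    unfolding fcoeff_def using tw[of "- m"] by simp
  define C where "C = (norm G)^2 / (of_int p)^2"
  have "(\<Sum>m\<in>{0..<0+p}. (norm (fcoeff p ?f m))^2) = (\<Sum>j\<in>{0..<p}. (norm (?f j))^2) / of_int p"
    using p0 by (intro parseval) (auto simp: Legendre_period)
  moreover have "(norm (fcoeff p ?f m))^2 = (if p dvd m then 0 else 1) * C" for m
    unfolding fc norm_divide norm_mult power_divide power_mult_distrib norm_Legendre_sq C_def by simp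
  ultimately have "(\<Sum>t\<in>{0..<p}. (if p dvd t then 0 else 1) * C) = (\<Sum>t\<in>{0..<p}. (if p dvd t then 0 else 1)) / real_of_int p"
    by (simp only: norm_Legendre_sq add_0)
  then have "(of_int p - 1) * C = (of_int p - 1) / real_of_int p"
    by (simp only: cnt sum_distrib_right[symmetric])
  then have "(of_int p - 1) * C = (of_int p - 1) * (1 / real_of_int p)" by simp
  then have "C = 1 / of_int p" using p by (subst (asm) mult_left_cancel) auto
  then show "(norm G)^2 = of_int p" using p by (simp add: C_def field_simps power2_eq_square)
qed

section \<open>The sign sequence attached to a set of primes and its transform\<close>

definition uleg :: "int \<Rightarrow> int \<Rightarrow> int" where
  "uleg p j = (if p dvd j then 1 else Legendre j p)"

definition xseq :: "int set \<Rightarrow> int \<Rightarrow> int" where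
  "xseq P j = (\<Prod>p\<in>P. uleg p j)"

lemma uleg_cong: "p dvd a - b \<Longrightarrow> uleg p a = uleg p b"
  unfolding uleg_def using Legendre_cong[of p a b] mod_eq_dvd_iff[of a p b] by (simp add: dvd_eq_mod_eq_0)

lemma xseq_cong: "finite P \<Longrightarrow> \<Prod>P dvd a - b \<Longrightarrow> xseq P a = xseq P b"
  unfolding xseq_def by (intro prod.cong refl uleg_cong) (rule dvd_trans[OF dvd_prodI[of P _ "\<lambda>x. x"]])

lemma uleg_pm1: "uleg p j \<in> {1, -1}"
  by (auto simp: uleg_def Legendre_def cong_0_iff)

lemma xseq_pm1: "finite P \<Longrightarrow> xseq P j \<in> {1, -1}"
proof (induction P rule: finite_induct)
  case (insert q P)
  then show ?case using uleg_pm1[of q j] by (auto simp: xseq_def)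
qed (simp add: xseq_def)

text \<open>The value 1 at the multiples of \<open>p\<close> adds the constant 1 to the Gauss sum.
  The dilation \<open>c\<close>, produced by the Chinese remainder theorem, only affects the sign of
  \<open>G\<close>.\<close>

lemma uleg_fourier:
  fixes p :: int
  assumes p: "prime p" "p > 2" and c: "\<not> p dvd c"
  obtains G :: complex where "(norm G)^2 = of_int p"
    and "\<And>k. (\<Sum>u\<in>{0..<p}. of_int (uleg p (c * u)) * ee p (u * k)) = 1 + G * of_int (Legendre k p)"
proof -
  obtain G :: complex where G: "(norm G)^2 = of_int p"
    "\<And>k. (\<Sum>u\<in>{0..<p}. of_int (Legendre u p) * ee p (u * k)) = of_int (Legendre k p) * G"
    using gauss_sum[OF p] by blast
  have R: "{0..<p} = insert 0 {1..<p}" using p by auto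
  have nd: "\<not> p dvd u" if "u \<in> {1..<p}" for u using that zdvd_not_zless[of u p] by auto
  show ?thesis
  proof
    show "(norm (of_int (Legendre c p) * G))^2 = of_int p"
      unfolding norm_mult power_mult_distrib norm_Legendre_sq using G c by simp
    fix k
    have "(\<Sum>u\<in>{0..<p}. of_int (uleg p (c * u)) * ee p (u * k))
        = 1 + (\<Sum>u\<in>{1..<p}. of_int (uleg p (c * u)) * ee p (u * k))"
      unfolding R by (simp add: uleg_def)
    also have "(\<Sum>u\<in>{1..<p}. of_int (uleg p (c * u)) * ee p (u * k))
        = (\<Sum>u\<in>{1..<p}. of_int (Legendre (c * u) p) * ee p (u * k))"
      using nd c p by (intro sum.cong refl) (simp add: uleg_def prime_dvd_mult_iff)
    also have "\<dots> = (\<Sum>u\<in>{0..<p}. of_int (Legendre (c * u) p) * ee p (u * k))"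
      unfolding R by (simp add: Legendre_eq_0_iff)
    also have "\<dots> = of_int (Legendre c p) * (\<Sum>u\<in>{0..<p}. of_int (Legendre u p) * ee p (u * k))"
      by (simp add: Legendre_mult[OF p] sum_distrib_left mult_ac)
    finally show "(\<Sum>u\<in>{0..<p}. of_int (uleg p (c * u)) * ee p (u * k))
       = 1 + of_int (Legendre c p) * G * of_int (Legendre k p)" by (simp add: G(2) mult_ac)
  qed
qed

text \<open>The dilation \<open>c\<close> is there for the induction: splitting off the prime
  \<open>q\<close> rescales the remaining variable by \<open>q\<close>. With period
  \<open>2 * \<Prod>P\<close> the transform lives on the even frequencies, which is already visible
  for empty \<open>P\<close>.\<close>

lemma xseq_fourier:
  assumes "finite P" "\<And>p. p \<in> P \<Longrightarrow> prime p \<and> p > (2::int)" "coprime c (2 * \<Prod>P)"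
  shows "\<exists>\<gamma>. (\<forall>p\<in>P. (norm (\<gamma> p :: complex))^2 = of_int p) \<and>
    (\<forall>k. (\<Sum>j\<in>{0..<2 * \<Prod>P}. of_int (xseq P (c * j)) * ee (2 * \<Prod>P) (j * k))
       = (if even k then 2 else 0) * (\<Prod>p\<in>P. 1 + \<gamma> p * of_int (Legendre k p)))"
  using assms
proof (induction P arbitrary: c rule: finite_induct)
  case empty
  show ?case using ee_sum[of 2] by (auto simp: xseq_def)
next
  case (insert q P)
  define b where "b = 2 * \<Prod>P"
  have q: "prime q" "q > 2" using insert.prems(1) by auto
  have P: "prime p \<and> p > 2" if "p \<in> P" for p using insert.prems(1) that by auto
  have Ppos: "\<Prod>P > 0" using P by (intro prod_pos) force
  have bpos: "b > 0" and qpos: "q > 0" using Ppos q by (auto simp: b_def)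
  have N: "2 * \<Prod>(insert q P) = q * b" using insert.hyps by (simp add: b_def)
  have copP: "coprime q (\<Prod>P)"
  proof (rule prod_coprime_right)
    fix p assume "p \<in> P"
    then show "coprime q p" using P[of p] q insert.hyps(2) by (intro primes_coprime) auto
  qed
  have "coprime q 2" using q prime_odd_int[of q] by simp
  then have cop: "coprime q b" using copP by (simp add: b_def)
  have cq: "coprime c q" "coprime c b" using insert.prems(2) unfolding N by auto
  have "coprime (c * q) (2 * \<Prod>P)" using cq(2) cop by (simp add: b_def)
  then obtain \<gamma> where \<gamma>: "\<And>p. p \<in> P \<Longrightarrow> (norm (\<gamma> p :: complex))^2 = of_int p"
    "\<And>k. (\<Sum>j\<in>{0..<b}. of_int (xseq P (c * q * j)) * ee b (j * k))
       = (if even k then 2 else 0) * (\<Prod>p\<in>P. 1 + \<gamma> p * of_int (Legendre k p))"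
    using insert.IH[of "c * q"] P unfolding b_def by blast
  have "coprime (c * b) q" using cq cop by (simp add: coprime_commute)
  then have "\<not> q dvd c * b" using q by (metis coprime_commute coprime_absorb_left not_prime_unit)
  then obtain G :: complex where G: "(norm G)^2 = of_int q"
    "\<And>k. (\<Sum>u\<in>{0..<q}. of_int (uleg q (c * b * u)) * ee q (u * k)) = 1 + G * of_int (Legendre k q)"
    using uleg_fourier[OF q] by blast
  define \<gamma>' where "\<gamma>' = \<gamma>(q := G)"
  have prod_eq: "(\<Prod>p\<in>P. 1 + \<gamma>' p * of_int (Legendre k p)) = (\<Prod>p\<in>P. 1 + \<gamma> p * of_int (Legendre k p))" for k
    using insert.hyps(2) by (intro prod.cong) (auto simp: \<gamma>'_def)
  have main: "(\<Sum>j\<in>{0..<q * b}. of_int (xseq (insert q P) (c * j)) * ee (q * b) (j * k))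
      = (if even k then 2 else 0) * ((1 + G * of_int (Legendre k q)) * (\<Prod>p\<in>P. 1 + \<gamma> p * of_int (Legendre k p)))" for k
  proof -
    let ?f = "\<lambda>j. of_int (xseq (insert q P) (c * j)) * ee (q * b) (j * k)"
    have per: "?f (j + q * b) = ?f j" for j
    proof (intro arg_cong2[where f="(*)"] arg_cong[where f=of_int])
      have "c * (j + q * b) - c * j = \<Prod>(insert q P) * (2 * c)"
        using insert.hyps by (simp add: b_def algebra_simps)
      then show "xseq (insert q P) (c * (j + q * b)) = xseq (insert q P) (c * j)"
        using insert.hyps(1) by (intro xseq_cong) auto
      show "ee (q * b) ((j + q * b) * k) = ee (q * b) (j * k)"
        using qpos bpos by (intro ee_cong) (auto simp: algebra_simps)
    qed
    have "sum ?f {0..<q * b} = (\<Sum>u\<in>{0..<q}. \<Sum>v\<in>{0..<b}. ?f (b * u + q * v))"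
      using per qpos bpos cop by (intro sum_period_crt) auto
    also have "\<dots> = (\<Sum>u\<in>{0..<q}. \<Sum>v\<in>{0..<b}. (of_int (uleg q (c * b * u)) * ee q (u * k)) * (of_int (xseq P (c * q * v)) * ee b (v * k)))"
    proof (intro sum.cong refl)
      fix u v
      have "uleg q (c * (b * u + q * v)) = uleg q (c * b * u)"
        by (intro uleg_cong) (simp add: algebra_simps)
      moreover have "xseq P (c * (b * u + q * v)) = xseq P (c * q * v)"
        using insert.hyps(1) by (intro xseq_cong) (auto simp: b_def algebra_simps)
      moreover have "ee (q * b) ((b * u + q * v) * k) = ee q (u * k) * ee b (v * k)"
      proof -
        have "(b * u + q * v) * k = b * (u * k) + q * (v * k)" by (simp add: algebra_simps)
        then show ?thesis using ee_cancel[of b q "u * k"] ee_cancel[of q b "v * k"] qpos bpos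
          by (simp add: ee_add mult.commute)
      qed
      ultimately show "?f (b * u + q * v)
        = (of_int (uleg q (c * b * u)) * ee q (u * k)) * (of_int (xseq P (c * q * v)) * ee b (v * k))"
        using insert.hyps by (simp add: xseq_def)
    qed
    also have "\<dots> = (\<Sum>u\<in>{0..<q}. of_int (uleg q (c * b * u)) * ee q (u * k)) * (\<Sum>v\<in>{0..<b}. of_int (xseq P (c * q * v)) * ee b (v * k))"
      by (simp add: sum_product)
    finally show ?thesis unfolding G(2) \<gamma>(2) by simp
  qed
  show ?case
  proof (intro exI[of _ \<gamma>'] conjI ballI allI)
    fix p assume "p \<in> insert q P"
    then show "(norm (\<gamma>' p))^2 = of_int p" using \<gamma>(1) G(1) by (auto simp: \<gamma>'_def)
  next
    fix k
    show "(\<Sum>j\<in>{0..<2 * \<Prod>(insert q P)}. of_int (xseq (insert q P) (c * j)) * ee (2 * \<Prod>(insert q P)) (j * k))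
       = (if even k then 2 else 0) * (\<Prod>p\<in>insert q P. 1 + \<gamma>' p * of_int (Legendre k p))"
      unfolding N main using insert.hyps by (simp add: prod_eq) (simp add: \<gamma>'_def)
  qed
qed

lemma sum_period_prod_primes:
  fixes e :: "int \<Rightarrow> complex" and h :: "int \<Rightarrow> int \<Rightarrow> complex"
  assumes "finite P" "\<And>p. p \<in> P \<Longrightarrow> prime p \<and> p > (2::int)"
    and "\<And>k. e (k + 2) = e k" "\<And>p k. p \<in> P \<Longrightarrow> h p (k + p) = h p k"
  shows "(\<Sum>k\<in>{0..<2 * \<Prod>P}. e k * (\<Prod>p\<in>P. h p k)) = (\<Sum>k\<in>{0..<2}. e k) * (\<Prod>p\<in>P. \<Sum>k\<in>{0..<p}. h p k)"
  using assms(1,2,4)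
proof (induction P rule: finite_induct)
  case (insert q P)
  define b where "b = 2 * \<Prod>P"
  have q: "prime q" "q > 2" using insert.prems(1) by auto
  have P: "prime p \<and> p > 2" if "p \<in> P" for p using insert.prems(1) that by auto
  have Ppos: "\<Prod>P > 0" using P by (intro prod_pos) force
  have bpos: "b > 0" and qpos: "q > 0" using Ppos q by (auto simp: b_def)
  have N: "2 * \<Prod>(insert q P) = q * b" using insert.hyps by (simp add: b_def)
  have copP: "coprime q (\<Prod>P)"
  proof (rule prod_coprime_right)
    fix p assume "p \<in> P"
    then show "coprime q p" using P[of p] q insert.hyps(2) by (intro primes_coprime) auto
  qed
  have "coprime q 2" using q prime_odd_int[of q] by simp
  then have cop: "coprime q b" using copP by (simp add: b_def)
  have "(\<Sum>k\<in>{0..<q * b}. e k * (\<Prod>p\<in>insert q P. h p k)) = (\<Sum>k\<in>{0..<q * b}. h q k * (e k * (\<Prod>p\<in>P. h p k)))"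
    using insert.hyps by (simp add: mult_ac)
  also have "\<dots> = (\<Sum>k\<in>{0..<q}. h q k) * (\<Sum>k\<in>{0..<b}. e k * (\<Prod>p\<in>P. h p k))"
  proof (rule sum_period_product)
    fix k
    show "h q (k + q) = h q k" using insert.prems by simp
    have "e (k + b) = e k" using periodic_cong[of e 2 "k + b" k] assms(3) by (simp add: b_def)
    moreover have "h p (k + b) = h p k" if "p \<in> P" for p
    proof (rule periodic_cong[of "h p" p])
      show "p dvd k + b - k" using dvd_prodI[OF insert.hyps(1) that, of "\<lambda>x. x"] by (simp add: b_def)
    qed (use that insert.prems(2) in auto)
    ultimately show "e (k + b) * (\<Prod>p\<in>P. h p (k + b)) = e k * (\<Prod>p\<in>P. h p k)" by simp
  qed (use qpos bpos cop in auto)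
  also have "(\<Sum>k\<in>{0..<b}. e k * (\<Prod>p\<in>P. h p k)) = (\<Sum>k\<in>{0..<2}. e k) * (\<Prod>p\<in>P. \<Sum>k\<in>{0..<p}. h p k)"
    unfolding b_def using insert.IH P insert.prems(2) by auto
  finally show ?case unfolding N using insert.hyps by (simp add: mult_ac)
qed simp

subsection \<open>Four-point correlations of the Fourier transform\<close>

text \<open>The factor \<open>1 + \<gamma> p * Legendre k p\<close> of the transform, divided by the
  square root of \<open>p\<close>; \<open>g\<close> stands for a normalised Gauss sum.\<close>

definition hfac :: "int \<Rightarrow> complex \<Rightarrow> int \<Rightarrow> complex" where
  "hfac p g k = of_real (1 / sqrt (of_int p)) + g * of_int (Legendre k p)"

definition Tp :: "int \<Rightarrow> complex \<Rightarrow> int \<Rightarrow> int \<Rightarrow> int \<Rightarrow> int \<Rightarrow> complex" where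
  "Tp p g m1 m2 m3 m4 = (\<Sum>k\<in>{0..<p}. hfac p g (k + m1) * hfac p g (k + m2)
     * cnj (hfac p g (k + m3)) * cnj (hfac p g (k + m4))) / of_int p"

definition char4 :: "int \<Rightarrow> int \<Rightarrow> int \<Rightarrow> int \<Rightarrow> int \<Rightarrow> int" where
  "char4 p m1 m2 m3 m4 = (\<Sum>k\<in>{0..<p}. Legendre (k + m1) p * Legendre (k + m2) p
     * Legendre (k + m3) p * Legendre (k + m4) p)"

text \<open>The third alternative joins the two unconjugated points and the two conjugated ones. It
  occurs because Legendre symbols are real and the phases \<open>g\<close> cancel in the product of
  four factors.\<close>

definition paired :: "int \<Rightarrow> int \<Rightarrow> int \<Rightarrow> int \<Rightarrow> bool" where
  "paired m1 m2 m3 m4 \<longleftrightarrow> (m1 = m3 \<and> m2 = m4) \<or> (m1 = m4 \<and> m2 = m3) \<or> (m1 = m2 \<and> m3 = m4)"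

lemma hfac_period: "hfac p g (k + p) = hfac p g k"
  by (simp add: hfac_def Legendre_period)

text \<open>Replacing one factor at a time costs 8, 4, 2 and 1 times \<open>r\<close>.\<close>

lemma norm_prod4_diff:
  fixes z1 z2 z3 z4 w1 w2 w3 w4 :: complex
  assumes z: "norm z2 \<le> 2" "norm z3 \<le> 2" "norm z4 \<le> 2"
    and w: "norm w1 \<le> 1" "norm w2 \<le> 1" "norm w3 \<le> 1"
    and d: "norm (z1 - w1) \<le> r" "norm (z2 - w2) \<le> r" "norm (z3 - w3) \<le> r" "norm (z4 - w4) \<le> r"
  shows "norm (z1 * z2 * z3 * z4 - w1 * w2 * w3 * w4) \<le> 15 * r"
proof -
  have r: "r \<ge> 0" using d(1) norm_ge_zero order_trans by blast
  have eq: "z1 * z2 * z3 * z4 - w1 * w2 * w3 * w4 = (z1 - w1) * z2 * z3 * z4 + w1 * (z2 - w2) * z3 * z4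
      + w1 * w2 * (z3 - w3) * z4 + w1 * w2 * w3 * (z4 - w4)"
    by (simp add: algebra_simps)
  have "norm ((z1 - w1) * z2 * z3 * z4) \<le> r * 2 * 2 * 2"
    unfolding norm_mult using z d r by (intro mult_mono) auto
  moreover have "norm (w1 * (z2 - w2) * z3 * z4) \<le> 1 * r * 2 * 2"
    unfolding norm_mult using z d r w by (intro mult_mono) auto
  moreover have "norm (w1 * w2 * (z3 - w3) * z4) \<le> 1 * 1 * r * 2"
    unfolding norm_mult using z d r w by (intro mult_mono) auto
  moreover have "norm (w1 * w2 * w3 * (z4 - w4)) \<le> 1 * 1 * 1 * r"
    unfolding norm_mult using z d r w by (intro mult_mono) auto
  ultimately show ?thesis
    unfolding eq
    using norm_triangle_ineq[of "(z1 - w1) * z2 * z3 * z4 + w1 * (z2 - w2) * z3 * z4 + w1 * w2 * (z3 - w3) * z4" "w1 * w2 * w3 * (z4 - w4)"]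
      norm_triangle_ineq[of "(z1 - w1) * z2 * z3 * z4 + w1 * (z2 - w2) * z3 * z4" "w1 * w2 * (z3 - w3) * z4"]
      norm_triangle_ineq[of "(z1 - w1) * z2 * z3 * z4" "w1 * (z2 - w2) * z3 * z4"]
    by linarith
qed

text \<open>Dropping the terms \<open>1 / sqrt p\<close> costs 15 by telescoping. Two factors carry
  \<open>g\<close> and two its conjugate, so that only a sum of Legendre symbols remains.\<close>

lemma Tp_approx:
  assumes p: "prime p" "p > 2" and g: "norm g = 1"
  shows "norm (Tp p g m1 m2 m3 m4 - of_int (char4 p m1 m2 m3 m4) / of_int p) \<le> 15 / sqrt (of_int p)"
proof -
  define r where "r = 1 / sqrt (real_of_int p)"
  have "1 \<le> sqrt (real_of_int p)" using p by simp
  then have r: "0 \<le> r" "r \<le> 1" by (auto simp: r_def divide_simps)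
  define w where "w k = g * of_int (Legendre k p)" for k
  have nL: "norm (of_int (Legendre k p) :: complex) \<le> 1" for k by (simp add: Legendre_def)
  have w: "norm (w k) \<le> 1" for k unfolding w_def norm_mult g using nL by simp
  have d: "norm (hfac p g k - w k) \<le> r" for k
    using r by (simp add: hfac_def w_def r_def[symmetric] del: of_real_divide)
  have h: "norm (hfac p g k) \<le> 2" for k
    using norm_triangle_ineq[of "hfac p g k - w k" "w k"] d[of k] w[of k] r by simp
  have gg: "g * cnj g = 1" using complex_norm_square[of g] g by simp
  have ww: "w a * w b * cnj (w c) * cnj (w d) = of_int (Legendre a p * Legendre b p * Legendre c p * Legendre d p)" for a b c d
  proof -
    have "w a * w b * cnj (w c) * cnj (w d) = (g * cnj g) * (g * cnj g) * of_int (Legendre a p * Legendre b p * Legendre c p * Legendre d p)"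
      by (simp add: w_def mult_ac)
    then show ?thesis using gg by simp
  qed
  have pw: "norm (hfac p g a * hfac p g b * cnj (hfac p g c) * cnj (hfac p g d) - w a * w b * cnj (w c) * cnj (w d)) \<le> 15 * r" for a b c d
    using h w d by (intro norm_prod4_diff) (auto simp: complex_cnj_diff[symmetric] simp del: complex_cnj_diff)
  have "Tp p g m1 m2 m3 m4 - of_int (char4 p m1 m2 m3 m4) / of_int p
     = (\<Sum>k\<in>{0..<p}. hfac p g (k + m1) * hfac p g (k + m2) * cnj (hfac p g (k + m3)) * cnj (hfac p g (k + m4))
         - w (k + m1) * w (k + m2) * cnj (w (k + m3)) * cnj (w (k + m4))) / of_int p"
    by (simp add: Tp_def char4_def ww sum_subtractf diff_divide_distrib del: of_int_mult)
  also have "norm \<dots> \<le> (\<Sum>k\<in>{0..<p}. 15 * r) / of_int p"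
    unfolding norm_divide using p by (intro divide_mono sum_norm_le pw) (auto simp: sum_nonneg r)
  also have "\<dots> = 15 * r" using p by simp
  finally show ?thesis by (simp add: r_def)
qed

text \<open>A product of two squares of Legendre symbols is 1 except at the at most two residues
  where one of them vanishes.\<close>

lemma char4_paired:
  assumes p: "prime p" "p > 2" and "paired m1 m2 m3 m4"
  shows "\<bar>char4 p m1 m2 m3 m4 - p\<bar> \<le> 2"
proof -
  obtain a b where "char4 p m1 m2 m3 m4
    = (\<Sum>k\<in>{0..<p}. (Legendre (k + a) p * Legendre (k + a) p) * (Legendre (k + b) p * Legendre (k + b) p))"
  proof -
    from assms(3) consider "m1 = m3" "m2 = m4" | "m1 = m4" "m2 = m3" | "m1 = m2" "m3 = m4"
      by (auto simp: paired_def)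
    then show ?thesis
      by cases (rule that[of m1 m2] that[of m1 m3], simp add: char4_def mult_ac)+
  qed
  moreover have sq: "Legendre x p * Legendre x p = 1 - (if p dvd x then 1 else 0)" for x
    using Legendre_sq[of p x] Legendre_eq_0_iff[of x p] by auto
  define i where "i x = (if p dvd x then 1 else 0 :: int)" for x
  have isum: "(\<Sum>k\<in>{0..<p}. i (k + c)) = 1" for c
  proof -
    have "(\<Sum>k\<in>{0..<p}. i (k + c)) = (\<Sum>k\<in>{0..<p}. i k)"
      using p by (intro sum_period_translate) (auto simp: i_def)
    also have "\<dots> = (\<Sum>k\<in>{0..<p}. if k = 0 then 1 else 0)"
      by (intro sum.cong refl) (use zdvd_not_zless in \<open>force simp: i_def\<close>)
    finally show ?thesis using p by simp
  qed
  have "p - 2 \<le> (\<Sum>k\<in>{0..<p}. (1 - i (k + a)) * (1 - i (k + b)))" (is "_ \<le> ?S")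
  proof -
    have "p - 2 = (\<Sum>k\<in>{0..<p}. 1 - i (k + a) - i (k + b))" using p isum by (simp add: sum_subtractf)
    also have "\<dots> \<le> ?S" by (intro sum_mono) (auto simp: i_def)
    finally show ?thesis .
  qed
  moreover have "?S \<le> (\<Sum>k\<in>{0..<p}. 1)" by (intro sum_mono) (auto simp: i_def)
  ultimately show ?thesis using p by (simp add: sq i_def)
qed

text \<open>The square only deletes the term with \<open>k\<close> congruent to \<open>- a\<close>;
  adding that term back gives a two-point correlation, which is -1.\<close>

lemma char4_repeated:
  assumes p: "prime p" "p > 2" and nd: "\<not> p dvd b - c"
  shows "\<bar>\<Sum>k\<in>{0..<p}. Legendre (k + a) p * Legendre (k + a) p * Legendre (k + b) p * Legendre (k + c) p\<bar> \<le> 2"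
proof -
  let ?L = "\<lambda>t. Legendre t p"
  define b' c' where "b' = b - a" and "c' = c - a"
  have "{0..<p} = insert 0 {1..<p}" using p by auto
  then have R: "sum f {0..<p} = f 0 + sum f {1..<p}" for f :: "int \<Rightarrow> int" by simp
  have unit: "\<not> p dvd x" if "x \<in> {1..<p}" for x using that zdvd_not_zless[of x p] by auto
  let ?F = "\<lambda>k. ?L k * ?L k * ?L (k + b') * ?L (k + c')"
  have "(\<Sum>k\<in>{0..<p}. ?L (k + a) * ?L (k + a) * ?L (k + b) * ?L (k + c)) = (\<Sum>k\<in>{0..<p}. ?F (k + a))"
    by (simp add: b'_def c'_def)
  also have "\<dots> = (\<Sum>k\<in>{0..<p}. ?F k)"
    using p by (intro sum_period_translate[of ?F] arg_cong2[where f="(*)"] Legendre_cong) auto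
  also have "\<dots> = (\<Sum>k\<in>{1..<p}. ?F k)" by (subst R) (simp add: Legendre_eq_0_iff)
  also have "\<dots> = (\<Sum>k\<in>{1..<p}. ?L (k + b') * ?L (k + c'))"
    using unit Legendre_sq by (intro sum.cong) auto
  also have "\<dots> = (\<Sum>k\<in>{0..<p}. ?L (k + b') * ?L (k + c')) - ?L b' * ?L c'" by (subst R) simp
  also have "(\<Sum>k\<in>{0..<p}. ?L (k + b') * ?L (k + c')) = (\<Sum>k\<in>{0..<p}. ?L (k + b') * ?L ((k + b') + (c - b)))"
    by (simp add: b'_def c'_def algebra_simps)
  also have "\<dots> = (\<Sum>k\<in>{0..<p}. ?L k * ?L (k + (c - b)))"
    using p by (intro sum_period_translate[of "\<lambda>k. ?L k * ?L (k + (c - b))"] arg_cong2[where f="(*)"] Legendre_cong) auto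
  also have "\<dots> = -1" using nd by (intro Legendre_correlation p) (simp add: dvd_diff_commute)
  finally show ?thesis by (simp add: Legendre_def)
qed

lemma char4_unpaired:
  assumes p: "prime p" "p > 2" and np: "\<not> paired m1 m2 m3 m4"
    and small: "\<And>x y. x \<in> {m1, m2, m3, m4} \<Longrightarrow> y \<in> {m1, m2, m3, m4} \<Longrightarrow> \<bar>x - y\<bar> < p"
  shows "\<bar>real_of_int (char4 p m1 m2 m3 m4)\<bar> \<le> 4 * of_int p powr (3/4)"
proof -
  have nd: "\<not> p dvd x - y" if "x \<in> {m1, m2, m3, m4}" "y \<in> {m1, m2, m3, m4}" "x \<noteq> y" for x y
    using small[OF that(1,2)] that(3) dvd_imp_le_int[of "x - y" p] by auto
  have "1 \<le> real_of_int p powr (3/4)" using p by (intro ge_one_powr_ge_zero) auto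
  then have le: "\<bar>real_of_int x\<bar> \<le> 4 * of_int p powr (3/4)" if "\<bar>x\<bar> \<le> 2" for x using that by linarith
  note rep = char4_repeated[OF p]
  \<comment> \<open>In the first six cases two points coincide and the remaining two differ. In the
    last one \<open>m1\<close> is isolated and \<open>m2\<close> differs from \<open>m3\<close>, as
    the four-point bound requires. Smallness turns distinct integers into distinct residues.\<close>
  consider "m1 = m2" "m3 \<noteq> m4" | "m1 = m3" "m2 \<noteq> m4" | "m1 = m4" "m2 \<noteq> m3" | "m2 = m3" "m1 \<noteq> m4"
    | "m2 = m4" "m1 \<noteq> m3" | "m3 = m4" "m1 \<noteq> m2"
    | "m1 \<noteq> m2" "m1 \<noteq> m3" "m1 \<noteq> m4" "m2 \<noteq> m3"
    using np by (auto simp: paired_def)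
  then show ?thesis
  proof cases
    case 1 then show ?thesis using rep[of m3 m4 m1] nd[of m3 m4] by (intro le) (simp add: char4_def mult_ac)
  next
    case 2 then show ?thesis using rep[of m2 m4 m1] nd[of m2 m4] by (intro le) (simp add: char4_def mult_ac)
  next
    case 3 then show ?thesis using rep[of m2 m3 m1] nd[of m2 m3] by (intro le) (simp add: char4_def mult_ac)
  next
    case 4 then show ?thesis using rep[of m1 m4 m2] nd[of m1 m4] by (intro le) (simp add: char4_def mult_ac)
  next
    case 5 then show ?thesis using rep[of m1 m3 m2] nd[of m1 m3] by (intro le) (simp add: char4_def mult_ac)
  next
    case 6 then show ?thesis using rep[of m1 m2 m3] nd[of m1 m2] by (intro le) (simp add: char4_def mult_ac)
  next
    case 7 then show ?thesis unfolding char4_def using nd by (intro four_point_sum p) auto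
  qed
qed

lemma char4_le: assumes "p > 0" shows "\<bar>char4 p m1 m2 m3 m4\<bar> \<le> p"
proof -
  have "\<bar>char4 p m1 m2 m3 m4\<bar> \<le> (\<Sum>k\<in>{0..<p}. 1)"
    unfolding char4_def
  proof (intro order_trans[OF sum_abs] sum_mono)
    fix k
    have "\<bar>Legendre (k + m1) p\<bar> * \<bar>Legendre (k + m2) p\<bar> * \<bar>Legendre (k + m3) p\<bar> * \<bar>Legendre (k + m4) p\<bar> \<le> 1 * 1 * 1 * 1"
      by (intro mult_mono Legendre_abs_le) auto
    then show "\<bar>Legendre (k + m1) p * Legendre (k + m2) p * Legendre (k + m3) p * Legendre (k + m4) p\<bar> \<le> 1"
      by (simp add: abs_mult)
  qed
  then show ?thesis using assms by simp
qed

lemma Tp_le: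
  assumes p: "prime p" "p > 2" and g: "norm g = 1"
  shows "norm (Tp p g m1 m2 m3 m4) \<le> 1 + 15 / sqrt (of_int p)"
proof -
  have "\<bar>real_of_int (char4 p m1 m2 m3 m4)\<bar> \<le> of_int p"
    using char4_le[of p m1 m2 m3 m4] p by linarith
  then have "norm (of_int (char4 p m1 m2 m3 m4) / of_int p :: complex) \<le> 1"
    using p by (simp add: norm_divide divide_simps)
  then show ?thesis using Tp_approx[OF assms, of m1 m2 m3 m4]
      norm_triangle_ineq[of "Tp p g m1 m2 m3 m4 - of_int (char4 p m1 m2 m3 m4) / of_int p" "of_int (char4 p m1 m2 m3 m4) / of_int p"]
    by simp
qed

text \<open>17 = 15 + 2: the loss from dropping the terms \<open>1 / sqrt p\<close>, and the
  residues where a Legendre symbol vanishes.\<close>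

lemma Tp_paired:
  assumes p: "prime p" "p > 2" and g: "norm g = 1" and "paired m1 m2 m3 m4"
  shows "norm (Tp p g m1 m2 m3 m4 - 1) \<le> 17 / sqrt (of_int p)"
proof -
  have "\<bar>real_of_int (char4 p m1 m2 m3 m4 - p)\<bar> \<le> 2"
    using char4_paired[OF p assms(4)] by linarith
  moreover have "of_int (char4 p m1 m2 m3 m4) / of_int p - 1 = (of_int (char4 p m1 m2 m3 m4 - p) / of_int p :: complex)"
    using p by (simp add: field_simps)
  ultimately have "norm (of_int (char4 p m1 m2 m3 m4) / of_int p - 1 :: complex) \<le> 2 / of_int p"
    using p by (simp only: norm_divide norm_of_int) (simp add: divide_right_mono)
  also have "\<dots> \<le> 2 / sqrt (of_int p)"
    using p by (intro divide_left_mono) (auto intro!: real_le_lsqrt simp: power2_eq_square mult_le_cancel_left1)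
  finally show ?thesis using Tp_approx[OF p g, of m1 m2 m3 m4]
      norm_triangle_ineq[of "Tp p g m1 m2 m3 m4 - of_int (char4 p m1 m2 m3 m4) / of_int p" "of_int (char4 p m1 m2 m3 m4) / of_int p - 1"]
    by (simp add: add_divide_distrib[symmetric])
qed

text \<open>19 = 4 + 15: the character sum has the weaker decay \<open>p powr (-1/4)\<close>, to
  which the error of order \<open>p powr (-1/2)\<close> is relaxed.\<close>

lemma Tp_unpaired:
  assumes p: "prime p" "p > 2" and g: "norm g = 1" and np: "\<not> paired m1 m2 m3 m4"
    and small: "\<And>x y. x \<in> {m1, m2, m3, m4} \<Longrightarrow> y \<in> {m1, m2, m3, m4} \<Longrightarrow> \<bar>x - y\<bar> < p"
  shows "norm (Tp p g m1 m2 m3 m4) \<le> 19 * of_int p powr (-1/4)"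
proof -
  have p0: "real_of_int p > 0" "real_of_int p \<ge> 1" using p by auto
  have "norm (of_int (char4 p m1 m2 m3 m4) / of_int p :: complex) \<le> 4 * of_int p powr (3/4) / of_int p"
    using char4_unpaired[OF p np small] p0 by (simp add: norm_divide divide_right_mono)
  also have "\<dots> = 4 * of_int p powr (3/4 - 1)" using p0 by (simp only: powr_diff powr_one)
  finally have 1: "norm (of_int (char4 p m1 m2 m3 m4) / of_int p :: complex) \<le> 4 * of_int p powr (-1/4)" by simp
  have "1 / sqrt (of_int p) = of_int p powr (-1/2)" using p0 by (simp add: powr_minus_divide powr_half_sqrt)
  also have "\<dots> \<le> of_int p powr (-1/4)" using p0 by (intro powr_mono) auto
  finally have "15 / sqrt (of_int p) \<le> 15 * of_int p powr (-1/4)" by simp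
  then show ?thesis using 1 Tp_approx[OF p g, of m1 m2 m3 m4]
      norm_triangle_ineq[of "Tp p g m1 m2 m3 m4 - of_int (char4 p m1 m2 m3 m4) / of_int p" "of_int (char4 p m1 m2 m3 m4) / of_int p"]
    by simp
qed

text \<open>The factor for \<open>k\<close> even appears because the \<open>n\<close>-periodic sequence is transformed with period \<open>2n\<close>.\<close>
definition Yfun :: "int set \<Rightarrow> (int \<Rightarrow> complex) \<Rightarrow> int \<Rightarrow> complex" where
  "Yfun P g k = (if even k then 1 else 0) * (\<Prod>p\<in>P. hfac p (g p) k)"

text \<open>The normalisation is by \<open>\<Prod>P\<close>, half the length of the sum, because at
  most one parity class of \<open>k\<close> contributes; paired frequencies of equal parity then
  give a value close to 1.\<close>

definition T4 :: "int set \<Rightarrow> (int \<Rightarrow> complex) \<Rightarrow> int \<Rightarrow> int \<Rightarrow> int \<Rightarrow> int \<Rightarrow> complex" where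
  "T4 P g m1 m2 m3 m4 = (\<Sum>k\<in>{0..<2 * \<Prod>P}. Yfun P g (k + m1) * Yfun P g (k + m2)
     * cnj (Yfun P g (k + m3)) * cnj (Yfun P g (k + m4))) / of_int (\<Prod>P)"

definition same_parity :: "int \<Rightarrow> int \<Rightarrow> int \<Rightarrow> int \<Rightarrow> bool" where
  "same_parity m1 m2 m3 m4 \<longleftrightarrow> (even m1 \<longleftrightarrow> even m2) \<and> (even m1 \<longleftrightarrow> even m3) \<and> (even m1 \<longleftrightarrow> even m4)"

definition T_ideal :: "int \<Rightarrow> int \<Rightarrow> int \<Rightarrow> int \<Rightarrow> complex" where
  "T_ideal m1 m2 m3 m4 = (if same_parity m1 m2 m3 m4 \<and> paired m1 m2 m3 m4 then 1 else 0)"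

lemma T4_factor:
  assumes P: "finite P" "\<And>p. p \<in> P \<Longrightarrow> prime p \<and> p > 2"
  shows "T4 P g m1 m2 m3 m4 = (if same_parity m1 m2 m3 m4 then \<Prod>p\<in>P. Tp p (g p) m1 m2 m3 m4 else 0)"
proof -
  let ?e = "\<lambda>k. (if even (k + m1) \<and> even (k + m2) \<and> even (k + m3) \<and> even (k + m4) then 1 else 0 :: complex)"
  let ?h = "\<lambda>p k. hfac p (g p) (k + m1) * hfac p (g p) (k + m2) * cnj (hfac p (g p) (k + m3)) * cnj (hfac p (g p) (k + m4))"
  have "(\<Sum>k\<in>{0..<2 * \<Prod>P}. Yfun P g (k + m1) * Yfun P g (k + m2) * cnj (Yfun P g (k + m3)) * cnj (Yfun P g (k + m4)))
      = (\<Sum>k\<in>{0..<2 * \<Prod>P}. ?e k * (\<Prod>p\<in>P. ?h p k))"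
    by (intro sum.cong refl) (simp add: Yfun_def prod.distrib cnj_prod del: even_add odd_add)
  also have "\<dots> = (\<Sum>k\<in>{0..<2}. ?e k) * (\<Prod>p\<in>P. \<Sum>k\<in>{0..<p}. ?h p k)"
    using P hfac_period[of _ _ "_ + _"]
    by (intro sum_period_prod_primes) (auto simp: add.assoc add.commute[of _ "m1"] add.commute[of _ "m2"] add.commute[of _ "m3"] add.commute[of _ "m4"] hfac_period simp flip: add.assoc)
  also have "(\<Sum>k\<in>{0..<2}. ?e k) = (if same_parity m1 m2 m3 m4 then 1 else 0)"
  proof -
    have "{0..<2::int} = {0, 1}" by auto
    then show ?thesis by (auto simp: same_parity_def)
  qed
  finally show ?thesis by (simp add: T4_def Tp_def prod_dividef of_int_prod)
qed

lemma norm_prod_one_plus_minus_one: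
  fixes f :: "'a \<Rightarrow> complex"
  assumes "finite A"
  shows "norm ((\<Prod>x\<in>A. 1 + f x) - 1) \<le> (\<Prod>x\<in>A. 1 + norm (f x)) - 1"
  using assms
proof (induction A rule: finite_induct)
  case (insert a A)
  let ?X = "\<Prod>x\<in>A. 1 + f x" and ?Z = "\<Prod>x\<in>A. 1 + norm (f x)"
  have "norm ?X \<le> ?Z"
    unfolding prod_norm[symmetric] by (intro prod_mono conjI norm_ge_zero norm_triangle_le) simp
  then have "norm (f a * ?X) \<le> norm (f a) * ?Z" unfolding norm_mult by (intro mult_left_mono) auto
  moreover have "(1 + f a) * ?X - 1 = (?X - 1) + f a * ?X" by (simp add: algebra_simps)
  ultimately have "norm ((1 + f a) * ?X - 1) \<le> (?Z - 1) + norm (f a) * ?Z"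
    using insert.IH norm_triangle_mono by metis
  also have "\<dots> = (1 + norm (f a)) * ?Z - 1" by (simp add: algebra_simps)
  finally show ?case using insert.hyps by simp
qed simp

text \<open>Frequencies below \<open>q / 2\<close> in absolute value stay distinct modulo every
  prime if they are distinct. For pairings the local errors multiply up to \<open>K - 1\<close>;
  otherwise a single prime supplies \<open>q powr (-1/4)\<close> and the others cost
  \<open>K\<close>. Larger frequencies get the trivial bound \<open>K + 1\<close>.\<close>

lemma T4_bound:
  assumes P: "finite P" "P \<noteq> {}" "\<And>p. p \<in> P \<Longrightarrow> prime p \<and> p > 2 \<and> q \<le> p" and q: "q > 2"
    and g: "\<And>p. p \<in> P \<Longrightarrow> norm (g p) = 1"
  defines "K \<equiv> exp (17 * real (card P) / sqrt (of_int q))"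
  defines "big \<equiv> (\<lambda>m. if 2 * \<bar>m\<bar> \<ge> q then 1 else 0 :: real)"
  shows "norm (T4 P g m1 m2 m3 m4 - T_ideal m1 m2 m3 m4)
    \<le> (K - 1 + 19 * of_int q powr (-1/4) * K) + (K + 1) * (big m1 + big m2 + big m3 + big m4)"
proof -
  have K1: "K \<ge> 1" unfolding K_def using q by simp
  have q0: "19 * of_int q powr (-1/4) * K \<ge> 0" using K1 by simp
  have T4: "T4 P g m1 m2 m3 m4 = (if same_parity m1 m2 m3 m4 then \<Prod>p\<in>P. Tp p (g p) m1 m2 m3 m4 else 0)"
    using P by (intro T4_factor) auto
  have sq: "c / sqrt (of_int p) \<le> c / sqrt (of_int q)" if "p \<in> P" "c \<ge> 0" for p c
    using P(3)[OF that(1)] q that(2) by (intro divide_left_mono) auto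
  have prodK: "(\<Prod>p\<in>Q. 1 + 17 / sqrt (of_int q)) \<le> K" if "Q \<subseteq> P" for Q :: "int set"
  proof -
    have "(\<Prod>p\<in>Q. 1 + 17 / sqrt (of_int q)) = (1 + 17 / sqrt (of_int q)) ^ card Q" by simp
    also have "\<dots> \<le> (exp (17 / sqrt (of_int q))) ^ card Q"
      using q by (intro power_mono exp_ge_add_one_self) auto
    also have "\<dots> = exp (17 * real (card Q) / sqrt (of_int q))" by (simp add: exp_of_nat_mult[symmetric] mult_ac)
    also have "\<dots> \<le> K" unfolding K_def using card_mono[OF P(1) that] q by (simp add: divide_right_mono)
    finally show ?thesis .
  qed
  have T_le: "norm (\<Prod>p\<in>Q. Tp p (g p) m1 m2 m3 m4) \<le> K" if "Q \<subseteq> P" for Q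
  proof -
    have "norm (\<Prod>p\<in>Q. Tp p (g p) m1 m2 m3 m4) \<le> (\<Prod>p\<in>Q. 1 + 17 / sqrt (of_int q))"
      unfolding prod_norm[symmetric]
    proof (intro prod_mono conjI norm_ge_zero)
      fix p assume "p \<in> Q"
      then have p: "p \<in> P" using that by auto
      have "norm (Tp p (g p) m1 m2 m3 m4) \<le> 1 + 15 / sqrt (of_int p)"
        using P(3)[OF p] g[OF p] by (intro Tp_le) auto
      also have "\<dots> \<le> 1 + 17 / sqrt (of_int p)" using P(3)[OF p] by (simp add: divide_right_mono)
      also have "\<dots> \<le> 1 + 17 / sqrt (of_int q)" using sq[OF p] by simp
      finally show "norm (Tp p (g p) m1 m2 m3 m4) \<le> 1 + 17 / sqrt (of_int q)" .
    qed
    then show ?thesis using prodK[OF that] by linarith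
  qed
  show ?thesis
  proof (cases "2 * \<bar>m1\<bar> < q \<and> 2 * \<bar>m2\<bar> < q \<and> 2 * \<bar>m3\<bar> < q \<and> 2 * \<bar>m4\<bar> < q")
    case False
    then have "1 \<le> big m1 + big m2 + big m3 + big m4" by (auto simp: big_def)
    then have "(K + 1) * 1 \<le> (K + 1) * (big m1 + big m2 + big m3 + big m4)" using K1 by (intro mult_left_mono) auto
    then have "K + 1 \<le> (K + 1) * (big m1 + big m2 + big m3 + big m4)" by simp
    moreover have "norm (T4 P g m1 m2 m3 m4) \<le> K" unfolding T4 using T_le[of P] K1 by auto
    moreover have "norm (T_ideal m1 m2 m3 m4) \<le> 1" by (simp add: T_ideal_def)
    ultimately show ?thesis using norm_triangle_ineq4[of "T4 P g m1 m2 m3 m4" "T_ideal m1 m2 m3 m4"] q0 K1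
      by (smt (verit))
  next
    case True
    then have b0: "big m1 + big m2 + big m3 + big m4 = 0" by (auto simp: big_def)
    have "norm (T4 P g m1 m2 m3 m4 - T_ideal m1 m2 m3 m4) \<le> K - 1 + 19 * of_int q powr (-1/4) * K"
    proof (cases "same_parity m1 m2 m3 m4")
      case False
      then show ?thesis using K1 q0 by (simp add: T4 T_ideal_def)
    next
      case sp: True
      show ?thesis
      proof (cases "paired m1 m2 m3 m4")
        case pr: True
        have "norm ((\<Prod>p\<in>P. 1 + (Tp p (g p) m1 m2 m3 m4 - 1)) - 1) \<le> (\<Prod>p\<in>P. 1 + norm (Tp p (g p) m1 m2 m3 m4 - 1)) - 1"
          by (rule norm_prod_one_plus_minus_one[OF P(1)])
        also have "(\<Prod>p\<in>P. 1 + norm (Tp p (g p) m1 m2 m3 m4 - 1)) \<le> (\<Prod>p\<in>P. 1 + 17 / sqrt (of_int q))"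
        proof (intro prod_mono conjI)
          fix p assume p: "p \<in> P"
          have "norm (Tp p (g p) m1 m2 m3 m4 - 1) \<le> 17 / sqrt (of_int p)"
            using P(3)[OF p] g[OF p] pr by (intro Tp_paired) auto
          then show "1 + norm (Tp p (g p) m1 m2 m3 m4 - 1) \<le> 1 + 17 / sqrt (of_int q)" using sq[OF p, of 17] by simp
        qed (simp add: add_nonneg_nonneg)
        also have "\<dots> \<le> K" by (rule prodK) simp
        finally have "norm (T4 P g m1 m2 m3 m4 - T_ideal m1 m2 m3 m4) \<le> K - 1"
          using sp pr by (simp add: T4 T_ideal_def)
        then show ?thesis using q0 by linarith
      next
        case np: False
        obtain p where p: "p \<in> P" using P(2) by auto
        have pq: "prime p" "p > 2" "q \<le> p" using P(3)[OF p] by auto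
        have "norm (Tp p (g p) m1 m2 m3 m4) \<le> 19 * of_int p powr (-1/4)"
          using True pq by (intro Tp_unpaired np g[OF p]) auto
        also have "\<dots> \<le> 19 * of_int q powr (-1/4)"
          using pq q by (intro mult_left_mono powr_mono2') auto
        finally have 1: "norm (Tp p (g p) m1 m2 m3 m4) \<le> 19 * of_int q powr (-1/4)" .
        have "norm (\<Prod>p\<in>P. Tp p (g p) m1 m2 m3 m4) = norm (Tp p (g p) m1 m2 m3 m4) * norm (\<Prod>p\<in>P - {p}. Tp p (g p) m1 m2 m3 m4)"
          by (subst prod.remove[OF P(1) p]) (rule norm_mult)
        also have "\<dots> \<le> 19 * of_int q powr (-1/4) * K"
          using 1 T_le[of "P - {p}"] by (intro mult_mono) auto
        finally show ?thesis using sp np K1 by (simp add: T4 T_ideal_def)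
      qed
    qed
    then show ?thesis using b0 by simp
  qed
qed

subsection \<open>The fourth moment of weighted sequences\<close>

definition FF :: "int \<Rightarrow> (int \<Rightarrow> int) \<Rightarrow> (int \<Rightarrow> complex) \<Rightarrow> int \<Rightarrow> complex" where
  "FF N x \<phi> k = (\<Sum>j\<in>{0..<N}. \<phi> j * of_int (x j) * ee N (j * k))"

definition N4 :: "int \<Rightarrow> (int \<Rightarrow> int) \<Rightarrow> (int \<Rightarrow> complex) \<Rightarrow> real" where
  "N4 N x \<phi> = (\<Sum>k\<in>{0..<N}. (norm (FF N x \<phi> k))^4) / of_int N"

definition Kp :: "int \<Rightarrow> bool \<Rightarrow> int set" where
  "Kp n e = {m \<in> {-n..<n}. even m = e}"

text \<open>Inclusion-exclusion over the three pairings: two of them hold together only if all four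
  indices agree, so the diagonal is counted three times and two copies are removed.\<close>

definition mainpart :: "int set \<Rightarrow> (int \<Rightarrow> complex) \<Rightarrow> real" where
  "mainpart A \<kappa> = 2 * (\<Sum>m\<in>A. (norm (\<kappa> m))^2)^2 + (norm (\<Sum>m\<in>A. (\<kappa> m)^2))^2 - 2 * (\<Sum>m\<in>A. (norm (\<kappa> m))^4)"

definition mainfun :: "int \<Rightarrow> (int \<Rightarrow> complex) \<Rightarrow> real" where
  "mainfun n \<kappa> = mainpart (Kp n True) \<kappa> + mainpart (Kp n False) \<kappa>"

lemma norm_power4: "of_real ((norm z)^4) = z * z * cnj z * cnj z" for z :: complex
proof -
  have "of_real ((norm z)^4) = (of_real ((norm z)^2))^2" by (simp flip: power_mult)
  also have "\<dots> = (z * cnj z)^2" by (simp only: complex_norm_square)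
  finally show ?thesis by (simp add: power2_eq_square mult_ac)
qed

lemma paired_sum:
  assumes "finite A"
  shows "(\<Sum>m1\<in>A. \<Sum>m2\<in>A. \<Sum>m3\<in>A. \<Sum>m4\<in>A. \<kappa> m1 * \<kappa> m2 * cnj (\<kappa> m3) * cnj (\<kappa> m4)
      * (if paired m1 m2 m3 m4 then 1 else 0)) = of_real (mainpart A \<kappa>)"
proof -
  define ob where "ob a b = (if a = b then 1 else 0 :: complex)" for a b :: int
  let ?t = "\<lambda>m1 m2 m3 m4. \<kappa> m1 * \<kappa> m2 * cnj (\<kappa> m3) * cnj (\<kappa> m4)"
  have o: "(\<Sum>b\<in>A. f b * ob a b) = f a" if "a \<in> A" for a and f :: "int \<Rightarrow> complex"
    using that assms by (simp add: ob_def if_distrib[of "(*) _"] cong: if_cong)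
  have pr: "(if paired m1 m2 m3 m4 then 1 else 0)
     = ob m1 m3 * ob m2 m4 + ob m1 m4 * ob m2 m3 + ob m1 m2 * ob m3 m4 - 2 * (ob m1 m2 * ob m1 m3 * ob m1 m4)" for m1 m2 m3 m4
    by (auto simp: paired_def ob_def)
  have A: "(\<Sum>m1\<in>A. \<Sum>m2\<in>A. \<kappa> m1 * \<kappa> m2 * cnj (\<kappa> m1) * cnj (\<kappa> m2)) = of_real ((\<Sum>m\<in>A. (norm (\<kappa> m))^2)^2)"
    unfolding power2_eq_square[of "sum _ _"] sum_product of_real_sum of_real_mult complex_norm_square
    by (simp add: mult_ac)
  have s1: "(\<Sum>m1\<in>A. \<Sum>m2\<in>A. \<Sum>m3\<in>A. \<Sum>m4\<in>A. ?t m1 m2 m3 m4 * (ob m1 m3 * ob m2 m4)) = of_real ((\<Sum>m\<in>A. (norm (\<kappa> m))^2)^2)"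
  proof -
    have "(\<Sum>m1\<in>A. \<Sum>m2\<in>A. \<Sum>m3\<in>A. \<Sum>m4\<in>A. ?t m1 m2 m3 m4 * (ob m1 m3 * ob m2 m4))
      = (\<Sum>m1\<in>A. \<Sum>m2\<in>A. (\<kappa> m1 * \<kappa> m2) * ((\<Sum>m3\<in>A. cnj (\<kappa> m3) * ob m1 m3) * (\<Sum>m4\<in>A. cnj (\<kappa> m4) * ob m2 m4)))"
      unfolding sum_product unfolding sum_distrib_left by (intro sum.cong refl) (simp add: mult_ac)
    also have "\<dots> = (\<Sum>m1\<in>A. \<Sum>m2\<in>A. \<kappa> m1 * \<kappa> m2 * cnj (\<kappa> m1) * cnj (\<kappa> m2))"
      by (intro sum.cong refl) (simp add: o)
    finally show ?thesis using A by simp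
  qed
  have s2: "(\<Sum>m1\<in>A. \<Sum>m2\<in>A. \<Sum>m3\<in>A. \<Sum>m4\<in>A. ?t m1 m2 m3 m4 * (ob m1 m4 * ob m2 m3)) = of_real ((\<Sum>m\<in>A. (norm (\<kappa> m))^2)^2)"
  proof -
    have "(\<Sum>m1\<in>A. \<Sum>m2\<in>A. \<Sum>m3\<in>A. \<Sum>m4\<in>A. ?t m1 m2 m3 m4 * (ob m1 m4 * ob m2 m3))
      = (\<Sum>m1\<in>A. \<Sum>m2\<in>A. (\<kappa> m1 * \<kappa> m2) * ((\<Sum>m3\<in>A. cnj (\<kappa> m3) * ob m2 m3) * (\<Sum>m4\<in>A. cnj (\<kappa> m4) * ob m1 m4)))"
      unfolding sum_product unfolding sum_distrib_left by (intro sum.cong refl) (simp add: mult_ac)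
    also have "\<dots> = (\<Sum>m1\<in>A. \<Sum>m2\<in>A. \<kappa> m1 * \<kappa> m2 * cnj (\<kappa> m1) * cnj (\<kappa> m2))"
      by (intro sum.cong refl) (simp add: o)
    finally show ?thesis using A by simp
  qed
  have s3: "(\<Sum>m1\<in>A. \<Sum>m2\<in>A. \<Sum>m3\<in>A. \<Sum>m4\<in>A. ?t m1 m2 m3 m4 * (ob m1 m2 * ob m3 m4)) = of_real ((norm (\<Sum>m\<in>A. (\<kappa> m)^2))^2)"
  proof -
    have "(\<Sum>m1\<in>A. \<Sum>m2\<in>A. \<Sum>m3\<in>A. \<Sum>m4\<in>A. ?t m1 m2 m3 m4 * (ob m1 m2 * ob m3 m4))
      = (\<Sum>m1\<in>A. \<Sum>m2\<in>A. (\<kappa> m1 * (\<kappa> m2 * ob m1 m2)) * (\<Sum>m3\<in>A. \<Sum>m4\<in>A. cnj (\<kappa> m3) * (cnj (\<kappa> m4) * ob m3 m4)))"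
      unfolding sum_distrib_left by (intro sum.cong refl) (simp add: mult_ac)
    also have "\<dots> = (\<Sum>m1\<in>A. \<kappa> m1 * (\<Sum>m2\<in>A. \<kappa> m2 * ob m1 m2)) * (\<Sum>m3\<in>A. cnj (\<kappa> m3) * (\<Sum>m4\<in>A. cnj (\<kappa> m4) * ob m3 m4))"
      by (simp only: sum_distrib_right[symmetric] sum_distrib_left[symmetric])
    also have "\<dots> = (\<Sum>m\<in>A. (\<kappa> m)^2) * cnj (\<Sum>m\<in>A. (\<kappa> m)^2)"
      by (simp add: o power2_eq_square)
    finally show ?thesis by (simp only: complex_norm_square)
  qed
  have s4: "(\<Sum>m1\<in>A. \<Sum>m2\<in>A. \<Sum>m3\<in>A. \<Sum>m4\<in>A. ?t m1 m2 m3 m4 * (ob m1 m2 * ob m1 m3 * ob m1 m4)) = of_real (\<Sum>m\<in>A. (norm (\<kappa> m))^4)"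
  proof -
    have "(\<Sum>m1\<in>A. \<Sum>m2\<in>A. \<Sum>m3\<in>A. \<Sum>m4\<in>A. ?t m1 m2 m3 m4 * (ob m1 m2 * ob m1 m3 * ob m1 m4))
      = (\<Sum>m1\<in>A. \<Sum>m2\<in>A. \<Sum>m3\<in>A. \<Sum>m4\<in>A. \<kappa> m1 * ((\<kappa> m2 * ob m1 m2) * ((cnj (\<kappa> m3) * ob m1 m3) * (cnj (\<kappa> m4) * ob m1 m4))))"
      by (intro sum.cong refl) (simp add: mult_ac)
    also have "\<dots> = (\<Sum>m1\<in>A. \<kappa> m1 * ((\<Sum>m2\<in>A. \<kappa> m2 * ob m1 m2) * ((\<Sum>m3\<in>A. cnj (\<kappa> m3) * ob m1 m3) * (\<Sum>m4\<in>A. cnj (\<kappa> m4) * ob m1 m4))))"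
      by (simp only: sum_distrib_right[symmetric] sum_distrib_left[symmetric])
    also have "\<dots> = (\<Sum>m\<in>A. of_real ((norm (\<kappa> m))^4))"
      unfolding norm_power4 by (intro sum.cong refl) (simp add: o mult_ac)
    finally show ?thesis by simp
  qed
  have "(\<Sum>m1\<in>A. \<Sum>m2\<in>A. \<Sum>m3\<in>A. \<Sum>m4\<in>A. ?t m1 m2 m3 m4 * (if paired m1 m2 m3 m4 then 1 else 0))
    = (\<Sum>m1\<in>A. \<Sum>m2\<in>A. \<Sum>m3\<in>A. \<Sum>m4\<in>A. ?t m1 m2 m3 m4 * (ob m1 m3 * ob m2 m4))
    + (\<Sum>m1\<in>A. \<Sum>m2\<in>A. \<Sum>m3\<in>A. \<Sum>m4\<in>A. ?t m1 m2 m3 m4 * (ob m1 m4 * ob m2 m3))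
    + (\<Sum>m1\<in>A. \<Sum>m2\<in>A. \<Sum>m3\<in>A. \<Sum>m4\<in>A. ?t m1 m2 m3 m4 * (ob m1 m2 * ob m3 m4))
    - 2 * (\<Sum>m1\<in>A. \<Sum>m2\<in>A. \<Sum>m3\<in>A. \<Sum>m4\<in>A. ?t m1 m2 m3 m4 * (ob m1 m2 * ob m1 m3 * ob m1 m4))"
    unfolding pr sum_distrib_left sum.distrib[symmetric] sum_subtractf[symmetric]
    by (intro sum.cong refl) (simp add: algebra_simps)
  then show ?thesis unfolding s1 s2 s3 s4 mainpart_def by simp
qed

lemma T_ideal_sum:
  "(\<Sum>m1\<in>{-n..<n}. \<Sum>m2\<in>{-n..<n}. \<Sum>m3\<in>{-n..<n}. \<Sum>m4\<in>{-n..<n}. \<kappa> m1 * \<kappa> m2 * cnj (\<kappa> m3) * cnj (\<kappa> m4)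
      * T_ideal m1 m2 m3 m4) = of_real (mainfun n \<kappa>)"
proof -
  let ?K = "{-n..<n}"
  define \<kappa>' where "\<kappa>' e m = (if even m = e then \<kappa> m else 0)" for e m
  have split: "\<kappa> m1 * \<kappa> m2 * cnj (\<kappa> m3) * cnj (\<kappa> m4) * T_ideal m1 m2 m3 m4
    = \<kappa>' True m1 * \<kappa>' True m2 * cnj (\<kappa>' True m3) * cnj (\<kappa>' True m4) * (if paired m1 m2 m3 m4 then 1 else 0)
    + \<kappa>' False m1 * \<kappa>' False m2 * cnj (\<kappa>' False m3) * cnj (\<kappa>' False m4) * (if paired m1 m2 m3 m4 then 1 else 0)" for m1 m2 m3 m4
    by (auto simp: T_ideal_def same_parity_def \<kappa>'_def)
  have mp: "mainpart ?K (\<kappa>' e) = mainpart (Kp n e) \<kappa>" for e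
  proof -
    have f: "(\<Sum>m\<in>Kp n e. f (\<kappa> m)) = (\<Sum>m\<in>?K. f (\<kappa>' e m))" if "f 0 = 0" for f :: "complex \<Rightarrow> 'a::comm_monoid_add"
      unfolding Kp_def by (subst sum.inter_filter) (auto simp: \<kappa>'_def that intro!: sum.cong)
    show ?thesis unfolding mainpart_def
      using f[of "\<lambda>z. (norm z)^2"] f[of "\<lambda>z. z^2"] f[of "\<lambda>z. (norm z)^4"] by simp
  qed
  show ?thesis unfolding split sum.distrib paired_sum[OF finite_atLeastLessThan_int] mp mainfun_def by simp
qed

section \<open>Expansion of the fourth moment in the spectrum of the cut-off\<close>

locale jacobi_setup =
  fixes P :: "int set" and q :: int and g :: "int \<Rightarrow> complex"
  assumes P: "finite P" "P \<noteq> {}" "\<And>p. p \<in> P \<Longrightarrow> prime p \<and> p > 2 \<and> q \<le> p" and q: "q > 2"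
    and g: "\<And>p. p \<in> P \<Longrightarrow> norm (g p) = 1"
    and fourier: "\<And>k. (\<Sum>j\<in>{0..<2 * \<Prod>P}. of_int (xseq P j) * ee (2 * \<Prod>P) (j * k))
       = of_real (2 * sqrt (of_int (\<Prod>P))) * Yfun P g k"
begin

definition n where "n = \<Prod>P"

definition N where "N = 2 * n"

abbreviation "x \<equiv> xseq P"

abbreviation "M4 \<equiv> N4 N x"

lemma n_pos: "n > 0"
  unfolding n_def using P(3) by (intro prod_pos) force

lemma N_pos: "N > 0"
  using n_pos by (simp add: N_def)

lemma q_le_n: "q \<le> n"
proof -
  obtain p where p: "p \<in> P" using P(2) by auto
  then have "p dvd n" unfolding n_def using P(1) dvd_prodI[of P p "\<lambda>x. x"] by simp
  then have "p \<le> n" using n_pos zdvd_imp_le by blast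
  then show ?thesis using P(3)[OF p] by simp
qed

lemma x_period: "x (j + N) = x j"
  using P(1) by (intro xseq_cong) (auto simp: N_def n_def)

text \<open>Multiplying the sequence by \<open>\<phi>\<close> convolves its transform with the
  Fourier coefficients of \<open>\<phi>\<close>.\<close>

lemma FF_eq:
  assumes per: "\<And>j. \<phi> (j + N) = \<phi> j"
  shows "FF N x \<phi> k = of_real (2 * sqrt (of_int n)) * (\<Sum>m\<in>{-n..<n}. fcoeff N \<phi> m * Yfun P g (k + m))"
proof -
  have K: "{-n..<n} = {-n..<-n+N}" by (simp add: N_def)
  have "FF N x \<phi> k = (\<Sum>j\<in>{0..<N}. (\<Sum>m\<in>{-n..<n}. fcoeff N \<phi> m * ee N (j * m)) * of_int (x j) * ee N (j * k))"
    unfolding FF_def K fourier_inversion[where N=N and f=\<phi> and a="-n", OF N_pos per, symmetric] ..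
  also have "\<dots> = (\<Sum>m\<in>{-n..<n}. fcoeff N \<phi> m * (\<Sum>j\<in>{0..<N}. of_int (x j) * ee N (j * (k + m))))"
    unfolding sum_distrib_left sum_distrib_right
    by (subst sum.swap) (simp add: ring_distribs ee_add mult_ac)
  also have "\<dots> = (\<Sum>m\<in>{-n..<n}. fcoeff N \<phi> m * (of_real (2 * sqrt (of_int n)) * Yfun P g (k + m)))"
    using fourier by (simp add: N_def n_def)
  finally show ?thesis by (simp add: sum_distrib_left mult_ac)
qed

text \<open>The constant 8: the fourth power of \<open>2 * sqrt n\<close> is
  \<open>16 * n^2\<close>, the normalisation of \<open>T4\<close> contributes \<open>n\<close>, and
  the mean divides by \<open>2 * n\<close>.\<close>

lemma N4_formula:
  assumes per: "\<And>j. \<phi> (j + N) = \<phi> j"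
  defines "\<kappa> \<equiv> fcoeff N \<phi>"
  shows "of_real (M4 \<phi>) = 8 * of_int n^2 * (\<Sum>m1\<in>{-n..<n}. \<Sum>m2\<in>{-n..<n}. \<Sum>m3\<in>{-n..<n}. \<Sum>m4\<in>{-n..<n}.
     \<kappa> m1 * \<kappa> m2 * cnj (\<kappa> m3) * cnj (\<kappa> m4) * T4 P g m1 m2 m3 m4)"
proof -
  let ?K = "{-n..<n}"
  let ?Z = "\<lambda>k. \<Sum>m\<in>?K. \<kappa> m * Yfun P g (k + m)"
  have r4: "(of_real (2 * sqrt (of_int n)) :: complex)^4 = 16 * of_int n^2"
  proof -
    have "(2 * sqrt (real_of_int n))^4 = 16 * ((sqrt (real_of_int n))^2)^2" by (simp add: power_mult_distrib flip: power_mult)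
    also have "\<dots> = 16 * of_int n^2" using n_pos by simp
    finally have "complex_of_real ((2 * sqrt (real_of_int n))^4) = of_real (16 * of_int n^2)" by (rule arg_cong)
    then show ?thesis by simp
  qed
  have Z: "?Z k * ?Z k * cnj (?Z k) * cnj (?Z k) = (\<Sum>m1\<in>?K. \<Sum>m2\<in>?K. \<Sum>m3\<in>?K. \<Sum>m4\<in>?K.
     \<kappa> m1 * \<kappa> m2 * cnj (\<kappa> m3) * cnj (\<kappa> m4) * (Yfun P g (k + m1) * Yfun P g (k + m2) * cnj (Yfun P g (k + m3)) * cnj (Yfun P g (k + m4))))" for k
    unfolding cnj_sum sum_prod4 by (intro sum.cong refl) (simp add: mult_ac)
  have "complex_of_real (M4 \<phi>) = (\<Sum>k\<in>{0..<N}. of_real ((norm (FF N x \<phi> k))^4)) / of_int N"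
    unfolding N4_def by simp
  also have "\<dots> = (\<Sum>k\<in>{0..<N}. 16 * of_int n^2 * (?Z k * ?Z k * cnj (?Z k) * cnj (?Z k))) / of_int N"
  proof (intro arg_cong2[where f="(/)"] sum.cong refl)
    fix k
    have "of_real ((norm (FF N x \<phi> k))^4) = FF N x \<phi> k * FF N x \<phi> k * cnj (FF N x \<phi> k) * cnj (FF N x \<phi> k)"
      by (rule norm_power4)
    also have "\<dots> = of_real (2 * sqrt (of_int n))^4 * (?Z k * ?Z k * cnj (?Z k) * cnj (?Z k))"
      unfolding FF_eq[of \<phi>, OF per] \<kappa>_def complex_cnj_mult complex_cnj_complex_of_real power4_eq_xxxx by (simp only: mult_ac)
    finally show "of_real ((norm (FF N x \<phi> k))^4) = 16 * of_int n^2 * (?Z k * ?Z k * cnj (?Z k) * cnj (?Z k))"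
      by (simp only: r4)
  qed
  also have "\<dots> = 8 * of_int n * (\<Sum>k\<in>{0..<N}. ?Z k * ?Z k * cnj (?Z k) * cnj (?Z k))"
    unfolding sum_distrib_left[symmetric] using n_pos by (simp add: N_def field_simps power2_eq_square)
  also have "(\<Sum>k\<in>{0..<N}. ?Z k * ?Z k * cnj (?Z k) * cnj (?Z k))
     = (\<Sum>m1\<in>?K. \<Sum>m2\<in>?K. \<Sum>m3\<in>?K. \<Sum>m4\<in>?K. \<kappa> m1 * \<kappa> m2 * cnj (\<kappa> m3) * cnj (\<kappa> m4) *
        (\<Sum>k\<in>{0..<N}. Yfun P g (k + m1) * Yfun P g (k + m2) * cnj (Yfun P g (k + m3)) * cnj (Yfun P g (k + m4))))"
    unfolding Z unfolding sum_distrib_left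
    by (subst sum.swap, rule sum.cong[OF refl], subst sum.swap, rule sum.cong[OF refl], subst sum.swap,
        rule sum.cong[OF refl], rule sum.swap)
  also have "\<dots> = (\<Sum>m1\<in>?K. \<Sum>m2\<in>?K. \<Sum>m3\<in>?K. \<Sum>m4\<in>?K. of_int n * (\<kappa> m1 * \<kappa> m2 * cnj (\<kappa> m3) * cnj (\<kappa> m4) * T4 P g m1 m2 m3 m4))"
    using n_pos by (intro sum.cong refl) (simp add: T4_def N_def flip: n_def)
  finally show ?thesis unfolding sum_distrib_left[symmetric] by (simp add: power2_eq_square mult_ac)
qed

definition Kexp :: real where "Kexp = exp (17 * real (card P) / sqrt (of_int q))"

definition Egen :: real where "Egen = Kexp - 1 + 19 * of_int q powr (-1/4) * Kexp"

text \<open>Absolute summability of \<open>\<kappa>\<close> controls the quadrilinear error: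
  \<open>L\<close> bounds its total mass and \<open>t\<close> the mass at frequencies that may be
  congruent modulo a prime. The factor 4 counts which index is large.\<close>

lemma N4_error:
  assumes per: "\<And>j. \<phi> (j + N) = \<phi> j"
  defines "\<kappa> \<equiv> fcoeff N \<phi>"
  assumes L: "(\<Sum>m\<in>{-n..<n}. norm (\<kappa> m)) \<le> L"
    and t: "(\<Sum>m\<in>{-n..<n}. norm (\<kappa> m) * (if 2 * \<bar>m\<bar> \<ge> q then 1 else 0)) \<le> t"
  shows "\<bar>M4 \<phi> - 8 * of_int n^2 * mainfun n \<kappa>\<bar> \<le> 8 * of_int n^2 * (Egen * L^4 + 4 * (Kexp + 1) * L^3 * t)"
proof -
  let ?K = "{-n..<n}"
  define big where "big m = (if 2 * \<bar>m\<bar> \<ge> q then 1 else 0 :: real)" for m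
  define a where "a m = norm (\<kappa> m)" for m
  let ?D = "Kexp + 1"
  have K1: "Kexp \<ge> 1" unfolding Kexp_def using q by simp
  have E0: "Egen \<ge> 0" unfolding Egen_def using K1 by simp
  have "of_real (M4 \<phi> - 8 * of_int n^2 * mainfun n \<kappa>) = 8 * of_int n^2 * (\<Sum>m1\<in>?K. \<Sum>m2\<in>?K. \<Sum>m3\<in>?K. \<Sum>m4\<in>?K.
     \<kappa> m1 * \<kappa> m2 * cnj (\<kappa> m3) * cnj (\<kappa> m4) * (T4 P g m1 m2 m3 m4 - T_ideal m1 m2 m3 m4))"
    (is "_ = _ * ?S")
    unfolding of_real_diff of_real_mult N4_formula[of \<phi>, OF per] T_ideal_sum[symmetric] \<kappa>_def
    by (simp add: right_diff_distrib sum_subtractf)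
  then have "\<bar>M4 \<phi> - 8 * of_int n^2 * mainfun n \<kappa>\<bar> = norm (8 * of_int n^2 * ?S)"
    by (metis norm_of_real)
  then have norm_eq: "\<bar>M4 \<phi> - 8 * of_int n^2 * mainfun n \<kappa>\<bar> = 8 * of_int n^2 * norm ?S"
    by (simp add: norm_mult norm_power)
  have "norm ?S \<le> (\<Sum>m1\<in>?K. \<Sum>m2\<in>?K. \<Sum>m3\<in>?K. \<Sum>m4\<in>?K. a m1 * a m2 * a m3 * a m4 * (Egen + ?D * (big m1 + big m2 + big m3 + big m4)))"
  proof (intro sum_norm_le)
    fix m1 m2 m3 m4
    have "norm (T4 P g m1 m2 m3 m4 - T_ideal m1 m2 m3 m4) \<le> Egen + ?D * (big m1 + big m2 + big m3 + big m4)"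
      unfolding Egen_def Kexp_def big_def using P q g by (intro T4_bound) auto
    then show "norm (\<kappa> m1 * \<kappa> m2 * cnj (\<kappa> m3) * cnj (\<kappa> m4) * (T4 P g m1 m2 m3 m4 - T_ideal m1 m2 m3 m4))
       \<le> a m1 * a m2 * a m3 * a m4 * (Egen + ?D * (big m1 + big m2 + big m3 + big m4))"
      unfolding norm_mult complex_mod_cnj a_def by (intro mult_left_mono) auto
  qed
  also have "\<dots> = Egen * (\<Sum>m1\<in>?K. \<Sum>m2\<in>?K. \<Sum>m3\<in>?K. \<Sum>m4\<in>?K. a m1 * a m2 * a m3 * a m4)
     + ?D * (\<Sum>m1\<in>?K. \<Sum>m2\<in>?K. \<Sum>m3\<in>?K. \<Sum>m4\<in>?K. (a m1 * big m1) * a m2 * a m3 * a m4)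
     + ?D * (\<Sum>m1\<in>?K. \<Sum>m2\<in>?K. \<Sum>m3\<in>?K. \<Sum>m4\<in>?K. a m1 * (a m2 * big m2) * a m3 * a m4)
     + ?D * (\<Sum>m1\<in>?K. \<Sum>m2\<in>?K. \<Sum>m3\<in>?K. \<Sum>m4\<in>?K. a m1 * a m2 * (a m3 * big m3) * a m4)
     + ?D * (\<Sum>m1\<in>?K. \<Sum>m2\<in>?K. \<Sum>m3\<in>?K. \<Sum>m4\<in>?K. a m1 * a m2 * a m3 * (a m4 * big m4))"
  proof -
    have pt: "a1 * a2 * a3 * a4 * (E + D * (b1 + b2 + b3 + b4)) = E * (a1 * a2 * a3 * a4) + D * ((a1 * b1) * a2 * a3 * a4)
      + D * (a1 * (a2 * b2) * a3 * a4) + D * (a1 * a2 * (a3 * b3) * a4) + D * (a1 * a2 * a3 * (a4 * b4))"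
      for a1 a2 a3 a4 b1 b2 b3 b4 E D :: real by (simp add: algebra_simps)
    show ?thesis by (simp only: pt sum.distrib sum_distrib_left[symmetric])
  qed
  also have "\<dots> = Egen * (\<Sum>m\<in>?K. a m)^4 + 4 * ?D * (\<Sum>m\<in>?K. a m)^3 * (\<Sum>m\<in>?K. a m * big m)"
    unfolding sum_prod4[symmetric] by (simp add: power4_eq_xxxx power3_eq_cube algebra_simps)
  also have "\<dots> \<le> Egen * L^4 + 4 * ?D * L^3 * t"
  proof -
    let ?A = "\<Sum>m\<in>?K. a m" and ?B = "\<Sum>m\<in>?K. a m * big m"
    have AB: "0 \<le> ?A" "0 \<le> ?B" "?A \<le> L" "?B \<le> t"
      using L t by (auto simp: a_def big_def intro!: sum_nonneg)
    have "?A^4 \<le> L^4" "?A^3 * ?B \<le> L^3 * t" using AB by (auto intro!: power_mono mult_mono)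
    then have "Egen * ?A^4 + (4 * ?D) * (?A^3 * ?B) \<le> Egen * L^4 + (4 * ?D) * (L^3 * t)"
      using K1 E0 by (intro add_mono mult_left_mono) auto
    then show ?thesis by (simp only: mult.assoc)
  qed
  finally show ?thesis unfolding norm_eq by (intro mult_left_mono) auto
qed

end

subsection \<open>Trapezoidal cut-offs\<close>

text \<open>Jordan's inequality: the sine is concave on this interval and lies above its
  chord.\<close>

lemma sin_ge_linear:
  fixes t :: real
  assumes "0 \<le> t" "t \<le> pi / 2"
  shows "2 * t / pi \<le> sin t"
proof -
  have "convex_on {0..pi / 2} (\<lambda>x. - sin x)"
  proof (rule f''_ge0_imp_convex[where f'="\<lambda>x. - cos x" and f''=sin])
    fix x assume "x \<in> {0..pi / 2}"
    then show "0 \<le> sin x" by (intro sin_ge_zero) auto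
  qed (auto intro!: derivative_eq_intros)
  from convex_onD[OF this, of "2 * t / pi" 0 "pi / 2"] assms show ?thesis
    by (simp add: field_simps)
qed

lemma norm_ee_minus_1_ge:
  assumes "N > 0" "2 * \<bar>m\<bar> \<le> N"
  shows "4 * \<bar>of_int m\<bar> / of_int N \<le> norm (ee N m - 1)"
proof -
  let ?t = "pi * \<bar>real_of_int m\<bar> / of_int N"
  have N0: "real_of_int N > 0" using assms by simp
  have "2 * \<bar>real_of_int m\<bar> \<le> of_int N" using assms(2) by linarith
  then have "?t \<le> pi / 2" using N0 by (simp add: field_simps)
  then have "2 * ?t / pi \<le> sin ?t" using N0 by (intro sin_ge_linear) auto
  then have "4 * \<bar>of_int m\<bar> / of_int N \<le> 2 * \<bar>sin ?t\<bar>" by simp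
  also have "\<bar>sin ?t\<bar> = \<bar>sin (pi * of_int m / of_int N)\<bar>" by (cases "m \<ge> 0") auto
  also have "2 * \<dots> = norm (ee N m - 1)"
    using dist_exp_i_1[of "2 * pi * of_int m / of_int N"] by (simp add: ee_def cis_conv_exp)
  finally show ?thesis .
qed

text \<open>A geometric sum is at most \<open>2 / norm (1 - z)\<close> whatever its length, and the
  chord \<open>norm (1 - z)\<close> is at least \<open>4 * \<bar>m\<bar> / N\<close>.\<close>

lemma dirichlet_kernel_bound:
  assumes N: "N > 0" and m: "m \<noteq> 0" "2 * \<bar>m\<bar> \<le> N"
  shows "norm (\<Sum>i\<in>{0..<L}. ee N (- (i * m))) \<le> of_int N / (2 * \<bar>of_int m\<bar>)"
proof (cases "L \<ge> 0")
  case True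
  define z where "z = ee N (- m)"
  have "{0..<L} = int ` {..<nat L}"
    using True by (auto simp: image_iff intro!: bexI[of _ "nat _"])
  then have "(\<Sum>i\<in>{0..<L}. ee N (- (i * m))) = (\<Sum>i<nat L. ee N (int i * (- m)))"
    by (simp add: sum.reindex)
  also have "\<dots> = (\<Sum>i<nat L. z ^ i)" by (simp only: ee_power z_def)
  finally have "(1 - z) * (\<Sum>i\<in>{0..<L}. ee N (- (i * m))) = 1 - z ^ nat L"
    by (simp add: one_diff_power_eq)
  moreover have "norm (1 - z ^ nat L) \<le> 2"
    using norm_triangle_ineq4[of 1 "z ^ nat L"] by (simp add: norm_power z_def)
  ultimately have "norm (1 - z) * norm (\<Sum>i\<in>{0..<L}. ee N (- (i * m))) \<le> 2"
    by (metis norm_mult)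
  moreover have ge: "4 * \<bar>of_int m\<bar> / of_int N \<le> norm (1 - z)"
    using norm_ee_minus_1_ge[of N "- m"] N m by (simp add: z_def norm_minus_commute)
  ultimately have "4 * \<bar>of_int m\<bar> / of_int N * norm (\<Sum>i\<in>{0..<L}. ee N (- (i * m))) \<le> 2"
    using mult_right_mono[OF ge norm_ge_zero[of "\<Sum>i\<in>{0..<L}. ee N (- (i * m))"]] by linarith
  then show ?thesis using N m by (simp add: field_simps)
qed (use N in auto)

section \<open>Cyclic intervals and their averages\<close>

definition ind :: "int \<Rightarrow> int \<Rightarrow> int \<Rightarrow> int \<Rightarrow> real" where
  "ind N a L j = (if (j - a) mod N < L then 1 else 0)"

text \<open>The convolution of an interval with an averaging window: a trapezoid with ramps of
  length about \<open>w\<close>, and a tent if \<open>L = w\<close>. Its Fourier coefficients are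
  products of two Dirichlet kernels.\<close>

definition trap :: "int \<Rightarrow> int \<Rightarrow> int \<Rightarrow> int \<Rightarrow> int \<Rightarrow> real" where
  "trap N a L w j = (\<Sum>i\<in>{0..<w}. ind N a L (j - i)) / of_int w"

lemma ind_period: "ind N a L (j + N) = ind N a L j"
proof -
  have "j + N - a = (j - a) + N" by simp
  then show ?thesis unfolding ind_def by (simp only: mod_add_self2)
qed

lemma trap_period: "trap N a L w (j + N) = trap N a L w j"
proof -
  have "j + N - i = (j - i) + N" for i by simp
  then show ?thesis unfolding trap_def by (simp only: ind_period)
qed

lemma trap_bounds: assumes "w > 0" shows "0 \<le> trap N a L w j" "trap N a L w j \<le> 1"
proof -
  have "(\<Sum>i\<in>{0..<w}. ind N a L (j - i)) \<le> (\<Sum>i\<in>{0..<w}. 1)" by (intro sum_mono) (simp add: ind_def)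
  then show "trap N a L w j \<le> 1" using assms by (simp add: trap_def)
  show "0 \<le> trap N a L w j" using assms by (auto simp: trap_def ind_def intro!: divide_nonneg_pos sum_nonneg)
qed

lemma sum_ind:
  fixes f :: "int \<Rightarrow> complex"
  assumes "N > 0" "0 \<le> L" "L \<le> N" and per: "\<And>j. f (j + N) = f j"
  shows "(\<Sum>j\<in>{0..<N}. of_real (ind N a L j) * f j) = (\<Sum>j\<in>{a..<a+L}. f j)"
proof -
  have "(\<Sum>j\<in>{0..<N}. of_real (ind N a L j) * f j) = (\<Sum>j\<in>{a..<a+N}. of_real (ind N a L j) * f j)"
    using assms by (intro sum_period_range[symmetric]) (auto simp: ind_period)
  also have "\<dots> = (\<Sum>j\<in>{a..<a+N}. if j < a + L then f j else 0)"
    by (intro sum.cong refl) (auto simp: ind_def)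
  also have "\<dots> = (\<Sum>j\<in>{j \<in> {a..<a+N}. j < a + L}. f j)" by (rule sum.inter_filter[symmetric]) simp
  also have "{j \<in> {a..<a+N}. j < a + L} = {a..<a+L}" using assms by auto
  finally show ?thesis .
qed

lemma sum_ind_real:
  assumes "N > 0" "0 \<le> L" "L \<le> N"
  shows "(\<Sum>j\<in>{0..<N}. ind N a L j) = of_int L"
proof -
  have "complex_of_real (\<Sum>j\<in>{0..<N}. ind N a L j) = of_real (of_int L)"
    using sum_ind[of N L "\<lambda>_. 1" a] assms by simp
  then show ?thesis using of_real_eq_iff by blast
qed

lemma sum_trap:
  assumes "N > 0" "0 \<le> L" "L \<le> N" "w > 0"
  shows "(\<Sum>j\<in>{0..<N}. trap N a L w j) = of_int L"
proof -
  have "(\<Sum>j\<in>{0..<N}. ind N a L (j - i)) = of_int L" for i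
    using sum_period_translate[of "ind N a L" N "-i"] sum_ind_real[OF assms(1-3)] assms(1) ind_period by simp
  then have "(\<Sum>i\<in>{0..<w}. \<Sum>j\<in>{0..<N}. ind N a L (j - i)) = of_int w * of_int L" using assms(4) by simp
  then show ?thesis using assms(4) unfolding trap_def sum_divide_distrib[symmetric]
    by (subst sum.swap) simp
qed

lemma fcoeff_ind:
  assumes "N > 0" "0 \<le> L" "L \<le> N"
  shows "fcoeff N (\<lambda>j. of_real (ind N a L j)) m = ee N (- (a * m)) * (\<Sum>i\<in>{0..<L}. ee N (- (i * m))) / of_int N"
proof -
  have "(\<Sum>j\<in>{0..<N}. of_real (ind N a L j) * ee N (- (j * m))) = (\<Sum>j\<in>{a..<a+L}. ee N (- (j * m)))"
    using assms by (intro sum_ind) (auto simp: algebra_simps intro!: ee_cong)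
  also have "\<dots> = (\<Sum>i\<in>{0..<L}. ee N (- ((a + i) * m)))"
    by (rule sum.reindex_bij_witness[of _ "\<lambda>i. a + i" "\<lambda>j. j - a"]) auto
  also have "\<dots> = ee N (- (a * m)) * (\<Sum>i\<in>{0..<L}. ee N (- (i * m)))"
    by (simp add: sum_distrib_left ee_add[symmetric] algebra_simps)
  finally show ?thesis by (simp add: fcoeff_def)
qed

lemma fcoeff_trap:
  assumes "N > 0"
  shows "fcoeff N (\<lambda>j. of_real (trap N a L w j)) m
    = (\<Sum>i\<in>{0..<w}. ee N (- (i * m))) * fcoeff N (\<lambda>j. of_real (ind N a L j)) m / of_int w"
proof -
  let ?S = "\<Sum>j\<in>{0..<N}. of_real (ind N a L j) * ee N (- (j * m))"
  have shift: "(\<Sum>j\<in>{0..<N}. of_real (ind N a L (j - i)) * ee N (- (j * m))) = ee N (- (i * m)) * ?S" for i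
  proof -
    let ?f = "\<lambda>j. of_real (ind N a L j) * ee N (- ((j + i) * m))"
    have "(\<Sum>j\<in>{0..<N}. of_real (ind N a L (j - i)) * ee N (- (j * m))) = (\<Sum>j\<in>{0..<N}. ?f (j + - i))" by simp
    also have "\<dots> = (\<Sum>j\<in>{0..<N}. ?f j)"
      using assms by (intro sum_period_translate[of ?f]) (auto simp: ind_period algebra_simps intro!: ee_cong)
    also have "\<dots> = ee N (- (i * m)) * ?S"
    proof -
      have "ee N (- ((j + i) * m)) = ee N (- (i * m)) * ee N (- (j * m))" for j
        by (simp add: ee_add[symmetric] algebra_simps)
      then show ?thesis by (simp add: sum_distrib_left mult_ac)
    qed
    finally show ?thesis .
  qed
  have "(\<Sum>j\<in>{0..<N}. of_real (trap N a L w j) * ee N (- (j * m)))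
     = (\<Sum>j\<in>{0..<N}. \<Sum>i\<in>{0..<w}. of_real (ind N a L (j - i)) * ee N (- (j * m)) / of_int w)"
    by (simp add: trap_def sum_distrib_right sum_divide_distrib)
  also have "\<dots> = (\<Sum>i\<in>{0..<w}. (\<Sum>j\<in>{0..<N}. of_real (ind N a L (j - i)) * ee N (- (j * m))) / of_int w)"
    by (subst sum.swap) (simp add: sum_divide_distrib)
  also have "\<dots> = (\<Sum>i\<in>{0..<w}. ee N (- (i * m))) * ?S / of_int w"
    unfolding shift by (simp add: sum_distrib_right sum_divide_distrib)
  finally show ?thesis by (simp add: fcoeff_def)
qed

text \<open>Each of the two kernels contributes a decay \<open>1 / m\<close>, so the coefficients
  are summable with a bound depending only on \<open>n / w\<close>.\<close>

lemma fcoeff_trap_bound: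
  assumes "n > 0" "0 \<le> L" "L \<le> 2 * n" "w > 0" "m \<noteq> 0" "\<bar>m\<bar> \<le> n"
  shows "norm (fcoeff (2 * n) (\<lambda>j. of_real (trap (2 * n) a L w j)) m) \<le> of_int n / (2 * of_int w) / (of_int m)^2"
proof -
  let ?d = "\<lambda>L. \<Sum>i\<in>{0..<L}. ee (2 * n) (- (i * m))"
  have d: "norm (?d L) \<le> of_int n / \<bar>of_int m\<bar>" for L
    using dirichlet_kernel_bound[of "2 * n" m L] assms by simp
  have "norm (fcoeff (2 * n) (\<lambda>j. of_real (trap (2 * n) a L w j)) m) = norm (?d w) * norm (?d L) / (2 * of_int n * of_int w)"
    using assms by (simp add: fcoeff_trap fcoeff_ind norm_mult norm_divide)
  also have "\<dots> \<le> (of_int n / \<bar>of_int m\<bar>) * (of_int n / \<bar>of_int m\<bar>) / (2 * of_int n * of_int w)"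
    using assms by (intro divide_right_mono mult_mono d) auto
  also have "\<dots> = of_int n / (2 * of_int w) / (of_int m)^2"
    using assms by (simp add: field_simps power2_eq_square abs_mult_self_eq)
  finally show ?thesis .
qed

lemma norm_fcoeff_le_1:
  assumes "N > 0" "\<And>j. norm (f j) \<le> 1"
  shows "norm (fcoeff N f m) \<le> 1"
proof -
  have "norm (\<Sum>j\<in>{0..<N}. f j * ee N (- (j * m))) \<le> (\<Sum>j\<in>{0..<N}. 1)"
    using assms by (intro sum_norm_le) (simp add: norm_mult)
  then show ?thesis using assms by (simp add: fcoeff_def norm_divide)
qed

text \<open>By telescoping; the subtracted \<open>1 / n\<close> is what carries the
  induction.\<close>

lemma sum_inverse_squares_int:
  fixes M n :: int
  assumes "2 \<le> M" "M - 1 \<le> n"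
  shows "(\<Sum>m\<in>{M..n}. 1 / (real_of_int m)^2) \<le> 1 / (of_int M - 1) - 1 / of_int n"
  using assms(2)
proof (induction n rule: int_ge_induct)
  case base
  then show ?case using assms(1) by simp
next
  case (step n)
  have n: "real_of_int n \<ge> 1" using step assms(1) by simp
  have "{M..n+1} = insert (n + 1) {M..n}" using step by auto
  then have "(\<Sum>m\<in>{M..n+1}. 1 / (real_of_int m)^2) = 1 / (of_int n + 1)^2 + (\<Sum>m\<in>{M..n}. 1 / (real_of_int m)^2)" by simp
  moreover have "1 / (real_of_int n + 1)^2 \<le> 1 / of_int n - 1 / (of_int n + 1)"
  proof -
    have "1 / of_int n - 1 / (of_int n + 1) = 1 / (real_of_int n * (of_int n + 1))" using n by (simp add: field_simps)
    moreover have "1 / (real_of_int n + 1)^2 \<le> 1 / (real_of_int n * (of_int n + 1))"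
      unfolding power2_eq_square using n by (intro divide_left_mono mult_right_mono) auto
    ultimately show ?thesis by simp
  qed
  ultimately show ?case using step.IH by simp
qed

lemma sum_symmetric_le:
  fixes f :: "int \<Rightarrow> real" and n :: int
  assumes "\<And>m. f m \<ge> 0" "n > 0"
  shows "(\<Sum>m\<in>{-n..<n}. f \<bar>m\<bar>) \<le> f 0 + 2 * (\<Sum>m\<in>{1..n}. f m)"
proof -
  have "(\<Sum>m\<in>{-n..<n}. f \<bar>m\<bar>) \<le> (\<Sum>m\<in>uminus ` {1..n} \<union> ({0} \<union> {1..n}). f \<bar>m\<bar>)"
    using assms by (intro sum_mono2) (auto simp: image_iff intro!: bexI[of _ "- _"])
  also have "\<dots> \<le> (\<Sum>m\<in>uminus ` {1..n}. f \<bar>m\<bar>) + (\<Sum>m\<in>{0} \<union> {1..n}. f \<bar>m\<bar>)"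
    using assms by (subst sum.union_disjoint) auto
  also have "(\<Sum>m\<in>uminus ` {1..n}. f \<bar>m\<bar>) = (\<Sum>m\<in>{1..n}. f m)"
    by (subst sum.reindex) (auto intro!: sum.cong)
  also have "(\<Sum>m\<in>{0} \<union> {1..n}. f \<bar>m\<bar>) = f 0 + (\<Sum>m\<in>{1..n}. f m)"
    by (subst sum.union_disjoint) auto
  finally show ?thesis by simp
qed

text \<open>With \<open>w\<close> proportional to \<open>n\<close> both bounds are free of
  \<open>n\<close>; this is the purpose of smoothing. Frequency 0 gives the summand 1, and each sign
  of the frequency gives at most \<open>2 * C\<close>.\<close>

lemma trap_coeff_sums:
  fixes n L w q a :: int and C :: real
  assumes n: "n > 0" and L: "0 \<le> L" "L \<le> 2 * n" and w: "w > 0" and q: "3 \<le> q" "q \<le> n"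
    and C: "of_int n / (2 * of_int w) \<le> C"
  defines "\<kappa> \<equiv> fcoeff (2 * n) (\<lambda>j. of_real (trap (2 * n) a L w j))"
  shows "(\<Sum>m\<in>{-n..<n}. norm (\<kappa> m)) \<le> 1 + 4 * C"
    and "(\<Sum>m\<in>{-n..<n}. norm (\<kappa> m) * (if 2 * \<bar>m\<bar> \<ge> q then 1 else 0)) \<le> 12 * C / of_int q"
proof -
  have C0: "C \<ge> 0" using n w by (intro order_trans[OF _ C]) auto
  have b0: "norm (\<kappa> 0) \<le> 1" unfolding \<kappa>_def
    using n trap_bounds[OF w] by (intro norm_fcoeff_le_1) auto
  have b: "norm (\<kappa> m) \<le> C / (of_int \<bar>m\<bar>)^2" if "m \<noteq> 0" "\<bar>m\<bar> \<le> n" for m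
  proof -
    have "norm (\<kappa> m) \<le> of_int n / (2 * of_int w) / (of_int m)^2"
      unfolding \<kappa>_def using that n L w by (intro fcoeff_trap_bound) auto
    also have "\<dots> \<le> C / (of_int m)^2" using C by (intro divide_right_mono) auto
    finally show ?thesis by simp
  qed
  define f where "f m = (if m = 0 then 1 else C / (of_int m)^2)" for m :: int
  have "(\<Sum>m\<in>{-n..<n}. norm (\<kappa> m)) \<le> (\<Sum>m\<in>{-n..<n}. f \<bar>m\<bar>)"
    using b0 b by (intro sum_mono) (auto simp: f_def)
  also have "\<dots> \<le> f 0 + 2 * (\<Sum>m\<in>{1..n}. f m)" using n C0 by (intro sum_symmetric_le) (auto simp: f_def)
  also have "(\<Sum>m\<in>{1..n}. f m) \<le> 2 * C"
  proof -
    have "{1..n} = insert 1 {2..n}" using n by auto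
    then have "(\<Sum>m\<in>{1..n}. f m) = C + C * (\<Sum>m\<in>{2..n}. 1 / (real_of_int m)^2)"
      by (simp add: f_def sum_distrib_left)
    also have "(\<Sum>m\<in>{2..n}. 1 / (real_of_int m)^2) \<le> 1"
    proof -
      have "(\<Sum>m\<in>{2..n}. 1 / (real_of_int m)^2) \<le> 1 - 1 / of_int n"
        using n sum_inverse_squares_int[of 2 n] by simp
      moreover have "1 / real_of_int n \<ge> 0" using n by simp
      ultimately show ?thesis by linarith
    qed
    finally show ?thesis using C0 by (simp add: mult_left_mono)
  qed
  finally show "(\<Sum>m\<in>{-n..<n}. norm (\<kappa> m)) \<le> 1 + 4 * C" by (simp add: f_def)
  define M where "M = (q + 1) div 2"
  have M: "2 \<le> M" "M - 1 \<le> n" "q \<le> 2 * M" using q by (auto simp: M_def)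
  define h where "h m = (if m \<ge> M then C / (of_int m)^2 else 0)" for m :: int
  have "(\<Sum>m\<in>{-n..<n}. norm (\<kappa> m) * (if 2 * \<bar>m\<bar> \<ge> q then 1 else 0)) \<le> (\<Sum>m\<in>{-n..<n}. h \<bar>m\<bar>)"
  proof (intro sum_mono)
    fix m assume m: "m \<in> {-n..<n}"
    show "norm (\<kappa> m) * (if 2 * \<bar>m\<bar> \<ge> q then 1 else 0) \<le> h \<bar>m\<bar>"
    proof (cases "2 * \<bar>m\<bar> \<ge> q")
      case True
      then have "M \<le> \<bar>m\<bar>" by (simp add: M_def)
      then show ?thesis using b[of m] m M True by (auto simp: h_def)
    qed (simp add: h_def C0)
  qed
  also have "\<dots> \<le> h 0 + 2 * (\<Sum>m\<in>{1..n}. h m)" using n C0 by (intro sum_symmetric_le) (auto simp: h_def)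
  also have "(\<Sum>m\<in>{1..n}. h m) = C * (\<Sum>m\<in>{M..n}. 1 / (real_of_int m)^2)"
  proof -
    have "(\<Sum>m\<in>{1..n}. h m) = (\<Sum>m\<in>{m \<in> {1..n}. m \<ge> M}. C / (of_int m)^2)"
      unfolding h_def by (simp only: sum.inter_filter finite_atLeastAtMost_int)
    also have "{m \<in> {1..n}. m \<ge> M} = {M..n}" using M by auto
    finally show ?thesis by (simp add: sum_distrib_left)
  qed
  finally have "(\<Sum>m\<in>{-n..<n}. norm (\<kappa> m) * (if 2 * \<bar>m\<bar> \<ge> q then 1 else 0)) \<le> 2 * C * (\<Sum>m\<in>{M..n}. 1 / (real_of_int m)^2)"
    using M by (simp add: h_def)
  also have "\<dots> \<le> 2 * C * (6 / of_int q)"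
  proof (intro mult_left_mono)
    have "(\<Sum>m\<in>{M..n}. 1 / (real_of_int m)^2) \<le> 1 / (of_int M - 1) - 1 / of_int n"
      using M by (intro sum_inverse_squares_int) auto
    also have "\<dots> \<le> 1 / (of_int M - 1)" using n by simp
    also have "\<dots> \<le> 1 / (of_int q / 6)"
    proof -
      \<comment> \<open>From \<open>q <= 2 * M\<close> and \<open>q >= 3\<close>:
        \<open>6 * (M - 1) >= 3 * q - 6 >= q\<close>.\<close>
      have "q \<le> 6 * (M - 1)" using M q by simp
      then have "real_of_int q \<le> real_of_int (6 * (M - 1))" by (simp only: of_int_le_iff)
      then show ?thesis using q by (intro divide_left_mono) auto
    qed
    finally show "(\<Sum>m\<in>{M..n}. 1 / (real_of_int m)^2) \<le> 6 / of_int q" by simp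
  qed (use C0 in simp)
  finally show "(\<Sum>m\<in>{-n..<n}. norm (\<kappa> m) * (if 2 * \<bar>m\<bar> \<ge> q then 1 else 0)) \<le> 12 * C / of_int q" by simp
qed

text \<open>Intervals of lengths \<open>n - w + 1\<close> and \<open>w\<close> convolve to a
  trapezoid supported exactly on the interval of length \<open>n\<close>. What is missing at its
  ends are the inner slopes of two tents whose peaks lie just outside, at \<open>R - 1\<close> and
  \<open>R + n\<close>.\<close>

lemma ind_minus_trap:
  assumes w: "w > 0" "2 * w \<le> n"
  defines "N \<equiv> 2 * n"
  shows "ind N R n j - trap N R (n - w + 1) w j = ind N R n j * (trap N (R - w) w w j + trap N (R + n - w + 1) w w j)"
proof -
  define t where "t = (j - R) mod N"
  have N0: "N > 0" using w by (simp add: N_def)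
  have t: "0 \<le> t" "t < N" using N0 by (auto simp: t_def)
  have md: "y mod N = (if y < 0 then y + N else y)" if "-N \<le> y" "y < N" for y
    using that mod_add_self2[of y N] mod_pos_pos_trivial[of "y + N" N] mod_pos_pos_trivial[of y N] by auto
  have sh: "(j - i - (R + c)) mod N = (t - i - c) mod N" for i c
  proof -
    have "(t - i - c) mod N = ((j - R) mod N - (i + c)) mod N" by (simp add: t_def algebra_simps)
    also have "\<dots> = ((j - R) - (i + c)) mod N" by (rule mod_diff_left_eq)
    finally show ?thesis by (simp add: algebra_simps)
  qed
  \<comment> \<open>The identity already holds for each translate \<open>i\<close> in the
    average.\<close>
  have tm: "ind N R n j - ind N R (n - w + 1) (j - i)
     = ind N R n j * (ind N (R - w) w (j - i) + ind N (R + n - w + 1) w (j - i))" if i: "i \<in> {0..<w}" for i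
  proof -
    have e1: "(j - i - R) mod N = (t - i) mod N" using sh[of i 0] by simp
    have e2: "(j - i - (R - w)) mod N = (t - i + w) mod N" using sh[of i "-w"] by simp
    have e3: "(j - i - (R + n - w + 1)) mod N = (t - i - (n - w + 1)) mod N" using sh[of i "n - w + 1"] by (simp add: algebra_simps)
    have m1: "(t - i) mod N = (if t - i < 0 then t - i + N else t - i)" using t i w by (intro md) (auto simp: N_def)
    show ?thesis
    proof (cases "t < n")
      case True
      have m2: "(t - i + w) mod N = t - i + w" using md[of "t - i + w"] True t i w by (auto simp: N_def)
      have m3: "(t - i - (n - w + 1)) mod N = (if t - i - (n - w + 1) < 0 then t - i - (n - w + 1) + N else t - i - (n - w + 1))"
        using True t i w by (intro md) (auto simp: N_def)
      show ?thesis unfolding ind_def e1 e2 e3 t_def[symmetric] m1 m2 m3 using True t i w by (auto simp: N_def)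
    next
      case False
      then show ?thesis unfolding ind_def e1 t_def[symmetric] m1 using t i w by (auto simp: N_def)
    qed
  qed
  have "ind N R n j - trap N R (n - w + 1) w j = (\<Sum>i\<in>{0..<w}. ind N R n j - ind N R (n - w + 1) (j - i)) / of_int w"
    using w by (simp add: trap_def sum_subtractf field_simps)
  also have "\<dots> = (\<Sum>i\<in>{0..<w}. ind N R n j * (ind N (R - w) w (j - i) + ind N (R + n - w + 1) w (j - i))) / of_int w"
    by (simp add: tm)
  finally show ?thesis
    by (simp add: trap_def sum_distrib_left[symmetric] sum.distrib add_divide_distrib ring_distribs)
qed

lemma tent_support:
  assumes w: "w > 0" "2 * w \<le> N" and j: "j \<in> {a + 2 * w..<a + N}"
  shows "trap N a w w j = 0"
proof -
  have "ind N a w (j - i) = 0" if "i \<in> {0..<w}" for i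
    using j w that by (auto simp: ind_def)
  then show ?thesis by (simp add: trap_def)
qed

subsection \<open>Truncation is bounded on \<open>L\<^sup>4\<close>\<close>

text \<open>M. Riesz: if \<open>F = G + Q\<close> and \<open>G\<^sup>2 (cnj Q)\<^sup>2\<close> has mean zero, then expanding
  \<open>cnj Q = cnj F - cnj G\<close> expresses the fourth moment of \<open>G\<close> through mixed moments of \<open>F\<close> and \<open>G\<close>.\<close>
lemma riesz_fourth_moment:
  fixes c :: "int \<Rightarrow> complex"
  assumes N: "N > 0"
    and sep: "\<And>a b d e. a \<in> A \<Longrightarrow> b \<in> A \<Longrightarrow> d \<in> B \<Longrightarrow> e \<in> B \<Longrightarrow> \<not> N dvd a + b - d - e"
  defines "G \<equiv> \<lambda>k. \<Sum>j\<in>A. c j * ee N (j * k)" and "Q \<equiv> \<lambda>k. \<Sum>j\<in>B. c j * ee N (j * k)"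
  shows "(\<Sum>k\<in>{0..<N}. (norm (G k))^4) \<le> 36 * (\<Sum>k\<in>{0..<N}. (norm (G k + Q k))^4)"
proof -
  let ?R = "{0..<N}"
  have GQ: "G k * G k * cnj (Q k) * cnj (Q k)
     = (\<Sum>a\<in>A. \<Sum>b\<in>A. \<Sum>d\<in>B. \<Sum>e\<in>B. c a * c b * cnj (c d) * cnj (c e) * ee N (k * (a + b - d - e)))" for k
    unfolding G_def Q_def cnj_sum sum_prod4
  proof (intro sum.cong refl)
    fix a b d e
    have "ee N (k * (a + b - d - e)) = ee N (a * k) * ee N (b * k) * ee N (- (d * k)) * ee N (- (e * k))"
      by (simp add: ee_add[symmetric] algebra_simps)
    then show "c a * ee N (a * k) * (c b * ee N (b * k)) * cnj (c d * ee N (d * k)) * cnj (c e * ee N (e * k))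
      = c a * c b * cnj (c d) * cnj (c e) * ee N (k * (a + b - d - e))"
      by (simp add: cnj_ee mult_ac)
  qed
  have zero: "(\<Sum>k\<in>?R. G k * G k * cnj (Q k) * cnj (Q k)) = 0"
  proof -
    have "(\<Sum>k\<in>?R. G k * G k * cnj (Q k) * cnj (Q k))
      = (\<Sum>a\<in>A. \<Sum>b\<in>A. \<Sum>d\<in>B. \<Sum>e\<in>B. c a * c b * cnj (c d) * cnj (c e) * (\<Sum>k\<in>?R. ee N (k * (a + b - d - e))))"
      unfolding GQ unfolding sum_distrib_left
      by (subst sum.swap, rule sum.cong[OF refl], subst sum.swap, rule sum.cong[OF refl], subst sum.swap,
        rule sum.cong[OF refl], rule sum.swap)
    also have "\<dots> = 0" using sep by (intro sum.neutral ballI) (simp add: ee_sum[OF N])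
    finally show ?thesis .
  qed
  have "complex_of_real (\<Sum>k\<in>?R. (norm (G k))^4) = (\<Sum>k\<in>?R. G k * G k * cnj (G k) * cnj (G k))"
    unfolding of_real_sum norm_power4 ..
  also have "\<dots> = (\<Sum>k\<in>?R. G k * G k * cnj (G k) * cnj (G k)) - (\<Sum>k\<in>?R. G k * G k * cnj (Q k) * cnj (Q k))"
    by (simp add: zero)
  also have "\<dots> = (\<Sum>k\<in>?R. 2 * (G k * G k * cnj (G k) * cnj (G k + Q k)) - G k * G k * cnj (G k + Q k) * cnj (G k + Q k))"
    unfolding sum_subtractf[symmetric] by (intro sum.cong refl) (simp add: algebra_simps)
  finally have "complex_of_real (\<Sum>k\<in>?R. (norm (G k))^4)
    = (\<Sum>k\<in>?R. 2 * (G k * G k * cnj (G k) * cnj (G k + Q k)) - G k * G k * cnj (G k + Q k) * cnj (G k + Q k))" .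
  then have "norm (complex_of_real (\<Sum>k\<in>?R. (norm (G k))^4)) \<le> (\<Sum>k\<in>?R. 3/4 * (norm (G k))^4 + 9 * (norm (G k + Q k))^4)"
  proof (elim ssubst, intro sum_norm_le)
    fix k
    define u v where "u = norm (G k)" and "v = norm (G k + Q k)"
    have "norm (2 * (G k * G k * cnj (G k) * cnj (G k + Q k)) - G k * G k * cnj (G k + Q k) * cnj (G k + Q k))
       \<le> norm (2 * (G k * G k * cnj (G k) * cnj (G k + Q k))) + norm (G k * G k * cnj (G k + Q k) * cnj (G k + Q k))"
      by (rule norm_triangle_ineq4)
    also have "\<dots> = 2 * (u * u * u * v) + u * u * v * v"
      unfolding norm_mult complex_mod_cnj u_def v_def by simp
    also have "\<dots> \<le> 3/4 * u^4 + 9 * v^4"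
    proof -
      \<comment> \<open>The squares are chosen so that the coefficient of \<open>u^4\<close> stays
        below 1: the moment of \<open>G\<close> can then be absorbed on the left, and 9 / (1 - 3/4)
        = 36.\<close>
      have "0 \<le> (u * u - 2 * (u * v))^2 / 2 + (u * u / 2 - 3 * (v * v))^2" by simp
      also have "\<dots> = 3/4 * u^4 + 9 * v^4 - (2 * (u * u * u * v) + u * u * v * v)"
        by (simp add: power2_eq_square power4_eq_xxxx field_simps)
      finally show ?thesis by simp
    qed
    finally show "norm (2 * (G k * G k * cnj (G k) * cnj (G k + Q k)) - G k * G k * cnj (G k + Q k) * cnj (G k + Q k))
       \<le> 3/4 * (norm (G k))^4 + 9 * (norm (G k + Q k))^4" by (simp add: u_def v_def)
  qed
  moreover have "norm (complex_of_real (\<Sum>k\<in>?R. (norm (G k))^4)) = (\<Sum>k\<in>?R. (norm (G k))^4)"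
    unfolding norm_of_real by (intro abs_of_nonneg sum_nonneg) auto
  ultimately have "(\<Sum>k\<in>?R. (norm (G k))^4) \<le> 3/4 * (\<Sum>k\<in>?R. (norm (G k))^4) + 9 * (\<Sum>k\<in>?R. (norm (G k + Q k))^4)"
    by (simp only: sum.distrib sum_distrib_left)
  then show ?thesis by simp
qed

lemma FF_range:
  assumes "N > 0" "\<And>j. \<phi> (j + N) = \<phi> j" "\<And>j. x (j + N) = x j"
  shows "FF N x \<phi> k = (\<Sum>j\<in>{a..<a+N}. \<phi> j * of_int (x j) * ee N (j * k))"
  unfolding FF_def using assms
  by (intro sum_period_range[symmetric]) (auto simp: ring_distribs ee_add ee_dvd)

text \<open>A cut at \<open>s\<close> separates a support of length \<open>2 * w\<close>: the sum of
  two points on the right minus that of two points on the left lies strictly between 0 and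
  \<open>4 * w\<close>, hence is not divisible by \<open>N\<close>. This is the mean-zero condition
  of the Riesz argument.\<close>

lemma N4_truncate:
  assumes N: "N > 0" and per: "\<And>j. \<phi> (j + N) = \<phi> j" "\<And>j. ct (j + N) = ct j" "\<And>j. x (j + N) = x j"
    and w: "w > 0" "4 * w \<le> N"
    and supp: "\<And>j. j \<in> {s + w..<s - w + N} \<Longrightarrow> \<phi> j = 0"
    and ct: "(\<forall>j\<in>{s - w..<s}. ct j = 0) \<and> (\<forall>j\<in>{s..<s + w}. ct j = 1) \<or> (\<forall>j\<in>{s - w..<s}. ct j = 1) \<and> (\<forall>j\<in>{s..<s + w}. ct j = 0)"
  shows "N4 N x (\<lambda>j. ct j * \<phi> j) \<le> 36 * N4 N x \<phi>"
proof -
  let ?l = "{s - w..<s}" and ?r = "{s..<s + w}"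
  define c where "c j = \<phi> j * of_int (x j)" for j
  have split: "FF N x \<psi> k = (\<Sum>j\<in>?l. \<psi> j * of_int (x j) * ee N (j * k)) + (\<Sum>j\<in>?r. \<psi> j * of_int (x j) * ee N (j * k))"
    if "\<And>j. \<psi> (j + N) = \<psi> j" "\<And>j. j \<in> {s + w..<s - w + N} \<Longrightarrow> \<psi> j = 0" for \<psi> k
  proof -
    have "FF N x \<psi> k = (\<Sum>j\<in>{s - w..<s - w + N}. \<psi> j * of_int (x j) * ee N (j * k))"
      using that(1) per(3) N by (intro FF_range)
    also have "\<dots> = (\<Sum>j\<in>?l \<union> ?r. \<psi> j * of_int (x j) * ee N (j * k))"
      using that(2) w by (intro sum.mono_neutral_right) auto
    also have "\<dots> = (\<Sum>j\<in>?l. \<psi> j * of_int (x j) * ee N (j * k)) + (\<Sum>j\<in>?r. \<psi> j * of_int (x j) * ee N (j * k))"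
      by (intro sum.union_disjoint) auto
    finally show ?thesis .
  qed
  have F: "FF N x \<phi> k = (\<Sum>j\<in>?l. c j * ee N (j * k)) + (\<Sum>j\<in>?r. c j * ee N (j * k))" for k
    unfolding c_def using per(1) supp by (rule split)
  have F': "FF N x (\<lambda>j. ct j * \<phi> j) k = (\<Sum>j\<in>?l. ct j * \<phi> j * of_int (x j) * ee N (j * k)) + (\<Sum>j\<in>?r. ct j * \<phi> j * of_int (x j) * ee N (j * k))" for k
    using per supp by (intro split) auto
  have nd: "\<not> N dvd y" if "y \<noteq> 0" "\<bar>y\<bar> < N" for y using that dvd_imp_le_int[of y N] by auto
  have "(\<Sum>k\<in>{0..<N}. (norm (FF N x (\<lambda>j. ct j * \<phi> j) k))^4) \<le> 36 * (\<Sum>k\<in>{0..<N}. (norm (FF N x \<phi> k))^4)"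
    using ct
  proof
    assume ct: "(\<forall>j\<in>?l. ct j = 0) \<and> (\<forall>j\<in>?r. ct j = 1)"
    then have "FF N x (\<lambda>j. ct j * \<phi> j) k = (\<Sum>j\<in>?r. c j * ee N (j * k))" for k
      unfolding F' by (simp add: c_def)
    then show ?thesis unfolding F
      using riesz_fourth_moment[OF N, of ?r ?l c] w by (simp add: nd add.commute)
  next
    assume ct: "(\<forall>j\<in>?l. ct j = 1) \<and> (\<forall>j\<in>?r. ct j = 0)"
    then have "FF N x (\<lambda>j. ct j * \<phi> j) k = (\<Sum>j\<in>?l. c j * ee N (j * k))" for k
      unfolding F' by (simp add: c_def)
    then show ?thesis unfolding F
      using riesz_fourth_moment[OF N, of ?l ?r c] w by (simp add: nd)
  qed
  then show ?thesis unfolding N4_def using N by (simp add: divide_right_mono)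
qed

subsection \<open>The main term\<close>

lemma norm_sum_squares_le: "norm (\<Sum>m\<in>A. (\<kappa> m)^2) \<le> (\<Sum>m\<in>A. (norm (\<kappa> m))^2)" for \<kappa> :: "int \<Rightarrow> complex"
  by (intro sum_norm_le) (simp add: norm_power)

lemma mainpart_le: "mainpart A \<kappa> \<le> 3 * (\<Sum>m\<in>A. (norm (\<kappa> m))^2)^2"
proof -
  have "(norm (\<Sum>m\<in>A. (\<kappa> m)^2))^2 \<le> (\<Sum>m\<in>A. (norm (\<kappa> m))^2)^2"
    by (intro power_mono norm_sum_squares_le) auto
  moreover have "(\<Sum>m\<in>A. (norm (\<kappa> m))^4) \<ge> 0" by (intro sum_nonneg) auto
  ultimately show ?thesis by (simp add: mainpart_def)
qed

lemma Kp_partition: "Kp n True \<union> Kp n False = {-n..<n}" "Kp n True \<inter> Kp n False = {}" "finite (Kp n e)"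
  by (auto simp: Kp_def intro: finite_subset[of _ "{-n..<n}"])

lemma sum_Kp: "(\<Sum>m\<in>{-n..<n}. f m) = (\<Sum>m\<in>Kp n True. f m) + (\<Sum>m\<in>Kp n False. f m)"
  for f :: "int \<Rightarrow> 'a::comm_monoid_add"
  unfolding Kp_partition(1)[symmetric] using Kp_partition by (intro sum.union_disjoint) auto

text \<open>The bound is quadratic in the square mass of the coefficients: a tent whose mass is of
  order \<delta> has a main term of order \<delta>^2.\<close>

lemma mainfun_le: "mainfun n \<kappa> \<le> 3 * (\<Sum>m\<in>{-n..<n}. (norm (\<kappa> m))^2)^2"
proof -
  let ?a = "\<Sum>m\<in>Kp n True. (norm (\<kappa> m))^2" and ?b = "\<Sum>m\<in>Kp n False. (norm (\<kappa> m))^2"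
  have "0 \<le> ?a * ?b" by (intro mult_nonneg_nonneg sum_nonneg) auto
  then have "3 * ?a^2 + 3 * ?b^2 \<le> 3 * (?a + ?b)^2" by (simp add: power2_sum)
  then show ?thesis unfolding mainfun_def sum_Kp
    using mainpart_le[of "Kp n True" \<kappa>] mainpart_le[of "Kp n False" \<kappa>] by linarith
qed

text \<open>Each of the three functionals changes by at most twice the weighted distance; their
  weights 2, 1 and 2 give the constant 10.\<close>

lemma mainpart_diff:
  assumes A: "finite A" and s: "(\<Sum>m\<in>A. (norm (\<kappa> m))^2) \<le> 1" "(\<Sum>m\<in>A. (norm (\<kappa>' m))^2) \<le> 1"
  shows "\<bar>mainpart A \<kappa> - mainpart A \<kappa>'\<bar> \<le> 10 * (\<Sum>m\<in>A. norm (\<kappa> m - \<kappa>' m) * (norm (\<kappa> m) + norm (\<kappa>' m)))"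
proof -
  define \<Delta> where "\<Delta> = (\<Sum>m\<in>A. norm (\<kappa> m - \<kappa>' m) * (norm (\<kappa> m) + norm (\<kappa>' m)))"
  define S where "S \<kappa> = (\<Sum>m\<in>A. (norm (\<kappa> m))^2)" for \<kappa> :: "int \<Rightarrow> complex"
  define B where "B \<kappa> = (\<Sum>m\<in>A. (\<kappa> m)^2)" for \<kappa> :: "int \<Rightarrow> complex"
  define C where "C \<kappa> = (\<Sum>m\<in>A. (norm (\<kappa> m))^4)" for \<kappa> :: "int \<Rightarrow> complex"
  have S: "0 \<le> S \<kappa>" "0 \<le> S \<kappa>'" "S \<kappa> \<le> 1" "S \<kappa>' \<le> 1" using s by (auto simp: S_def intro!: sum_nonneg)
  have d: "\<bar>(norm (\<kappa> m))^2 - (norm (\<kappa>' m))^2\<bar> \<le> norm (\<kappa> m - \<kappa>' m) * (norm (\<kappa> m) + norm (\<kappa>' m))" for m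
  proof -
    have "\<bar>(norm (\<kappa> m))^2 - (norm (\<kappa>' m))^2\<bar> = \<bar>norm (\<kappa> m) - norm (\<kappa>' m)\<bar> * (norm (\<kappa> m) + norm (\<kappa>' m))"
      by (simp add: power2_eq_square square_diff_square_factored abs_mult)
    also have "\<dots> \<le> norm (\<kappa> m - \<kappa>' m) * (norm (\<kappa> m) + norm (\<kappa>' m))"
      by (intro mult_right_mono norm_triangle_ineq3) auto
    finally show ?thesis .
  qed
  have "\<bar>S \<kappa> - S \<kappa>'\<bar> \<le> \<Delta>"
    unfolding S_def \<Delta>_def sum_subtractf[symmetric] by (intro order_trans[OF sum_abs] sum_mono d)
  moreover have "\<bar>(S \<kappa>)^2 - (S \<kappa>')^2\<bar> = \<bar>S \<kappa> - S \<kappa>'\<bar> * (S \<kappa> + S \<kappa>')"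
    using S by (simp add: power2_eq_square square_diff_square_factored abs_mult)
  ultimately have 1: "\<bar>(S \<kappa>)^2 - (S \<kappa>')^2\<bar> \<le> \<Delta> * 2" using S by (auto intro!: mult_mono)
  have nB: "norm (B \<kappa>) \<le> 1" "norm (B \<kappa>') \<le> 1"
    using norm_sum_squares_le[of \<kappa> A] norm_sum_squares_le[of \<kappa>' A] s by (auto simp: B_def)
  have "norm (B \<kappa> - B \<kappa>') \<le> \<Delta>"
    unfolding B_def \<Delta>_def sum_subtractf[symmetric]
  proof (intro sum_norm_le)
    fix m
    have "(\<kappa> m)^2 - (\<kappa>' m)^2 = (\<kappa> m - \<kappa>' m) * (\<kappa> m + \<kappa>' m)" by (simp add: power2_eq_square algebra_simps)
    then show "norm ((\<kappa> m)^2 - (\<kappa>' m)^2) \<le> norm (\<kappa> m - \<kappa>' m) * (norm (\<kappa> m) + norm (\<kappa>' m))"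
      by (simp add: norm_mult mult_left_mono norm_triangle_ineq)
  qed
  then have "\<bar>norm (B \<kappa>) - norm (B \<kappa>')\<bar> \<le> \<Delta>" using norm_triangle_ineq3[of "B \<kappa>" "B \<kappa>'"] by linarith
  moreover have "\<bar>(norm (B \<kappa>))^2 - (norm (B \<kappa>'))^2\<bar> = \<bar>norm (B \<kappa>) - norm (B \<kappa>')\<bar> * (norm (B \<kappa>) + norm (B \<kappa>'))"
    by (simp add: power2_eq_square square_diff_square_factored abs_mult)
  ultimately have 2: "\<bar>(norm (B \<kappa>))^2 - (norm (B \<kappa>'))^2\<bar> \<le> \<Delta> * 2" using nB by (auto intro!: mult_mono)
  have 3: "\<bar>C \<kappa> - C \<kappa>'\<bar> \<le> \<Delta> * 2"
    unfolding C_def \<Delta>_def sum_subtractf[symmetric] sum_distrib_right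
  proof (intro order_trans[OF sum_abs] sum_mono)
    fix m assume m: "m \<in> A"
    have le: "(norm (\<kappa> m))^2 \<le> S \<kappa>" "(norm (\<kappa>' m))^2 \<le> S \<kappa>'"
      unfolding S_def using A m by (auto intro!: member_le_sum)
    have "\<bar>(norm (\<kappa> m))^4 - (norm (\<kappa>' m))^4\<bar> = \<bar>(norm (\<kappa> m))^2 - (norm (\<kappa>' m))^2\<bar> * ((norm (\<kappa> m))^2 + (norm (\<kappa>' m))^2)"
    proof -
      have "x^4 - y^4 = (x^2 - y^2) * (x^2 + y^2)" for x y :: real
        by (simp add: power4_eq_xxxx power2_eq_square algebra_simps)
      then show ?thesis by (simp add: abs_mult)
    qed
    also have "\<dots> \<le> norm (\<kappa> m - \<kappa>' m) * (norm (\<kappa> m) + norm (\<kappa>' m)) * 2"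
      using le S d[of m] by (intro mult_mono) auto
    finally show "\<bar>(norm (\<kappa> m))^4 - (norm (\<kappa>' m))^4\<bar> \<le> norm (\<kappa> m - \<kappa>' m) * (norm (\<kappa> m) + norm (\<kappa>' m)) * 2" .
  qed
  have "mainpart A \<kappa> - mainpart A \<kappa>' = 2 * ((S \<kappa>)^2 - (S \<kappa>')^2) + ((norm (B \<kappa>))^2 - (norm (B \<kappa>'))^2) - 2 * (C \<kappa> - C \<kappa>')"
    by (simp add: mainpart_def S_def B_def C_def)
  moreover have "\<bar>y\<bar> \<le> 10 * d" if "y = 2 * s + t - 2 * c" "\<bar>s\<bar> \<le> d * 2" "\<bar>t\<bar> \<le> d * 2" "\<bar>c\<bar> \<le> d * 2" for y s t c d :: real
    using that by linarith
  ultimately show ?thesis unfolding \<Delta>_def[symmetric] using 1 2 3 by blast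
qed

text \<open>A Cauchy-Schwarz estimate in its parametrised form: the free \<open>\<eta>\<close>
  replaces the square root of \<open>D\<close> by a choice made later.\<close>

lemma mainfun_diff:
  assumes s: "(\<Sum>m\<in>{-n..<n}. (norm (\<kappa> m))^2) \<le> 1" "(\<Sum>m\<in>{-n..<n}. (norm (\<kappa>' m))^2) \<le> 1"
    and D: "(\<Sum>m\<in>{-n..<n}. (norm (\<kappa> m - \<kappa>' m))^2) \<le> D" and "\<eta> > 0"
  shows "\<bar>mainfun n \<kappa> - mainfun n \<kappa>'\<bar> \<le> 10 * (D / (2 * \<eta>) + 2 * \<eta>)"
proof -
  let ?t = "\<lambda>m. norm (\<kappa> m - \<kappa>' m) * (norm (\<kappa> m) + norm (\<kappa>' m))"
  have part: "\<bar>mainpart (Kp n e) \<kappa> - mainpart (Kp n e) \<kappa>'\<bar> \<le> 10 * (\<Sum>m\<in>Kp n e. ?t m)" for e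
  proof (rule mainpart_diff)
    have le: "(\<Sum>m\<in>Kp n e. (norm (\<kappa> m))^2) \<le> (\<Sum>m\<in>{-n..<n}. (norm (\<kappa> m))^2)" for \<kappa> :: "int \<Rightarrow> complex"
      by (intro sum_mono2) (auto simp: Kp_def)
    show "(\<Sum>m\<in>Kp n e. (norm (\<kappa> m))^2) \<le> 1" "(\<Sum>m\<in>Kp n e. (norm (\<kappa>' m))^2) \<le> 1"
      using le[of \<kappa>] le[of \<kappa>'] s by linarith+
  qed (rule Kp_partition)
  have "\<bar>mainfun n \<kappa> - mainfun n \<kappa>'\<bar> \<le> 10 * (\<Sum>m\<in>{-n..<n}. ?t m)"
  proof -
    have "\<bar>mainfun n \<kappa> - mainfun n \<kappa>'\<bar> \<le> \<bar>mainpart (Kp n True) \<kappa> - mainpart (Kp n True) \<kappa>'\<bar>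
       + \<bar>mainpart (Kp n False) \<kappa> - mainpart (Kp n False) \<kappa>'\<bar>"
      unfolding mainfun_def by linarith
    also have "\<dots> \<le> 10 * (\<Sum>m\<in>Kp n True. ?t m) + 10 * (\<Sum>m\<in>Kp n False. ?t m)"
      by (intro add_mono part)
    finally show ?thesis by (simp only: sum_Kp distrib_left)
  qed
  also have "(\<Sum>m\<in>{-n..<n}. ?t m) \<le> (\<Sum>m\<in>{-n..<n}. (norm (\<kappa> m - \<kappa>' m))^2 / (2 * \<eta>) + \<eta> * ((norm (\<kappa> m))^2 + (norm (\<kappa>' m))^2))"
  proof (intro sum_mono)
    fix m
    define u a b where "u = norm (\<kappa> m - \<kappa>' m)" and "a = norm (\<kappa> m)" and "b = norm (\<kappa>' m)"
    have "0 \<le> (u - \<eta> * (a + b))^2 / (2 * \<eta>) + \<eta> / 2 * (a - b)^2" using \<open>\<eta> > 0\<close> by simp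
    also have "\<dots> = u^2 / (2 * \<eta>) + \<eta> * (a^2 + b^2) - u * (a + b)"
      using \<open>\<eta> > 0\<close> by (simp add: field_simps power2_eq_square)
    finally show "?t m \<le> (norm (\<kappa> m - \<kappa>' m))^2 / (2 * \<eta>) + \<eta> * ((norm (\<kappa> m))^2 + (norm (\<kappa>' m))^2)"
      unfolding u_def a_def b_def by simp
  qed
  also have "\<dots> = (\<Sum>m\<in>{-n..<n}. (norm (\<kappa> m - \<kappa>' m))^2) / (2 * \<eta>)
      + \<eta> * ((\<Sum>m\<in>{-n..<n}. (norm (\<kappa> m))^2) + (\<Sum>m\<in>{-n..<n}. (norm (\<kappa>' m))^2))"
    by (simp only: sum.distrib sum_divide_distrib sum_distrib_left distrib_left)
  also have "\<dots> \<le> D / (2 * \<eta>) + \<eta> * 2"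
    using s D \<open>\<eta> > 0\<close> by (intro add_mono divide_right_mono mult_left_mono) auto
  finally show ?thesis by (simp add: mult_ac)
qed

section \<open>Exact evaluation for an interval\<close>

lemma sum_squares_int:
  fixes n :: int
  assumes "n \<ge> 0"
  shows "(\<Sum>k\<in>{1..n}. (real_of_int k)^2) = of_int n * (of_int n + 1) * (2 * of_int n + 1) / 6"
  using assms
proof (induction n rule: int_ge_induct)
  case (step n)
  have "{1..n+1} = insert (n + 1) {1..n}" using step by auto
  then show ?case using step by (simp add: field_simps power2_eq_square)
qed simp

lemma sum_triangle_squares:
  fixes n :: int
  assumes "n > 0"
  shows "(\<Sum>j\<in>{-n..<n}. (real_of_int (n - \<bar>j\<bar>))^2) = of_int n * (2 * (of_int n)^2 + 1) / 3"
proof -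
  have "{-n..<n} = {-n..<0} \<union> {0..<n}" using assms by auto
  then have "(\<Sum>j\<in>{-n..<n}. (real_of_int (n - \<bar>j\<bar>))^2)
     = (\<Sum>j\<in>{-n..<0}. (real_of_int (n - \<bar>j\<bar>))^2) + (\<Sum>j\<in>{0..<n}. (real_of_int (n - \<bar>j\<bar>))^2)"
    by (simp only:, intro sum.union_disjoint) auto
  also have "(\<Sum>j\<in>{-n..<0}. (real_of_int (n - \<bar>j\<bar>))^2) = (\<Sum>k\<in>{0..<n}. (real_of_int k)^2)"
    by (rule sum.reindex_bij_witness[of _ "\<lambda>k. k - n" "\<lambda>j. j + n"]) auto
  also have "\<dots> = (\<Sum>k\<in>{1..n-1}. (real_of_int k)^2)"
    by (rule sum.mono_neutral_right) auto
  also have "(\<Sum>j\<in>{0..<n}. (real_of_int (n - \<bar>j\<bar>))^2) = (\<Sum>k\<in>{1..n}. (real_of_int k)^2)"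
    by (rule sum.reindex_bij_witness[of _ "\<lambda>k. n - k" "\<lambda>j. n - j"]) auto
  finally show ?thesis using sum_squares_int[of n] sum_squares_int[of "n - 1"] assms
    by (simp add: field_simps power2_eq_square)
qed

text \<open>With period \<open>2 * n\<close> an interval of length \<open>n\<close> does not meet
  its translate a second time around the circle, so the autocorrelation is exactly a
  triangle.\<close>

lemma interval_autocorrelation:
  fixes n j :: int
  assumes n: "n > 0" and j: "j \<in> {-n..<n}"
  shows "(\<Sum>i\<in>{0..<2 * n}. ind (2 * n) R n i * ind (2 * n) R n (i + j)) = of_int (n - \<bar>j\<bar>)"
proof -
  have per: "ind (2 * n) R n (i + 2 * n + j) = ind (2 * n) R n (i + j)" for i
    using ind_period[of "2 * n" R n "i + j"] by (simp add: algebra_simps)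
  have "complex_of_real (\<Sum>i\<in>{0..<2 * n}. ind (2 * n) R n i * ind (2 * n) R n (i + j))
     = (\<Sum>i\<in>{0..<2 * n}. of_real (ind (2 * n) R n i) * of_real (ind (2 * n) R n (i + j)))" by simp
  also have "\<dots> = (\<Sum>i\<in>{R..<R+n}. of_real (ind (2 * n) R n (i + j)))"
    using n by (intro sum_ind[of "2 * n" n "\<lambda>i. of_real (ind (2 * n) R n (i + j))"]) (auto simp: per)
  also have "\<dots> = (\<Sum>i\<in>{R..<R+n}. if 0 \<le> i + j - R \<and> i + j - R < n then 1 else 0)"
  proof (intro sum.cong refl)
    fix i assume i: "i \<in> {R..<R+n}"
    define y where "y = i + j - R"
    have y: "-n \<le> y" "y < 2 * n" using i j by (auto simp: y_def)
    have "y mod (2 * n) < n \<longleftrightarrow> 0 \<le> y \<and> y < n"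
    proof (cases "y \<ge> 0")
      case False
      then have "y mod (2 * n) = y + 2 * n" using y mod_add_self2[of y "2 * n"] mod_pos_pos_trivial[of "y + 2 * n" "2 * n"] by auto
      then show ?thesis using y False by auto
    qed (use y in auto)
    then show "complex_of_real (ind (2 * n) R n (i + j)) = (if 0 \<le> i + j - R \<and> i + j - R < n then 1 else 0)"
      by (simp add: ind_def y_def)
  qed
  also have "\<dots> = (\<Sum>i\<in>{i \<in> {R..<R+n}. 0 \<le> i + j - R \<and> i + j - R < n}. 1)"
    by (rule sum.inter_filter[symmetric]) simp
  also have "{i \<in> {R..<R+n}. 0 \<le> i + j - R \<and> i + j - R < n} = {R + max 0 (-j)..<R + min n (n - j)}"
    by auto
  also have "(\<Sum>i\<in>{R + max 0 (-j)..<R + min n (n - j)}. 1 :: complex) = of_real (of_int (n - \<bar>j\<bar>))"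
    using j by (cases "j \<ge> 0") auto
  finally show ?thesis using of_real_eq_iff by blast
qed

text \<open>\<open>cnt\<close> is the overlap of the interval with its reflection. All even
  frequencies except 0 vanish, so totals over all frequencies determine the odd part. The three
  totals come from Parseval's identity for the indicator, for the indicator against its reflection,
  and for the autocorrelation, whose transform is \<open>N * (norm (\<kappa> m))^2\<close>.\<close>

lemma mainfun_interval:
  fixes n R :: int
  assumes n: "n > 0"
  defines "N \<equiv> 2 * n"
  defines "\<kappa> \<equiv> fcoeff N (\<lambda>j. of_real (ind N R n j))"
  defines "cnt \<equiv> (\<Sum>j\<in>{0..<N}. ind N R n j * ind N R n (- j))"
  shows "8 * mainfun n \<kappa> = 7/6 + 2 * (cnt / of_int n - 1/2)^2 - 2 / (3 * (of_int n)^2)"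
proof -
  let ?K = "{-n..<n}"
  have N0: "N > 0" using n by (simp add: N_def)
  have KN: "?K = {-n..<-n+N}" by (simp add: N_def)
  define f where "f j = complex_of_real (ind N R n j)" for j
  have per: "f (j + N) = f j" for j by (simp add: f_def ind_period)
  have \<kappa>: "\<kappa> = fcoeff N f" by (simp add: \<kappa>_def f_def[abs_def])
  have cnjf: "cnj (f j) = f j" for j by (simp add: f_def)
  \<comment> \<open>Even frequencies: the two halves of the period make up a constant function.\<close>
  have even0: "\<kappa> m = (if m = 0 then 1/2 else 0)" if m: "m \<in> Kp n True" for m
  proof -
    obtain m' where m': "m = 2 * m'" using m by (auto simp: Kp_def elim: evenE)
    have "(\<Sum>i\<in>{0..<n}. ee N (- (i * m))) = (\<Sum>i\<in>{0..<n}. ee n (i * (- m')))"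
    proof (intro sum.cong refl)
      fix i
      have "- (i * m) = 2 * (i * (- m'))" by (simp add: m')
      then show "ee N (- (i * m)) = ee n (i * (- m'))" unfolding N_def by (simp only: ee_cancel)
    qed
    also have "\<dots> = (if n dvd m' then of_int n else 0)" using ee_sum[OF n, of "- m'"] by simp
    also have "n dvd m' \<longleftrightarrow> m = 0"
    proof
      assume d: "n dvd m'"
      show "m = 0"
      proof (rule ccontr)
        assume "m \<noteq> 0"
        then have "n \<le> \<bar>m'\<bar>" using d m' dvd_imp_le_int[of m' n] n by auto
        then show False using m m' n by (auto simp: Kp_def)
      qed
    qed (simp add: m')
    finally show ?thesis unfolding \<kappa>_def using n N0 by (auto simp: fcoeff_ind N_def)
  qed
  have zero: "0 \<in> Kp n True" using n by (simp add: Kp_def)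
  have ev: "(\<Sum>m\<in>Kp n True. F (\<kappa> m)) = F (1/2)" if "F 0 = 0" for F :: "complex \<Rightarrow> 'b::comm_monoid_add"
  proof -
    have "(\<Sum>m\<in>Kp n True. F (\<kappa> m)) = (\<Sum>m\<in>Kp n True. if m = 0 then F (1/2) else 0)"
      using even0 that by (intro sum.cong refl) auto
    then show ?thesis using zero Kp_partition(3) by simp
  qed
  have E1: "(\<Sum>m\<in>Kp n True. (norm (\<kappa> m))^2) = 1/4" using ev[of "\<lambda>z. (norm z)^2"] by (simp add: power2_eq_square)
  have E2: "(\<Sum>m\<in>Kp n True. (\<kappa> m)^2) = 1/4" using ev[of "\<lambda>z. z^2"] by (simp add: power2_eq_square)
  have E3: "(\<Sum>m\<in>Kp n True. (norm (\<kappa> m))^4) = 1/16" using ev[of "\<lambda>z. (norm z)^4"] by (simp add: power4_eq_xxxx)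
  have T1: "(\<Sum>m\<in>?K. (norm (\<kappa> m))^2) = 1/2"
  proof -
    have "(\<Sum>m\<in>?K. (norm (\<kappa> m))^2) = (\<Sum>j\<in>{0..<N}. (norm (f j))^2) / of_int N"
      unfolding KN \<kappa> using N0 per by (rule parseval)
    also have "(\<Sum>j\<in>{0..<N}. (norm (f j))^2) = (\<Sum>j\<in>{0..<N}. ind N R n j)"
      by (intro sum.cong) (auto simp: f_def ind_def)
    also have "\<dots> = of_int n" using n N0 by (intro sum_ind_real) (auto simp: N_def)
    finally show ?thesis using n by (simp add: N_def)
  qed
  have T2: "(\<Sum>m\<in>?K. (\<kappa> m)^2) = of_real (cnt / of_int N)"
  proof -
    have refl: "(\<Sum>j\<in>{0..<N}. f (- j) * ee N (j * m)) = of_int N * \<kappa> m" for m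
    proof -
      let ?h = "\<lambda>j. f j * ee N (- (j * m))"
      have "(\<Sum>j\<in>{0..<N}. ?h ((-1) * j)) = (\<Sum>j\<in>{0..<N}. ?h j)"
        using N0 by (intro sum_period_dilate[of ?h]) (auto simp: per algebra_simps intro!: ee_cong)
      then show ?thesis using N0 by (simp add: \<kappa> fcoeff_def)
    qed
    have "of_int N * (\<Sum>m\<in>?K. (\<kappa> m)^2) = (\<Sum>m\<in>?K. \<kappa> m * (\<Sum>j\<in>{0..<N}. f (- j) * ee N (j * m)))"
      unfolding refl by (simp add: sum_distrib_left power2_eq_square mult_ac)
    also have "\<dots> = (\<Sum>j\<in>{0..<N}. f j * f (- j))"
      unfolding KN \<kappa> using N0 per by (rule parseval_bilinear)
    also have "\<dots> = of_real cnt" by (simp add: f_def cnt_def)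
    finally show ?thesis using N0 by (simp add: field_simps)
  qed
  have T3: "(\<Sum>m\<in>?K. (norm (\<kappa> m))^4) = 1/12 + 1 / (24 * (of_int n)^2)"
  proof -
    define ac where "ac j = (\<Sum>i\<in>{0..<N}. f i * f (i + j))" for j
    have acper: "ac (j + N) = ac j" for j
      unfolding ac_def by (intro sum.cong refl) (simp add: per add.assoc[symmetric])
    have fc: "fcoeff N ac m = of_real (of_int N * (norm (\<kappa> m))^2)" for m
    proof -
      have "(\<Sum>j\<in>{0..<N}. ac j * ee N (- (j * m)))
         = (\<Sum>i\<in>{0..<N}. f i * ee N (i * m) * (\<Sum>j\<in>{0..<N}. f (j + i) * ee N (- ((j + i) * m))))"
        unfolding ac_def sum_distrib_right sum_distrib_left
        by (subst sum.swap, intro sum.cong refl) (simp add: ring_distribs ee_add mult_ac, simp add: ee_add[symmetric] mult.assoc[symmetric] add.commute)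
      also have "\<dots> = (\<Sum>i\<in>{0..<N}. f i * ee N (i * m) * (\<Sum>j\<in>{0..<N}. f j * ee N (- (j * m))))"
      proof -
        have "(\<Sum>j\<in>{0..<N}. f (j + i) * ee N (- ((j + i) * m))) = (\<Sum>j\<in>{0..<N}. f j * ee N (- (j * m)))" for i
          using N0 by (intro sum_period_translate[of "\<lambda>j. f j * ee N (- (j * m))"]) (auto simp: per algebra_simps intro!: ee_cong)
        then show ?thesis by (simp only:)
      qed
      also have "\<dots> = (\<Sum>i\<in>{0..<N}. f i * ee N (i * m)) * (of_int N * \<kappa> m)"
        using N0 by (simp add: sum_distrib_right \<kappa> fcoeff_def)
      also have "(\<Sum>i\<in>{0..<N}. f i * ee N (i * m)) = cnj (of_int N * \<kappa> m)"
        using N0 by (simp add: \<kappa> fcoeff_def cnj_ee cnjf)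
      finally have "fcoeff N ac m = of_int N * (\<kappa> m * cnj (\<kappa> m))"
        using N0 by (simp add: fcoeff_def)
      then show ?thesis by (simp only: complex_norm_square of_real_mult of_real_of_int_eq)
    qed
    have "(\<Sum>m\<in>?K. (norm (fcoeff N ac m))^2) = (\<Sum>j\<in>{0..<N}. (norm (ac j))^2) / of_int N"
      unfolding KN using N0 acper by (rule parseval)
    also have "(\<Sum>j\<in>{0..<N}. (norm (ac j))^2) = (\<Sum>j\<in>?K. (norm (ac j))^2)"
      unfolding KN using N0 acper by (intro sum_period_range[symmetric]) auto
    also have "\<dots> = (\<Sum>j\<in>?K. (real_of_int (n - \<bar>j\<bar>))^2)"
    proof (intro sum.cong refl)
      fix j assume j: "j \<in> ?K"
      have "ac j = of_real (of_int (n - \<bar>j\<bar>))"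
        unfolding interval_autocorrelation[OF n j, of R, symmetric] by (simp add: ac_def f_def N_def)
      then show "(norm (ac j))^2 = (real_of_int (n - \<bar>j\<bar>))^2" by (simp only: norm_of_real power2_abs)
    qed
    also have "\<dots> = of_int n * (2 * (of_int n)^2 + 1) / 3" by (rule sum_triangle_squares[OF n])
    finally have "(\<Sum>m\<in>?K. (norm (fcoeff N ac m))^2) = of_int n * (2 * (of_int n)^2 + 1) / 3 / of_int N" .
    moreover have "(norm (fcoeff N ac m))^2 = (of_int N)^2 * (norm (\<kappa> m))^4" for m
      unfolding fc norm_of_real power2_abs by (simp add: power_mult_distrib flip: power_mult)
    ultimately have "(of_int N)^2 * (\<Sum>m\<in>?K. (norm (\<kappa> m))^4) = of_int n * (2 * (of_int n)^2 + 1) / 3 / of_int N"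
      by (simp add: sum_distrib_left)
    then have "of_int n * (24 * (of_int n)^2 * (\<Sum>m\<in>?K. (norm (\<kappa> m))^4)) = of_int n * (2 * (real_of_int n)^2 + 1)"
      using n by (simp add: N_def field_simps power2_eq_square)
    then have "24 * (of_int n)^2 * (\<Sum>m\<in>?K. (norm (\<kappa> m))^4) = 2 * (real_of_int n)^2 + 1"
      using n by (subst (asm) mult_left_cancel) auto
    then show ?thesis using n by (simp add: field_simps)
  qed
  have O1: "(\<Sum>m\<in>Kp n False. (norm (\<kappa> m))^2) = 1/4" using T1 E1 by (simp add: sum_Kp)
  have O2: "(\<Sum>m\<in>Kp n False. (\<kappa> m)^2) = of_real (cnt / of_int N - 1/4)" using T2 E2 by (simp add: sum_Kp algebra_simps)
  have O3: "(\<Sum>m\<in>Kp n False. (norm (\<kappa> m))^4) = 1/48 + 1 / (24 * (of_int n)^2)" using T3 E3 by (simp add: sum_Kp)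
  \<comment> \<open>After multiplication by 8 the even part gives 1/2 and the odd part 2/3 plus the
    square, which together make 7/6.\<close>
  have "mainpart (Kp n True) \<kappa> = 1/16" unfolding mainpart_def E1 E2 E3 by (simp add: power2_eq_square)
  moreover have "mainpart (Kp n False) \<kappa> = 1/12 + (cnt / of_int N - 1/4)^2 - 1 / (12 * (of_int n)^2)"
    unfolding mainpart_def O1 O2 O3 norm_of_real power2_abs by (simp add: power2_eq_square)
  moreover have "8 * (cnt / of_int N - 1/4)^2 = 2 * (cnt / of_int n - 1/2)^2"
    using n by (simp add: N_def field_simps power2_eq_square)
  ultimately show ?thesis unfolding mainfun_def by simp
qed

text \<open>Modulo \<open>2 * n\<close> the reflected interval runs from \<open>n - R + 1\<close> to
  \<open>2 * n - R\<close>. The overlap is centred at \<open>n\<close> and has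
  \<open>2 * R - 1\<close> or \<open>2 * (n - R) + 1\<close> points; for \<open>R = 0\<close> it is
  the single point 0.\<close>

lemma interval_reflection_count:
  fixes n R :: int
  assumes n: "n > 0" and R: "0 \<le> R" "R < n"
  shows "\<bar>(\<Sum>j\<in>{0..<2 * n}. ind (2 * n) R n j * ind (2 * n) R n (- j)) - 2 * of_int (min R (n - R))\<bar> \<le> 1"
proof -
  have per: "ind (2 * n) R n (- (j + 2 * n)) = ind (2 * n) R n (- j)" for j
    using ind_period[of "2 * n" R n "- (j + 2 * n)"] by simp
  have "complex_of_real (\<Sum>j\<in>{0..<2 * n}. ind (2 * n) R n j * ind (2 * n) R n (- j))
     = (\<Sum>j\<in>{0..<2 * n}. of_real (ind (2 * n) R n j) * of_real (ind (2 * n) R n (- j)))" by simp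
  also have "\<dots> = (\<Sum>j\<in>{R..<R+n}. of_real (ind (2 * n) R n (- j)))"
    using n per by (intro sum_ind[of "2 * n" n "\<lambda>i. of_real (ind (2 * n) R n (- i))"]) simp_all
  also have "\<dots> = (\<Sum>j\<in>{R..<R+n}. if (n - R < j \<and> j \<le> 2 * n - R) \<or> (R = 0 \<and> j = 0) then 1 else 0)"
  proof (intro sum.cong refl)
    fix j assume j: "j \<in> {R..<R+n}"
    define y where "y = 2 * n - j - R"
    have y: "-n < y" "y \<le> 2 * n" using j R by (auto simp: y_def)
    have "y mod (2 * n) < n \<longleftrightarrow> (0 \<le> y \<and> y < n) \<or> y = 2 * n"
    proof (cases "y \<ge> 0")
      case False
      then have "y mod (2 * n) = y + 2 * n" using y mod_add_self2[of y "2 * n"] mod_pos_pos_trivial[of "y + 2 * n" "2 * n"] by auto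
      then show ?thesis using y False by auto
    next
      case True
      then show ?thesis using y n by (cases "y = 2 * n") auto
    qed
    moreover have "(- j - R) mod (2 * n) = y mod (2 * n)"
      using mod_add_self2[of "- j - R" "2 * n"] by (simp add: y_def algebra_simps)
    ultimately show "complex_of_real (ind (2 * n) R n (- j)) = (if (n - R < j \<and> j \<le> 2 * n - R) \<or> (R = 0 \<and> j = 0) then 1 else 0)"
      using j R by (auto simp: ind_def y_def)
  qed
  also have "\<dots> = (\<Sum>j\<in>{j \<in> {R..<R+n}. (n - R < j \<and> j \<le> 2 * n - R) \<or> (R = 0 \<and> j = 0)}. 1)"
    by (rule sum.inter_filter[symmetric]) simp
  also have "\<dots> = of_real (real (card {j \<in> {R..<R+n}. (n - R < j \<and> j \<le> 2 * n - R) \<or> (R = 0 \<and> j = 0)}))" by simp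
  finally have eq: "(\<Sum>j\<in>{0..<2 * n}. ind (2 * n) R n j * ind (2 * n) R n (- j))
     = real (card {j \<in> {R..<R+n}. (n - R < j \<and> j \<le> 2 * n - R) \<or> (R = 0 \<and> j = 0)})" (is "_ = real (card ?S)")
    using of_real_eq_iff by blast
  consider "R = 0" | "R > 0" "2 * R \<le> n" | "2 * R > n" using R by linarith
  then show ?thesis
  proof cases
    case 1
    then have "?S = {0}" using n by auto
    then show ?thesis unfolding eq using 1 n by simp
  next
    case 2
    then have "?S = {n - R + 1..<R + n}" by auto
    then show ?thesis unfolding eq using 2 by (simp add: min_def)
  next
    case 3
    then have "?S = {R..2 * n - R}" using R n by auto
    then show ?thesis unfolding eq using 3 R by (simp add: min_def)
  qed
qed

subsection \<open>The fourth moment of an interval\<close>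

text \<open>If \<open>b\<close> is small relative to \<open>a\<close>, the relative change is at
  most \<open>(1 + \<eta>)^4 - 1\<close>, where 15 = 4 + 6 + 4 + 1. Otherwise both norms are at most
  \<open>2 * norm b / \<eta>\<close>, whence 16.\<close>

lemma norm_power4_perturb:
  fixes a b :: complex
  assumes \<eta>: "0 < \<eta>" "\<eta> \<le> 1"
  shows "\<bar>(norm (a + b))^4 - (norm a)^4\<bar> \<le> 15 * \<eta> * (norm a)^4 + 16 / \<eta>^4 * (norm b)^4"
proof -
  define X y Z where "X = norm a" and "y = norm b" and "Z = norm (a + b)"
  have XyZ: "0 \<le> X" "0 \<le> y" "0 \<le> Z" "Z \<le> X + y" "X \<le> Z + y"
    using norm_triangle_ineq[of a b] norm_triangle_ineq4[of "a + b" b] by (auto simp: X_def y_def Z_def)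
  show ?thesis unfolding X_def[symmetric] y_def[symmetric] Z_def[symmetric]
  proof (cases "y \<le> \<eta> * X")
    case True
    have y2: "y \<le> X" using True \<eta> XyZ by (meson mult_left_le_one_le less_imp_le order_trans)
    have up: "Z^4 - X^4 \<le> 15 * \<eta> * X^4"
    proof -
      have "Z^4 \<le> (X + \<eta> * X)^4" using XyZ True by (intro power_mono) auto
      also have "\<dots> = (1 + \<eta>)^4 * X^4" by (simp add: power_mult_distrib[symmetric] algebra_simps)
      also have "(1 + \<eta>)^4 \<le> 1 + 15 * \<eta>"
      proof -
        have "\<eta>^2 \<le> \<eta>" "\<eta>^3 \<le> \<eta>" "\<eta>^4 \<le> \<eta>" using \<eta> by (auto simp: power_le_one_iff intro: power_decreasing[of 1 _ \<eta>, simplified])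
        moreover have "(1 + \<eta>)^4 = 1 + 4 * \<eta> + 6 * \<eta>^2 + 4 * \<eta>^3 + \<eta>^4"
          by (simp add: power4_eq_xxxx power2_eq_square power3_eq_cube algebra_simps)
        ultimately show ?thesis by linarith
      qed
      finally show ?thesis using XyZ by (simp add: algebra_simps mult_right_mono)
    qed
    have dn: "X^4 - Z^4 \<le> 15 * \<eta> * X^4"
    proof -
      have "(1 - \<eta>) * X \<le> Z" using XyZ True by (simp add: algebra_simps)
      then have "((1 - \<eta>) * X)^4 \<le> Z^4" using \<eta> XyZ by (intro power_mono) auto
      then have "(1 - \<eta>)^4 * X^4 \<le> Z^4" by (simp only: power_mult_distrib)
      moreover have "1 - 4 * \<eta> \<le> (1 - \<eta>)^4" using Bernoulli_inequality[of "-\<eta>" 4] \<eta> by simp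
      then have "(1 - 4 * \<eta>) * X^4 \<le> (1 - \<eta>)^4 * X^4" by (intro mult_right_mono) auto
      ultimately have "(1 - 4 * \<eta>) * X^4 \<le> Z^4" by (rule order_trans[rotated])
      then have "X^4 - 4 * (\<eta> * X^4) \<le> Z^4" by (simp add: left_diff_distrib)
      moreover have "0 \<le> \<eta> * X^4" using \<eta> by simp
      moreover have "15 * \<eta> * X^4 = 15 * (\<eta> * X^4)" by simp
      ultimately show ?thesis by linarith
    qed
    have "0 \<le> 16 / \<eta>^4 * y^4" using \<eta> by simp
    then show "\<bar>Z^4 - X^4\<bar> \<le> 15 * \<eta> * X^4 + 16 / \<eta>^4 * y^4" using up dn by linarith
  next
    case False
    have X: "X \<le> y / \<eta>" using False \<eta> by (simp add: field_simps)
    have "\<eta> * y \<le> y" using XyZ \<eta> by (intro mult_left_le_one_le) auto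
    then have "y \<le> y / \<eta>" using \<eta> by (simp add: field_simps)
    then have "Z \<le> 2 * (y / \<eta>)" "X \<le> 2 * (y / \<eta>)" using X XyZ by auto
    then have "Z^4 \<le> (2 * (y / \<eta>))^4" "X^4 \<le> (2 * (y / \<eta>))^4" using XyZ by (auto intro!: power_mono)
    moreover have "(2 * (y / \<eta>))^4 = 16 / \<eta>^4 * y^4" by (simp add: power_mult_distrib power_divide)
    moreover have "0 \<le> X^4" "0 \<le> Z^4" "0 \<le> 15 * \<eta> * X^4" using \<eta> by auto
    ultimately show "\<bar>Z^4 - X^4\<bar> \<le> 15 * \<eta> * X^4 + 16 / \<eta>^4 * y^4" by linarith
  qed
qed

lemma norm_power4_add_le: "(norm (a + b))^4 \<le> 8 * ((norm a)^4 + (norm b)^4)" for a b :: complex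
proof -
  define u v where "u = norm a" and "v = norm b"
  have "(norm (a + b))^4 \<le> (u + v)^4" unfolding u_def v_def by (intro power_mono norm_triangle_ineq) auto
  also have "\<dots> = ((u + v)^2)^2" by (simp flip: power_mult)
  also have "\<dots> \<le> (2 * (u^2 + v^2))^2"
  proof (rule power_mono)
    have "0 \<le> (u - v)^2" by simp
    then show "(u + v)^2 \<le> 2 * (u^2 + v^2)" by (simp add: power2_sum power2_diff)
  qed simp
  also have "\<dots> \<le> 8 * (u^4 + v^4)"
  proof -
    have "0 \<le> (u^2 - v^2)^2" by simp
    then show ?thesis by (simp add: power2_sum power2_diff power_mult_distrib flip: power_mult)
  qed
  finally show ?thesis by (simp add: u_def v_def)
qed

lemma FF_add: "FF N x (\<lambda>j. \<phi> j + \<psi> j) k = FF N x \<phi> k + FF N x \<psi> k"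
  by (simp add: FF_def sum.distrib ring_distribs)

lemma N4_perturb:
  assumes "N > 0" "0 < \<eta>" "\<eta> \<le> 1"
  shows "\<bar>N4 N x (\<lambda>j. \<phi> j + \<psi> j) - N4 N x \<phi>\<bar> \<le> 15 * \<eta> * N4 N x \<phi> + 16 / \<eta>^4 * N4 N x \<psi>"
proof -
  let ?F = "\<lambda>\<phi> k. (norm (FF N x \<phi> k))^4"
  let ?s = "\<lambda>j. \<phi> j + \<psi> j"
  have "\<bar>(\<Sum>k\<in>{0..<N}. ?F ?s k) - (\<Sum>k\<in>{0..<N}. ?F \<phi> k)\<bar> \<le> (\<Sum>k\<in>{0..<N}. \<bar>?F ?s k - ?F \<phi> k\<bar>)"
    unfolding sum_subtractf[symmetric] by (rule sum_abs)
  also have "\<dots> \<le> (\<Sum>k\<in>{0..<N}. 15 * \<eta> * ?F \<phi> k + 16 / \<eta>^4 * ?F \<psi> k)"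
    unfolding FF_add using assms by (intro sum_mono norm_power4_perturb)
  also have "\<dots> = 15 * \<eta> * (\<Sum>k\<in>{0..<N}. ?F \<phi> k) + 16 / \<eta>^4 * (\<Sum>k\<in>{0..<N}. ?F \<psi> k)"
    by (simp only: sum.distrib sum_distrib_left)
  finally have "\<bar>(\<Sum>k\<in>{0..<N}. ?F ?s k) - (\<Sum>k\<in>{0..<N}. ?F \<phi> k)\<bar> / of_int N
     \<le> (15 * \<eta> * (\<Sum>k\<in>{0..<N}. ?F \<phi> k) + 16 / \<eta>^4 * (\<Sum>k\<in>{0..<N}. ?F \<psi> k)) / of_int N"
    using assms by (intro divide_right_mono) auto
  moreover have "\<bar>(\<Sum>k\<in>{0..<N}. ?F ?s k) - (\<Sum>k\<in>{0..<N}. ?F \<phi> k)\<bar> / of_int N = \<bar>N4 N x ?s - N4 N x \<phi>\<bar>"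
    using assms by (simp add: N4_def diff_divide_distrib[symmetric] abs_divide)
  ultimately show ?thesis by (simp add: N4_def add_divide_distrib)
qed

lemma N4_add_le:
  assumes "N > 0"
  shows "N4 N x (\<lambda>j. \<phi> j + \<psi> j) \<le> 8 * (N4 N x \<phi> + N4 N x \<psi>)"
proof -
  have "(\<Sum>k\<in>{0..<N}. (norm (FF N x (\<lambda>j. \<phi> j + \<psi> j) k))^4) \<le> (\<Sum>k\<in>{0..<N}. 8 * ((norm (FF N x \<phi> k))^4 + (norm (FF N x \<psi> k))^4))"
    unfolding FF_add by (intro sum_mono norm_power4_add_le)
  then have "(\<Sum>k\<in>{0..<N}. (norm (FF N x (\<lambda>j. \<phi> j + \<psi> j) k))^4) / of_int N \<le> (\<Sum>k\<in>{0..<N}. 8 * ((norm (FF N x \<phi> k))^4 + (norm (FF N x \<psi> k))^4)) / of_int N"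
    using assms by (intro divide_right_mono) auto
  then show ?thesis by (simp add: N4_def sum_distrib_left[symmetric] sum.distrib add_divide_distrib)
qed

lemma parseval_real_le:
  fixes f :: "int \<Rightarrow> real"
  assumes n: "n > 0" and per: "\<And>j. f (j + 2 * n) = f j" and f: "\<And>j. 0 \<le> f j" "\<And>j. f j \<le> 1"
    and S: "(\<Sum>j\<in>{0..<2 * n}. f j) \<le> S"
  shows "(\<Sum>m\<in>{-n..<n}. (norm (fcoeff (2 * n) (\<lambda>j. of_real (f j)) m))^2) \<le> S / (2 * of_int n)"
proof -
  have "{-n..<n} = {-n..<-n + 2 * n}" by simp
  then have "(\<Sum>m\<in>{-n..<n}. (norm (fcoeff (2 * n) (\<lambda>j. of_real (f j)) m))^2)
     = (\<Sum>j\<in>{0..<2 * n}. (norm (complex_of_real (f j)))^2) / of_int (2 * n)"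
    using n per by (simp only:) (intro parseval, auto)
  also have "\<dots> \<le> (\<Sum>j\<in>{0..<2 * n}. f j) / of_int (2 * n)"
    using n f by (intro divide_right_mono sum_mono) (auto simp: power2_eq_square mult_left_le)
  also have "\<dots> \<le> S / of_int (2 * n)" using S n by (intro divide_right_mono) auto
  finally show ?thesis by simp
qed

context jacobi_setup
begin

text \<open>The error of \<open>N4_error\<close> relative to \<open>8 * n^2\<close> for ramps of
  length at least \<open>\<delta> * n\<close>: the coefficients have mass at most
  \<open>1 + 2 / \<delta>\<close> and tail at most \<open>6 / \<delta> / q\<close>.\<close>

definition err :: "real \<Rightarrow> real" where
  "err \<delta> = Egen * (1 + 2 / \<delta>)^4 + 4 * (Kexp + 1) * (1 + 2 / \<delta>)^3 * (6 / \<delta> / of_int q)"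

text \<open>The indicator is a trapezoid plus two truncated tents. Truncation costs 36 and adding
  two functions costs 8, so the tents enter with 16 * 8 * (2 * 36) * 8 = 73728. The last summand
  pays for replacing the trapezoid by the indicator in the main term.\<close>

lemma interval_moment:
  fixes R w :: int and \<delta> \<eta> :: real
  assumes w: "w > 0" "2 * w \<le> n" and \<delta>: "\<delta> > 0" "\<delta> * of_int n \<le> of_int w" "of_int w \<le> 2 * \<delta> * of_int n"
    and \<eta>: "0 < \<eta>" "\<eta> \<le> 1"
  defines "I \<equiv> \<lambda>j. complex_of_real (ind N R n j)"
  shows "\<bar>M4 I / (of_int n)^2 - 8 * mainfun n (fcoeff N I)\<bar>
    \<le> 120 * \<eta> * (3 + err \<delta>) + 73728 / \<eta>^4 * (3 * \<delta>^2 + err \<delta>) + 8 * err \<delta> + 80 * (\<delta> / \<eta> + 2 * \<eta>)"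
proof -
  define \<phi> where "\<phi> j = complex_of_real (trap N R (n - w + 1) w j)" for j
  define t1 where "t1 j = complex_of_real (trap N (R - w) w w j)" for j
  define t2 where "t2 j = complex_of_real (trap N (R + n - w + 1) w w j)" for j
  define \<psi> where "\<psi> j = I j * t1 j + I j * t2 j" for j
  have n0: "real_of_int n > 0" using n_pos by simp
  have C: "of_int n / (2 * of_int w) \<le> 1 / (2 * \<delta>)"
    using \<delta> w n0 by (simp add: field_simps)
  have est: "\<bar>M4 (\<lambda>j. of_real (trap N a L w j)) - 8 * of_int n^2 * mainfun n (fcoeff N (\<lambda>j. of_real (trap N a L w j)))\<bar>
     \<le> 8 * of_int n^2 * err \<delta>" if L: "0 \<le> L" "L \<le> N" for a L
  proof -
    have "(\<Sum>m\<in>{-n..<n}. norm (fcoeff N (\<lambda>j. of_real (trap N a L w j)) m)) \<le> 1 + 4 * (1 / (2 * \<delta>))"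
      unfolding N_def using n_pos q q_le_n w C L by (intro trap_coeff_sums(1)[where q=q]) (auto simp: N_def)
    moreover have "(\<Sum>m\<in>{-n..<n}. norm (fcoeff N (\<lambda>j. of_real (trap N a L w j)) m) * (if 2 * \<bar>m\<bar> \<ge> q then 1 else 0)) \<le> 12 * (1 / (2 * \<delta>)) / of_int q"
      unfolding N_def using n_pos q q_le_n w C L by (intro trap_coeff_sums(2)) (auto simp: N_def)
    ultimately show ?thesis
      unfolding err_def by (intro N4_error) (auto simp: trap_period)
  qed
  have sq: "(\<Sum>m\<in>{-n..<n}. (norm (fcoeff N (\<lambda>j. of_real (trap N a L w j)) m))^2) \<le> of_int L / (2 * of_int n)"
    if L: "0 \<le> L" "L \<le> N" for a L
    unfolding N_def using n_pos w L sum_trap[of N L w a] trap_bounds[OF w(1)] N_pos trap_period[of "2 * n"]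
    by (intro parseval_real_le) (auto simp: N_def)
  have M\<phi>: "M4 \<phi> \<le> 8 * of_int n^2 * (3 + err \<delta>)"
  proof -
    let ?\<kappa> = "fcoeff N \<phi>"
    have "(\<Sum>m\<in>{-n..<n}. (norm (?\<kappa> m))^2) \<le> of_int (n - w + 1) / (2 * of_int n)"
      unfolding \<phi>_def using w n_pos by (intro sq) (auto simp: N_def)
    also have "\<dots> \<le> 1" using w n0 by (simp add: field_simps)
    finally have "(\<Sum>m\<in>{-n..<n}. (norm (?\<kappa> m))^2)^2 \<le> 1" by (intro power_le_one sum_nonneg) auto
    then have "mainfun n ?\<kappa> \<le> 3" using mainfun_le[of n ?\<kappa>] by linarith
    then have "8 * of_int n^2 * mainfun n ?\<kappa> \<le> 8 * of_int n^2 * 3" by (intro mult_left_mono) auto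
    moreover have "\<bar>M4 \<phi> - 8 * of_int n^2 * mainfun n ?\<kappa>\<bar> \<le> 8 * of_int n^2 * err \<delta>"
      unfolding \<phi>_def using w n_pos by (intro est) (auto simp: N_def)
    ultimately show ?thesis by (simp add: algebra_simps abs_le_iff)
  qed
  have Mtent: "M4 (\<lambda>j. of_real (trap N a w w j)) \<le> 8 * of_int n^2 * (3 * \<delta>^2 + err \<delta>)" for a
  proof -
    let ?\<kappa> = "fcoeff N (\<lambda>j. of_real (trap N a w w j))"
    have "(\<Sum>m\<in>{-n..<n}. (norm (?\<kappa> m))^2) \<le> of_int w / (2 * of_int n)"
      using w n_pos by (intro sq) (auto simp: N_def)
    also have "\<dots> \<le> \<delta>" using \<delta> n0 by (simp add: field_simps)
    finally have "(\<Sum>m\<in>{-n..<n}. (norm (?\<kappa> m))^2)^2 \<le> \<delta>^2" by (intro power_mono sum_nonneg) auto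
    then have "mainfun n ?\<kappa> \<le> 3 * \<delta>^2" using mainfun_le[of n ?\<kappa>] by linarith
    then have "8 * of_int n^2 * mainfun n ?\<kappa> \<le> 8 * of_int n^2 * (3 * \<delta>^2)" by (intro mult_left_mono) auto
    moreover have "\<bar>M4 (\<lambda>j. of_real (trap N a w w j)) - 8 * of_int n^2 * mainfun n ?\<kappa>\<bar> \<le> 8 * of_int n^2 * err \<delta>"
      using w n_pos by (intro est) (auto simp: N_def)
    ultimately show ?thesis by (simp add: algebra_simps abs_le_iff)
  qed
  have Iper: "I (j + N) = I j" for j by (simp add: I_def ind_period)
  have c1: "M4 (\<lambda>j. I j * t1 j) \<le> 36 * M4 t1"
  proof (rule N4_truncate[where s=R and w=w])
    fix j assume "j \<in> {R + w..<R - w + N}"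
    then show "t1 j = 0" unfolding t1_def using w by (subst tent_support) (auto simp: N_def)
  next
    have "I j = 0" if "j \<in> {R - w..<R}" for j
    proof -
      have "(j - R) mod N = j - R + N"
        using that w n_pos mod_add_self2[of "j - R" N] mod_pos_pos_trivial[of "j - R + N" N] by (auto simp: N_def)
      then show ?thesis using that w by (auto simp: I_def ind_def N_def)
    qed
    moreover have "I j = 1" if "j \<in> {R..<R + w}" for j
      using that w n_pos by (auto simp: I_def ind_def N_def)
    ultimately show "(\<forall>j\<in>{R - w..<R}. I j = 0) \<and> (\<forall>j\<in>{R..<R + w}. I j = 1)
      \<or> (\<forall>j\<in>{R - w..<R}. I j = 1) \<and> (\<forall>j\<in>{R..<R + w}. I j = 0)" by blast
  qed (use w N_pos Iper x_period in \<open>auto simp: t1_def trap_period N_def\<close>)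
  have c2: "M4 (\<lambda>j. I j * t2 j) \<le> 36 * M4 t2"
  proof (rule N4_truncate[where s="R + n" and w=w])
    fix j assume j: "j \<in> {R + n + w..<R + n - w + N}"
    \<comment> \<open>This tent starts one place to the right of the window used for the cut, so the
      point \<open>R + n + w\<close> is not covered by \<open>tent_support\<close> and is checked by
      hand.\<close>
    have "trap N (R + n - w + 1) w w j = 0"
    proof (cases "j = R + n + w")
      case True
      have "ind N (R + n - w + 1) w (j - i) = 0" if "i \<in> {0..<w}" for i
        using that w n_pos True by (auto simp: ind_def N_def)
      then show ?thesis by (simp add: trap_def)
    next
      case False
      then show ?thesis using j w by (intro tent_support) (auto simp: N_def)
    qed
    then show "t2 j = 0" by (simp add: t2_def)
  next
    have "I j = 0" if "j \<in> {R + n..<R + n + w}" for j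
      using that w n_pos by (auto simp: I_def ind_def N_def)
    moreover have "I j = 1" if "j \<in> {R + n - w..<R + n}" for j
      using that w n_pos by (auto simp: I_def ind_def N_def)
    ultimately show "(\<forall>j\<in>{R + n - w..<R + n}. I j = 0) \<and> (\<forall>j\<in>{R + n..<R + n + w}. I j = 1)
      \<or> (\<forall>j\<in>{R + n - w..<R + n}. I j = 1) \<and> (\<forall>j\<in>{R + n..<R + n + w}. I j = 0)" by blast
  qed (use w N_pos Iper x_period in \<open>auto simp: t2_def trap_period N_def\<close>)
  have M\<psi>: "M4 \<psi> \<le> 4608 * of_int n^2 * (3 * \<delta>^2 + err \<delta>)"
  proof -
    define T where "T = 8 * of_int n^2 * (3 * \<delta>^2 + err \<delta>)"
    have "M4 \<psi> \<le> 8 * (M4 (\<lambda>j. I j * t1 j) + M4 (\<lambda>j. I j * t2 j))"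
      unfolding \<psi>_def by (rule N4_add_le[OF N_pos])
    moreover have "M4 t1 \<le> T" "M4 t2 \<le> T" unfolding T_def t1_def t2_def by (rule Mtent)+
    ultimately have "M4 \<psi> \<le> 576 * T" using c1 c2 unfolding distrib_left by linarith
    then show ?thesis by (simp add: T_def)
  qed
  have dec_real: "ind N R n j - trap N R (n - w + 1) w j = ind N R n j * (trap N (R - w) w w j + trap N (R + n - w + 1) w w j)" for j
    unfolding N_def using w by (rule ind_minus_trap)
  have dec: "I j = \<phi> j + \<psi> j" for j
  proof -
    have "complex_of_real (ind N R n j - trap N R (n - w + 1) w j) = of_real (ind N R n j * (trap N (R - w) w w j + trap N (R + n - w + 1) w w j))"
      by (simp only: dec_real)
    then show ?thesis by (simp add: I_def \<phi>_def \<psi>_def t1_def t2_def algebra_simps)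
  qed
  have pert: "\<bar>M4 I - M4 \<phi>\<bar> \<le> 15 * \<eta> * M4 \<phi> + 16 / \<eta>^4 * M4 \<psi>"
    using N4_perturb[OF N_pos \<eta>, of x \<phi> \<psi>] by (simp add: dec[symmetric])
  have mdiff: "\<bar>mainfun n (fcoeff N \<phi>) - mainfun n (fcoeff N I)\<bar> \<le> 10 * (2 * \<delta> / (2 * \<eta>) + 2 * \<eta>)"
  proof (rule mainfun_diff)
    show "(\<Sum>m\<in>{-n..<n}. (norm (fcoeff N \<phi> m))^2) \<le> 1"
    proof -
      have "(\<Sum>m\<in>{-n..<n}. (norm (fcoeff N \<phi> m))^2) \<le> of_int (n - w + 1) / (2 * of_int n)"
        unfolding \<phi>_def using w n_pos by (intro sq) (auto simp: N_def)
      also have "\<dots> \<le> 1" using w n0 by (simp add: field_simps)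
      finally show ?thesis .
    qed
    show "(\<Sum>m\<in>{-n..<n}. (norm (fcoeff N I m))^2) \<le> 1"
    proof -
      have "(\<Sum>m\<in>{-n..<n}. (norm (fcoeff N I m))^2) \<le> of_int n / (2 * of_int n)"
        unfolding I_def N_def using n_pos sum_ind_real[of "2 * n" n R]
        by (intro parseval_real_le) (auto simp: ind_period, auto simp: ind_def)
      then show ?thesis using n0 by simp
    qed
    have "fcoeff N \<phi> m - fcoeff N I m = - fcoeff N (\<lambda>j. of_real (ind N R n j - trap N R (n - w + 1) w j)) m" for m
      by (simp add: \<phi>_def[abs_def] I_def fcoeff_diff)
    then have "(\<Sum>m\<in>{-n..<n}. (norm (fcoeff N \<phi> m - fcoeff N I m))^2)
      = (\<Sum>m\<in>{-n..<n}. (norm (fcoeff N (\<lambda>j. of_real (ind N R n j - trap N R (n - w + 1) w j)) m))^2)"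
      by simp
    \<comment> \<open>The difference has values between 0 and 1, so its square sum is at most its
      sum, which the masses \<open>w\<close> of the two tents bound.\<close>
    also have "\<dots> \<le> (of_int w + of_int w) / (2 * of_int n)"
      unfolding N_def
    proof (rule parseval_real_le)
      let ?f = "\<lambda>j. ind (2 * n) R n j - trap (2 * n) R (n - w + 1) w j"
      fix j
      show "?f (j + 2 * n) = ?f j" by (simp add: ind_period trap_period)
      show "0 \<le> ?f j"
        using dec_real[of j] trap_bounds(1)[OF w(1)] by (simp add: N_def ind_def)
      show "?f j \<le> 1" using trap_bounds(1)[OF w(1), of "2 * n" R "n - w + 1" j] by (auto simp: ind_def)
    next
      have "(\<Sum>j\<in>{0..<2 * n}. ind (2 * n) R n j - trap (2 * n) R (n - w + 1) w j)
         \<le> (\<Sum>j\<in>{0..<2 * n}. trap (2 * n) (R - w) w w j + trap (2 * n) (R + n - w + 1) w w j)"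
        using dec_real trap_bounds(1)[OF w(1)] unfolding N_def by (intro sum_mono) (simp add: ind_def)
      also have "\<dots> = of_int w + of_int w" using w n_pos by (simp add: sum.distrib sum_trap)
      finally show "(\<Sum>j\<in>{0..<2 * n}. ind (2 * n) R n j - trap (2 * n) R (n - w + 1) w j) \<le> of_int w + of_int w" .
    qed (use n_pos in simp)
    also have "\<dots> \<le> 2 * \<delta>" using \<delta> n0 by (simp add: field_simps)
    finally show "(\<Sum>m\<in>{-n..<n}. (norm (fcoeff N \<phi> m - fcoeff N I m))^2) \<le> 2 * \<delta>" .
  qed (use \<eta> in auto)
  have est\<phi>: "\<bar>M4 \<phi> - 8 * of_int n^2 * mainfun n (fcoeff N \<phi>)\<bar> \<le> 8 * of_int n^2 * err \<delta>"
    unfolding \<phi>_def using w n_pos by (intro est) (auto simp: N_def)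
  define s where "s = (real_of_int n)^2"
  have s0: "s > 0" using n0 by (simp add: s_def)
  have 1: "15 * \<eta> * M4 \<phi> \<le> 15 * \<eta> * (8 * s * (3 + err \<delta>))" using M\<phi> \<eta> by (intro mult_left_mono) (auto simp: s_def)
  have 2: "16 / \<eta>^4 * M4 \<psi> \<le> 16 / \<eta>^4 * (4608 * s * (3 * \<delta>^2 + err \<delta>))" using M\<psi> \<eta> by (intro mult_left_mono) (auto simp: s_def)
  have 3: "\<bar>8 * s * mainfun n (fcoeff N \<phi>) - 8 * s * mainfun n (fcoeff N I)\<bar> \<le> 8 * s * (10 * (2 * \<delta> / (2 * \<eta>) + 2 * \<eta>))"
  proof -
    have "\<bar>8 * s * mainfun n (fcoeff N \<phi>) - 8 * s * mainfun n (fcoeff N I)\<bar> = 8 * s * \<bar>mainfun n (fcoeff N \<phi>) - mainfun n (fcoeff N I)\<bar>"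
      using s0 by (simp add: right_diff_distrib[symmetric] abs_mult)
    then show ?thesis using mdiff s0 by (simp add: mult_left_mono)
  qed
  have tri: "\<bar>a - d\<bar> \<le> X + Y + Z + W" if "\<bar>a - b\<bar> \<le> p1 + p2" "p1 \<le> X" "p2 \<le> Y" "\<bar>b - c\<bar> \<le> Z" "\<bar>c - d\<bar> \<le> W"
    for a b c d X Y Z W p1 p2 :: real using that by linarith
  have "\<bar>M4 I - 8 * s * mainfun n (fcoeff N I)\<bar> \<le> 15 * \<eta> * (8 * s * (3 + err \<delta>)) + 16 / \<eta>^4 * (4608 * s * (3 * \<delta>^2 + err \<delta>))
      + 8 * s * err \<delta> + 8 * s * (10 * (2 * \<delta> / (2 * \<eta>) + 2 * \<eta>))"
    by (rule tri[OF pert 1 2 _ 3]) (use est\<phi> in \<open>simp add: s_def\<close>)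
  also have "\<dots> = (120 * \<eta> * (3 + err \<delta>) + 73728 / \<eta>^4 * (3 * \<delta>^2 + err \<delta>) + 8 * err \<delta> + 80 * (\<delta> / \<eta> + 2 * \<eta>)) * s"
    using \<eta> by (simp add: field_simps)
  finally have "\<bar>M4 I - 8 * s * mainfun n (fcoeff N I)\<bar> / s \<le> 120 * \<eta> * (3 + err \<delta>) + 73728 / \<eta>^4 * (3 * \<delta>^2 + err \<delta>) + 8 * err \<delta> + 80 * (\<delta> / \<eta> + 2 * \<eta>)"
    using s0 by (simp add: divide_le_eq)
  moreover have "\<bar>M4 I - 8 * s * mainfun n (fcoeff N I)\<bar> / s = \<bar>M4 I / s - 8 * mainfun n (fcoeff N I)\<bar>"
  proof -
    have "M4 I / s - 8 * mainfun n (fcoeff N I) = (M4 I - 8 * s * mainfun n (fcoeff N I)) / s" using s0 by (simp add: field_simps)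
    then show ?thesis using s0 by (simp add: abs_divide)
  qed
  ultimately show ?thesis by (simp add: s_def)
qed

end

subsection \<open>Norms of polynomials as discrete moments\<close>

lemma has_integral_cis:
  "((\<lambda>\<theta>. cis (of_int m * \<theta>)) has_integral (if m = 0 then of_real (2 * pi) else 0)) {0..2 * pi}"
proof (cases "m = 0")
  case True
  then show ?thesis using has_integral_const_real[of "1 :: complex" 0 "2 * pi"] by (simp add: scaleR_conv_of_real)
next
  case False
  let ?F = "\<lambda>x. exp (\<i> * of_int m * of_real x) / (\<i> * of_int m)"
  have "((\<lambda>x. exp (\<i> * of_int m * of_real x)) has_integral (?F (2 * pi) - ?F 0)) {0..2 * pi}"
  proof (rule fundamental_theorem_of_calculus)
    fix x
    show "(?F has_vector_derivative exp (\<i> * of_int m * of_real x)) (at x within {0..2 * pi})"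
      by (rule has_vector_derivative_real_field[of "\<lambda>z. exp (\<i> * of_int m * z) / (\<i> * of_int m)"])
         (use False in \<open>auto intro!: derivative_eq_intros\<close>)
  qed simp
  moreover have "exp (\<i> * of_int m * of_real (2 * pi)) = 1"
  proof -
    have "\<i> * of_int m * of_real (2 * pi) = of_real (2 * of_int m * pi) * \<i>" by simp
    moreover have "exp (of_real (2 * of_int m * pi) * \<i>) = 1" by (subst exp_eq_1) auto
    ultimately show ?thesis by (simp only:)
  qed
  moreover have "cis (of_int m * x) = exp (\<i> * of_int m * of_real x)" for x
    by (simp add: cis_conv_exp mult_ac)
  ultimately show ?thesis using False by simp
qed

lemma has_integral_of_realD:
  assumes "((\<lambda>x. complex_of_real (f x)) has_integral complex_of_real v) S"
  shows "(f has_integral v) S"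
  using has_integral_linear[OF assms bounded_linear_Re] by (simp add: o_def)

text \<open>The frequencies \<open>i1 + i2 - i3 - i4\<close> are smaller than \<open>2 * n\<close>
  in absolute value, so the \<open>2 * n\<close>-th roots of unity detect frequency 0 just as the
  integral does.\<close>

lemma fourth_moment_integral:
  fixes a :: "int \<Rightarrow> complex"
  assumes n: "n > 0"
  shows "((\<lambda>\<theta>. (norm (\<Sum>i\<in>{0..<n}. a i * cis (of_int i * \<theta>)))^4) has_integral
    (2 * pi * ((\<Sum>k\<in>{0..<2 * n}. (norm (\<Sum>i\<in>{0..<n}. a i * ee (2 * n) (i * k)))^4) / of_int (2 * n)))) {0..2 * pi}"
proof (rule has_integral_of_realD)
  let ?I = "{0..<n}" and ?N = "2 * n"
  let ?c = "\<lambda>i1 i2 i3 i4. a i1 * a i2 * cnj (a i3) * cnj (a i4)"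
  have exp4: "complex_of_real ((norm (\<Sum>i\<in>?I. a i * u i))^4)
    = (\<Sum>i1\<in>?I. \<Sum>i2\<in>?I. \<Sum>i3\<in>?I. \<Sum>i4\<in>?I. ?c i1 i2 i3 i4 * (u i1 * u i2 * cnj (u i3) * cnj (u i4)))" for u
    unfolding norm_power4 cnj_sum sum_prod4 by (intro sum.cong refl) (simp add: mult_ac)
  have cis4: "cis (of_int i1 * \<theta>) * cis (of_int i2 * \<theta>) * cnj (cis (of_int i3 * \<theta>)) * cnj (cis (of_int i4 * \<theta>))
    = cis (of_int (i1 + i2 - i3 - i4) * \<theta>)" for i1 i2 i3 i4 \<theta>
    by (simp add: cis_cnj cis_mult algebra_simps)
  have ee4: "ee ?N (i1 * k) * ee ?N (i2 * k) * cnj (ee ?N (i3 * k)) * cnj (ee ?N (i4 * k)) = ee ?N (k * (i1 + i2 - i3 - i4))" for i1 i2 i3 i4 k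
    by (simp add: cnj_ee ee_add[symmetric] algebra_simps)
  let ?E = "\<Sum>i1\<in>?I. \<Sum>i2\<in>?I. \<Sum>i3\<in>?I. \<Sum>i4\<in>?I. ?c i1 i2 i3 i4 * (if i1 + i2 - i3 - i4 = 0 then of_real (2 * pi) else 0)"
  have "((\<lambda>\<theta>. \<Sum>i1\<in>?I. \<Sum>i2\<in>?I. \<Sum>i3\<in>?I. \<Sum>i4\<in>?I. ?c i1 i2 i3 i4 * cis (of_int (i1 + i2 - i3 - i4) * \<theta>)) has_integral ?E) {0..2 * pi}"
    by (intro has_integral_sum has_integral_mult_right has_integral_cis) auto
  then have int: "((\<lambda>\<theta>. complex_of_real ((norm (\<Sum>i\<in>?I. a i * cis (of_int i * \<theta>)))^4)) has_integral ?E) {0..2 * pi}"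
    unfolding exp4 cis4 .
  have "complex_of_real (\<Sum>k\<in>{0..<?N}. (norm (\<Sum>i\<in>?I. a i * ee ?N (i * k)))^4)
     = (\<Sum>k\<in>{0..<?N}. \<Sum>i1\<in>?I. \<Sum>i2\<in>?I. \<Sum>i3\<in>?I. \<Sum>i4\<in>?I. ?c i1 i2 i3 i4 * ee ?N (k * (i1 + i2 - i3 - i4)))"
    unfolding of_real_sum exp4 ee4 ..
  also have "\<dots> = (\<Sum>i1\<in>?I. \<Sum>i2\<in>?I. \<Sum>i3\<in>?I. \<Sum>i4\<in>?I. ?c i1 i2 i3 i4 * (\<Sum>k\<in>{0..<?N}. ee ?N (k * (i1 + i2 - i3 - i4))))"
    unfolding sum_distrib_left
    by (subst sum.swap, rule sum.cong[OF refl], subst sum.swap, rule sum.cong[OF refl], subst sum.swap,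
        rule sum.cong[OF refl], rule sum.swap)
  also have "\<dots> = (\<Sum>i1\<in>?I. \<Sum>i2\<in>?I. \<Sum>i3\<in>?I. \<Sum>i4\<in>?I. ?c i1 i2 i3 i4 * (if i1 + i2 - i3 - i4 = 0 then of_int ?N else 0))"
  proof (intro sum.cong refl)
    fix i1 i2 i3 i4 assume i: "i1 \<in> ?I" "i2 \<in> ?I" "i3 \<in> ?I" "i4 \<in> ?I"
    have "\<bar>i1 + i2 - i3 - i4\<bar> < \<bar>?N\<bar>" using i by auto
    then have "?N dvd i1 + i2 - i3 - i4 \<longleftrightarrow> i1 + i2 - i3 - i4 = 0"
      using dvd_imp_le_int[of "i1 + i2 - i3 - i4" ?N] by (metis dvd_0_right not_less)
    moreover have "(\<Sum>k\<in>{0..<?N}. ee ?N (k * (i1 + i2 - i3 - i4))) = (if ?N dvd i1 + i2 - i3 - i4 then of_int ?N else 0)"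
      using n by (intro ee_sum) simp
    ultimately show "?c i1 i2 i3 i4 * (\<Sum>k\<in>{0..<?N}. ee ?N (k * (i1 + i2 - i3 - i4)))
      = ?c i1 i2 i3 i4 * (if i1 + i2 - i3 - i4 = 0 then of_int ?N else 0)" by simp
  qed
  finally have disc: "complex_of_real (\<Sum>k\<in>{0..<?N}. (norm (\<Sum>i\<in>?I. a i * ee ?N (i * k)))^4)
    = (\<Sum>i1\<in>?I. \<Sum>i2\<in>?I. \<Sum>i3\<in>?I. \<Sum>i4\<in>?I. ?c i1 i2 i3 i4 * (if i1 + i2 - i3 - i4 = 0 then of_int ?N else 0))" .
  have "complex_of_real (2 * pi * ((\<Sum>k\<in>{0..<?N}. (norm (\<Sum>i\<in>?I. a i * ee ?N (i * k)))^4) / of_int ?N))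
    = of_real (2 * pi) / of_int ?N * complex_of_real (\<Sum>k\<in>{0..<?N}. (norm (\<Sum>i\<in>?I. a i * ee ?N (i * k)))^4)"
    by simp
  also have "\<dots> = ?E"
    unfolding disc sum_distrib_left using n by (intro sum.cong refl) simp
  finally show "((\<lambda>\<theta>. complex_of_real ((norm (\<Sum>i\<in>?I. a i * cis (of_int i * \<theta>)))^4)) has_integral
    complex_of_real (2 * pi * ((\<Sum>k\<in>{0..<?N}. (norm (\<Sum>i\<in>?I. a i * ee ?N (i * k)))^4) / of_int ?N))) {0..2 * pi}"
    using int by simp
qed

lemma second_moment_integral:
  fixes a :: "int \<Rightarrow> complex"
  shows "((\<lambda>\<theta>. (norm (\<Sum>i\<in>{0..<n}. a i * cis (of_int i * \<theta>)))^2) has_integral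
    (2 * pi * (\<Sum>i\<in>{0..<n}. (norm (a i))^2))) {0..2 * pi}"
proof (rule has_integral_of_realD)
  let ?I = "{0..<n}"
  have exp2: "complex_of_real ((norm (\<Sum>i\<in>?I. a i * cis (of_int i * \<theta>)))^2)
    = (\<Sum>i1\<in>?I. \<Sum>i2\<in>?I. a i1 * cnj (a i2) * cis (of_int (i1 - i2) * \<theta>))" for \<theta>
  proof -
    have "cis (of_int (i1 - i2) * \<theta>) = cis (of_int i1 * \<theta>) * cnj (cis (of_int i2 * \<theta>))" for i1 i2
      by (simp add: cis_cnj cis_mult algebra_simps)
    then show ?thesis unfolding complex_norm_square cnj_sum sum_product
      by (simp only: complex_cnj_mult mult_ac)
  qed
  have "((\<lambda>\<theta>. \<Sum>i1\<in>?I. \<Sum>i2\<in>?I. a i1 * cnj (a i2) * cis (of_int (i1 - i2) * \<theta>)) has_integral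
    (\<Sum>i1\<in>?I. \<Sum>i2\<in>?I. a i1 * cnj (a i2) * (if i1 - i2 = 0 then of_real (2 * pi) else 0))) {0..2 * pi}"
    by (intro has_integral_sum has_integral_mult_right has_integral_cis) auto
  moreover have "(\<Sum>i1\<in>?I. \<Sum>i2\<in>?I. a i1 * cnj (a i2) * (if i1 - i2 = 0 then of_real (2 * pi) else 0))
    = complex_of_real (2 * pi * (\<Sum>i\<in>?I. (norm (a i))^2))"
  proof -
    have "(\<Sum>i2\<in>?I. a i1 * cnj (a i2) * (if i1 - i2 = 0 then of_real (2 * pi) else 0)) = a i1 * cnj (a i1) * of_real (2 * pi)"
      if "i1 \<in> ?I" for i1
    proof -
      have "(\<Sum>i2\<in>?I. a i1 * cnj (a i2) * (if i1 - i2 = 0 then of_real (2 * pi) else 0))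
        = (\<Sum>i2\<in>?I. if i1 = i2 then a i1 * cnj (a i2) * of_real (2 * pi) else 0)" by (intro sum.cong) auto
      then show ?thesis using that by simp
    qed
    then have "(\<Sum>i1\<in>?I. \<Sum>i2\<in>?I. a i1 * cnj (a i2) * (if i1 - i2 = 0 then of_real (2 * pi) else 0))
      = (\<Sum>i1\<in>?I. a i1 * cnj (a i1) * of_real (2 * pi))" by (intro sum.cong) auto
    then show ?thesis unfolding complex_norm_square[symmetric] by (simp add: sum_distrib_left mult_ac)
  qed
  ultimately show "((\<lambda>\<theta>. complex_of_real ((norm (\<Sum>i\<in>?I. a i * cis (of_int i * \<theta>)))^2)) has_integral
    complex_of_real (2 * pi * (\<Sum>i\<in>?I. (norm (a i))^2))) {0..2 * pi}"
    unfolding exp2 by simp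
qed

lemma merit_factor_eq:
  fixes a :: "int \<Rightarrow> complex"
  assumes n: "n > 0" and A: "\<And>\<theta>. poly A (cis \<theta>) = (\<Sum>i\<in>{0..<n}. a i * cis (of_int i * \<theta>))"
    and a: "\<And>i. norm (a i) = 1"
  defines "V \<equiv> (\<Sum>k\<in>{0..<2 * n}. (norm (\<Sum>i\<in>{0..<n}. a i * ee (2 * n) (i * k)))^4) / of_int (2 * n)"
  shows "merit_factor A = 1 / (V / (of_int n)^2 - 1)"
proof -
  have "(1 / (2 * pi)) * integral {0..2*pi} (\<lambda>\<theta>. norm (poly A (cis \<theta>)) powr 4) = V"
    unfolding A using integral_unique[OF fourth_moment_integral[OF n, of a]] by (simp add: V_def)
  moreover have "V \<ge> 0" unfolding V_def using n by (intro divide_nonneg_pos sum_nonneg) auto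
  ultimately have L4: "Lnorm 4 A ^ 4 = V"
    by (cases "V = 0") (simp_all add: Lnorm_def powr_power)
  have "(1 / (2 * pi)) * integral {0..2*pi} (\<lambda>\<theta>. norm (poly A (cis \<theta>)) powr 2) = of_int n"
    unfolding A using integral_unique[OF second_moment_integral[where a=a and n=n]] n by (simp add: a)
  then have L2: "Lnorm 2 A ^ 4 = (of_int n)^2" using n by (simp add: Lnorm_def powr_power)
  show ?thesis unfolding merit_factor_def L4 L2 using n by (simp add: field_simps)
qed

subsection \<open>The coefficients of the rotated polynomial\<close>

lemma squarefree_multiplicity:
  fixes n :: nat
  assumes "squarefree n" "p \<in> prime_factors n"
  shows "multiplicity p n = 1"
proof -
  have p: "prime p" "p dvd n" "n \<noteq> 0" using assms(2) by (auto simp: in_prime_factors_iff)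
  have "multiplicity p n \<ge> 1"
    using p not_dvd_imp_multiplicity_0 prime_elem_multiplicity_eq_zero_iff[of p n] by (auto simp: Suc_le_eq)
  moreover have "\<not> multiplicity p n \<ge> 2"
  proof
    assume "multiplicity p n \<ge> 2"
    then have "p^2 dvd n" by (meson dvd_trans le_imp_power_dvd multiplicity_dvd)
    then have "p dvd 1" using assms(1) by (auto simp: squarefree_def)
    then show False using p(1) by auto
  qed
  ultimately show ?thesis by linarith
qed

lemma jacobi_squarefree:
  assumes "squarefree m"
  shows "jacobi j m = (\<Prod>p\<in>prime_factors m. Legendre j (int p))"
  unfolding jacobi_def using assms by (intro prod.cong refl) (simp add: squarefree_multiplicity)

lemma xseq_prime_factors: "xseq (int ` prime_factors n) j = (\<Prod>p\<in>prime_factors n. uleg (int p) j)"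
  unfolding xseq_def by (subst prod.reindex) auto

text \<open>Since \<open>n\<close> is squarefree, the primes of \<open>n div gcd j n\<close> are the
  primes of \<open>n\<close> that do not divide \<open>j\<close>. The coefficient of
  \<open>poly_V\<close> is thus the product of the nonzero Legendre symbols, exactly where the
  coefficient of \<open>char_poly_J\<close> vanishes.\<close>

lemma coeff_J_plus_V:
  assumes n: "squarefree n" "n > 1" and j: "j < n"
  shows "Polynomial.coeff (char_poly_J n) j + Polynomial.coeff (poly_V n) j = of_int (xseq (int ` prime_factors n) (int j))"
proof -
  have cJ: "Polynomial.coeff (char_poly_J n) j = (if 1 \<le> j then of_int (jacobi (int j) n) else 0)"
    unfolding char_poly_J_def Polynomial.coeff_sum Polynomial.coeff_monom using j by (subst sum.delta) auto
  have fin: "finite {j. j \<le> n - 1 \<and> gcd j n > 1}" by (rule finite_subset[of _ "{..n}"]) auto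
  have cV: "Polynomial.coeff (poly_V n) j = (if gcd j n > 1 then of_int (jacobi (int j) (n div gcd j n)) else 0)"
    unfolding poly_V_def Polynomial.coeff_sum Polynomial.coeff_monom using j fin by (subst sum.delta) auto
  show ?thesis
  proof (cases "gcd j n > 1")
    case False
    have "gcd j n \<noteq> 0" using n(2) by simp
    then have "gcd j n = 1" using False by linarith
    then have nd: "\<not> p dvd j" if "p \<in> prime_factors n" for p
      using that by (metis gcd_greatest in_prime_factors_iff not_prime_unit)
    have "j \<ge> 1" using \<open>gcd j n = 1\<close> n(2) by (cases j) auto
    moreover have "jacobi (int j) n = xseq (int ` prime_factors n) (int j)"
      unfolding jacobi_squarefree[OF n(1)] xseq_prime_factors using nd
      by (intro prod.cong refl) (auto simp: uleg_def)
    ultimately show ?thesis using False cJ cV by simp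
  next
    case True
    define h where "h = n div gcd j n"
    have gh: "gcd j n * h = n" by (simp add: h_def)
    then have h_dvd: "h dvd n" using dvd_triv_right[of h "gcd j n"] by simp
    have h0: "h \<noteq> 0" using gh n(2) by (intro notI) auto
    have sqh: "squarefree h" using squarefree_mono h_dvd n(1) by blast
    have pf: "prime_factors h = {p \<in> prime_factors n. \<not> p dvd j}"
    proof (intro Set.set_eqI iffI)
      fix p assume "p \<in> prime_factors h"
      then have p: "prime p" "p dvd h" by (auto simp: in_prime_factors_iff)
      then have pn: "p dvd n" using h_dvd dvd_trans by blast
      have "\<not> p dvd j"
      proof
        assume "p dvd j"
        then have "p dvd gcd j n" using pn by simp
        then have "p * p dvd n" using p(2) mult_dvd_mono[of p "gcd j n" p h] gh by simp
        then have "p dvd 1" using n(1) by (auto simp: squarefree_def power2_eq_square)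
        then show False using p(1) by auto
      qed
      then show "p \<in> {p \<in> prime_factors n. \<not> p dvd j}"
        using p(1) pn n(2) by (auto simp: in_prime_factors_iff)
    next
      fix p assume "p \<in> {p \<in> prime_factors n. \<not> p dvd j}"
      then have p: "prime p" "p dvd n" "\<not> p dvd j" by (auto simp: in_prime_factors_iff)
      then have "p dvd gcd j n * h" by (simp add: gh)
      moreover have "\<not> p dvd gcd j n" using p(3) by simp
      ultimately have "p dvd h" using p(1) prime_dvd_mult_iff by blast
      then show "p \<in> prime_factors h" using p h0 by (auto simp: in_prime_factors_iff)
    qed
    have "jacobi (int j) h = (\<Prod>p\<in>prime_factors n. uleg (int p) (int j))"
      unfolding jacobi_squarefree[OF sqh] pf
      by (subst prod.inter_filter) (auto simp: uleg_def intro!: prod.cong)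
    moreover have "Polynomial.coeff (char_poly_J n) j = 0"
    proof -
      obtain p where p: "prime p" "p dvd gcd j n" using True prime_factor_nat[of "gcd j n"] by auto
      then have "p \<in> prime_factors n" "Legendre (int j) (int p) = 0"
        using n(2) by (auto simp: in_prime_factors_iff Legendre_eq_0_iff)
      then have "jacobi (int j) n = 0" unfolding jacobi_squarefree[OF n(1)] by (intro prod_zero) auto
      then show ?thesis by (simp add: cJ)
    qed
    ultimately show ?thesis using True cV by (simp add: h_def xseq_prime_factors)
  qed
qed

lemma prod_prime_factors_squarefree:
  fixes n :: nat
  assumes "squarefree n" "n > 0"
  shows "\<Prod>(int ` prime_factors n) = int n"
proof -
  have "n = (\<Prod>p\<in>prime_factors n. p ^ multiplicity p n)" using assms(2) by (rule prime_factorization_nat)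
  also have "\<dots> = (\<Prod>p\<in>prime_factors n. p)" using assms(1) by (intro prod.cong refl) (simp add: squarefree_multiplicity)
  finally have "(\<Prod>p\<in>prime_factors n. p) = n" by (rule sym)
  then have "int (\<Prod>p\<in>prime_factors n. p) = int n" by (rule arg_cong)
  then show ?thesis by (subst prod.reindex) auto
qed

lemma poly_rotated:
  fixes n :: nat and r :: real
  assumes n: "squarefree n" "n > 1"
  defines "\<rho> \<equiv> \<lfloor>real n * r\<rfloor> mod int n"
  shows "poly (rotation n r (char_poly_J n) + rotation n r (poly_V n)) (cis \<theta>)
    = (\<Sum>i\<in>{0..<int n}. of_int (xseq (int ` prime_factors n) (i + \<rho>)) * cis (of_int i * \<theta>))"
proof -
  let ?x = "xseq (int ` prime_factors n)" and ?R = "\<lfloor>real n * r\<rfloor>"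
  have xc: "?x a = ?x b" if "int n dvd a - b" for a b
    using that prod_prime_factors_squarefree[of n] n by (intro xseq_cong) auto
  have "poly (rotation n r (char_poly_J n) + rotation n r (poly_V n)) (cis \<theta>)
    = (\<Sum>k<n. (Polynomial.coeff (char_poly_J n) (nat ((int k + ?R) mod int n)) + Polynomial.coeff (poly_V n) (nat ((int k + ?R) mod int n))) * cis \<theta> ^ k)"
    unfolding rotation_def poly_add poly_sum poly_monom by (simp add: sum.distrib ring_distribs)
  also have "\<dots> = (\<Sum>k<n. of_int (?x (int k + \<rho>)) * cis (real k * \<theta>))"
  proof (intro sum.cong refl)
    fix k
    define j where "j = nat ((int k + ?R) mod int n)"
    have j: "int j = (int k + ?R) mod int n" "j < n" using n by (auto simp: j_def nat_less_iff)
    have "int n dvd int j - (int k + \<rho>)"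
      unfolding j(1) \<rho>_def mod_eq_dvd_iff[symmetric] by (simp add: mod_add_right_eq)
    then have "?x (int j) = ?x (int k + \<rho>)" by (rule xc)
    then show "(Polynomial.coeff (char_poly_J n) (nat ((int k + ?R) mod int n)) + Polynomial.coeff (poly_V n) (nat ((int k + ?R) mod int n))) * cis \<theta> ^ k
      = of_int (?x (int k + \<rho>)) * cis (real k * \<theta>)"
      unfolding j_def[symmetric] coeff_J_plus_V[OF n j(2)] Complex.DeMoivre by simp
  qed
  also have "\<dots> = (\<Sum>i\<in>{0..<int n}. of_int (?x (i + \<rho>)) * cis (of_int i * \<theta>))"
    by (rule sum.reindex_bij_witness[of _ nat int]) auto
  finally show ?thesis .
qed

text \<open>Translation by \<open>R\<close> multiplies the transform by the unimodular
  \<open>ee (2 * n) (R * k)\<close>, which the norm ignores.\<close>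

lemma N4_interval:
  assumes n: "n > 0" and x: "\<And>j. x (j + n) = x j"
  shows "N4 (2 * n) x (\<lambda>j. of_real (ind (2 * n) R n j))
    = (\<Sum>k\<in>{0..<2 * n}. (norm (\<Sum>i\<in>{0..<n}. of_int (x (i + R)) * ee (2 * n) (i * k)))^4) / of_int (2 * n)"
proof -
  have x2: "x (j + 2 * n) = x j" for j using x[of j] x[of "j + n"] by (simp add: algebra_simps)
  have "norm (FF (2 * n) x (\<lambda>j. of_real (ind (2 * n) R n j)) k) = norm (\<Sum>i\<in>{0..<n}. of_int (x (i + R)) * ee (2 * n) (i * k))" for k
  proof -
    let ?f = "\<lambda>j. of_int (x j) * ee (2 * n) (j * k)"
    have "FF (2 * n) x (\<lambda>j. of_real (ind (2 * n) R n j)) k = (\<Sum>j\<in>{0..<2 * n}. of_real (ind (2 * n) R n j) * ?f j)"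
      by (simp add: FF_def mult_ac)
    also have "\<dots> = (\<Sum>j\<in>{R..<R+n}. ?f j)"
      using n x2 by (intro sum_ind) (auto simp: ring_distribs ee_add ee_dvd)
    also have "\<dots> = (\<Sum>i\<in>{0..<n}. ?f (i + R))"
      by (rule sum.reindex_bij_witness[of _ "\<lambda>i. i + R" "\<lambda>j. j - R"]) auto
    also have "\<dots> = ee (2 * n) (R * k) * (\<Sum>i\<in>{0..<n}. of_int (x (i + R)) * ee (2 * n) (i * k))"
      by (simp add: sum_distrib_left ring_distribs ee_add mult_ac)
    finally show ?thesis by (simp add: norm_mult)
  qed
  then show ?thesis by (simp add: N4_def)
qed

text \<open>The phases are the Gauss sums divided by the square roots of their primes; these square
  roots multiply to the factor in front of \<open>Yfun\<close>.\<close>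

lemma jacobi_setup_exists:
  fixes n :: nat
  assumes n: "odd n" "squarefree n" "n > 1"
  shows "\<exists>g. jacobi_setup (int ` prime_factors n) (int (smallest_prime_factor n)) g"
proof -
  let ?P = "int ` prime_factors n" and ?q = "int (smallest_prime_factor n)"
  have fin: "finite ?P" by simp
  have pf: "prime p \<and> p > 2" if "p \<in> prime_factors n" for p
  proof -
    have p: "prime p" "p dvd n" using that by (auto simp: in_prime_factors_iff)
    then have "odd p" using n(1) by (meson dvd_trans)
    then show ?thesis using p prime_ge_2_nat[of p] by (cases "p = 2") auto
  qed
  have P: "prime p \<and> p > 2" if "p \<in> ?P" for p using that pf by auto
  have ne: "prime_factors n \<noteq> {}" using n(3) by (auto simp: prime_factorization_empty_iff)
  have min: "smallest_prime_factor n \<in> prime_factors n" unfolding smallest_prime_factor_def using ne by (intro Min_in) auto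
  have le: "smallest_prime_factor n \<le> p" if "p \<in> prime_factors n" for p
    unfolding smallest_prime_factor_def using that by (intro Min_le) auto
  obtain \<gamma> where \<gamma>: "\<And>p. p \<in> ?P \<Longrightarrow> (norm (\<gamma> p :: complex))^2 = of_int p"
    "\<And>k. (\<Sum>j\<in>{0..<2 * \<Prod>?P}. of_int (xseq ?P (1 * j)) * ee (2 * \<Prod>?P) (j * k))
       = (if even k then 2 else 0) * (\<Prod>p\<in>?P. 1 + \<gamma> p * of_int (Legendre k p))"
    using xseq_fourier[OF fin P coprime_1_left] by blast
  define g where "g p = \<gamma> p / of_real (sqrt (of_int p))" for p
  have "jacobi_setup ?P ?q g"
  proof
    show "finite ?P" "?P \<noteq> {}" using ne by auto
    show "prime p \<and> p > 2 \<and> ?q \<le> p" if "p \<in> ?P" for p using that P le by auto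
    show "2 < ?q" using pf[OF min] by simp
    show "norm (g p) = 1" if "p \<in> ?P" for p
    proof -
      have "norm (\<gamma> p) = sqrt (of_int p)" using \<gamma>(1)[OF that] by (metis norm_ge_zero real_sqrt_unique)
      then show ?thesis using P[OF that] by (simp add: g_def norm_divide)
    qed
    fix k
    have sqrtP: "(\<Prod>p\<in>?P. complex_of_real (sqrt (of_int p))) = of_real (sqrt (of_int (\<Prod>?P)))"
    proof -
      have "(\<Prod>p\<in>Q. complex_of_real (sqrt (of_int p))) = of_real (sqrt (of_int (\<Prod>Q)))" if "finite Q" for Q
        using that by (induction Q rule: finite_induct) (auto simp: real_sqrt_mult)
      then show ?thesis using fin by blast
    qed
    have "(\<Prod>p\<in>?P. 1 + \<gamma> p * of_int (Legendre k p)) = (\<Prod>p\<in>?P. of_real (sqrt (of_int p)) * hfac p (g p) k)"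
    proof (intro prod.cong refl)
      fix p assume "p \<in> ?P"
      then have "sqrt (of_int p) \<noteq> 0" using P[of p] by auto
      then show "1 + \<gamma> p * of_int (Legendre k p) = of_real (sqrt (of_int p)) * hfac p (g p) k"
        by (simp add: hfac_def g_def field_simps)
    qed
    then show "(\<Sum>j\<in>{0..<2 * \<Prod>?P}. of_int (xseq ?P j) * ee (2 * \<Prod>?P) (j * k))
       = of_real (2 * sqrt (of_int (\<Prod>?P))) * Yfun ?P g k"
      using \<gamma>(2)[of k] unfolding prod.distrib sqrtP by (simp add: Yfun_def)
  qed
  then show ?thesis by blast
qed

subsection \<open>The limit\<close>

definition interval_N4 :: "real \<Rightarrow> nat \<Rightarrow> real" where
  "interval_N4 r n = N4 (2 * int n) (xseq (int ` prime_factors n))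
     (\<lambda>j. of_real (ind (2 * int n) (\<lfloor>real n * r\<rfloor> mod int n) (int n) j))"

lemma merit_factor_rotated:
  assumes n: "odd n" "squarefree n" "n > 1"
  shows "merit_factor (rotation n r (char_poly_J n) + rotation n r (poly_V n)) = 1 / (interval_N4 r n / (real n)^2 - 1)"
proof -
  let ?x = "xseq (int ` prime_factors n)" and ?\<rho> = "\<lfloor>real n * r\<rfloor> mod int n"
  have per: "?x (j + int n) = ?x j" for j
    using prod_prime_factors_squarefree[of n] n by (intro xseq_cong) auto
  have "norm (complex_of_int (?x j)) = 1" for j
    using xseq_pm1[of "int ` prime_factors n" j] by auto
  then have "merit_factor (rotation n r (char_poly_J n) + rotation n r (poly_V n))
    = 1 / ((\<Sum>k\<in>{0..<2 * int n}. (norm (\<Sum>i\<in>{0..<int n}. of_int (?x (i + ?\<rho>)) * ee (2 * int n) (i * k)))^4) / of_int (2 * int n) / (of_int (int n))^2 - 1)"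
    using n poly_rotated[OF n(2,3)] by (intro merit_factor_eq) auto
  then show ?thesis
    using N4_interval[of "int n" ?x ?\<rho>] n per by (simp add: interval_N4_def)
qed

text \<open>The error of the locale with its parameters made explicit, so that a limit can be taken
  while the set of primes varies with the modulus.\<close>

definition errf :: "real \<Rightarrow> real \<Rightarrow> real \<Rightarrow> real" where
  "errf c q \<delta> = (exp (17 * c / sqrt q) - 1 + 19 * q powr (-1/4) * exp (17 * c / sqrt q)) * (1 + 2 / \<delta>)^4
     + 4 * (exp (17 * c / sqrt q) + 1) * (1 + 2 / \<delta>)^3 * (6 / \<delta> / q)"

lemma (in jacobi_setup) err_eq: "err \<delta> = errf (real (card P)) (of_int q) \<delta>"
  by (simp add: err_def errf_def Egen_def Kexp_def)

lemma errf_tendsto_0: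
  assumes c: "((\<lambda>n. c n / sqrt (q n)) \<longlongrightarrow> 0) F" and q: "((\<lambda>n. 1 / q n) \<longlongrightarrow> 0) F"
    and pos: "\<forall>\<^sub>F n in F. q n > 0"
  shows "((\<lambda>n. errf (c n) (q n) \<delta>) \<longlongrightarrow> 0) F"
proof -
  have "((\<lambda>n. exp (17 * (c n / sqrt (q n)))) \<longlongrightarrow> exp (17 * 0)) F"
    by (intro tendsto_intros c)
  then have K: "((\<lambda>n. exp (17 * c n / sqrt (q n))) \<longlongrightarrow> 1) F" by simp
  have "((\<lambda>n. (1 / q n) powr (1/4)) \<longlongrightarrow> 0 powr (1/4)) F"
    using pos by (intro tendsto_powr' q tendsto_const) (auto elim: eventually_mono)
  then have "((\<lambda>n. (1 / q n) powr (1/4)) \<longlongrightarrow> 0) F" by simp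
  moreover have "\<forall>\<^sub>F n in F. (1 / q n) powr (1/4) = q n powr (-1/4)"
    using pos by (auto elim!: eventually_mono simp: powr_divide powr_minus_divide)
  ultimately have p: "((\<lambda>n. q n powr (-1/4)) \<longlongrightarrow> 0) F" by (rule Lim_transform_eventually)
  have "((\<lambda>n. (exp (17 * c n / sqrt (q n)) - 1 + 19 * q n powr (-1/4) * exp (17 * c n / sqrt (q n))) * (1 + 2 / \<delta>)^4
     + 4 * (exp (17 * c n / sqrt (q n)) + 1) * (1 + 2 / \<delta>)^3 * (6 / \<delta> * (1 / q n)))
     \<longlongrightarrow> (1 - 1 + 19 * 0 * 1) * (1 + 2 / \<delta>)^4 + 4 * (1 + 1) * (1 + 2 / \<delta>)^3 * (6 / \<delta> * 0)) F"
    by (intro tendsto_intros K p q)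
  then show ?thesis by (simp add: errf_def)
qed

text \<open>The number is a product of distinct primes, each at least 2, and \<open>ln 2\<close> is
  at least 1/2.\<close>

lemma card_prime_factors_le:
  fixes n :: nat
  assumes "squarefree n" "n > 0"
  shows "real (card (prime_factors n)) \<le> 2 * ln (real n)"
proof -
  have "(2::int) ^ card (prime_factors n) = (\<Prod>p\<in>int ` prime_factors n. 2)"
    by (simp add: card_image)
  also have "\<dots> \<le> \<Prod>(int ` prime_factors n)"
    by (intro prod_mono) (auto simp: in_prime_factors_iff prime_ge_2_nat)
  also have "\<dots> = int n" by (rule prod_prime_factors_squarefree[OF assms])
  finally have "(2::nat) ^ card (prime_factors n) \<le> n" by (metis of_nat_le_iff of_nat_numeral of_nat_power)
  then have "(2::real) ^ card (prime_factors n) \<le> real n" by (metis of_nat_le_iff of_nat_numeral of_nat_power)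
  then have "ln ((2::real) ^ card (prime_factors n)) \<le> ln (real n)" using assms(2) by (subst ln_le_cancel_iff) auto
  then have "real (card (prime_factors n)) * ln 2 \<le> ln (real n)" by (simp add: ln_realpow)
  moreover have "real (card (prime_factors n)) * (1/2) \<le> real (card (prime_factors n)) * ln 2"
    using ln2_ge_two_thirds by (intro mult_left_mono) auto
  ultimately show ?thesis by linarith
qed

lemma interval_mainfun_tendsto:
  fixes r :: real
  defines "x \<equiv> frac r"
  shows "(\<lambda>n. 8 * mainfun (int n) (fcoeff (2 * int n) (\<lambda>j. of_real (ind (2 * int n) (\<lfloor>real n * r\<rfloor> mod int n) (int n) j))))
    \<longlonglongrightarrow> 7/6 + 8 * (min x (1 - x) - 1/4)^2"
proof -
  define \<rho> where "\<rho> n = \<lfloor>real n * r\<rfloor> mod int n" for n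
  define cnt where "cnt n = (\<Sum>j\<in>{0..<2 * int n}. ind (2 * int n) (\<rho> n) (int n) j * ind (2 * int n) (\<rho> n) (int n) (- j))" for n
  have x01: "0 \<le> x" "x < 1" by (auto simp: x_def frac_lt_1)
  have bd: "\<bar>cnt n / real n - 2 * min x (1 - x)\<bar> \<le> 3 / real n" if n: "n > 0" for n
  proof -
    have \<rho>: "0 \<le> \<rho> n" "\<rho> n < int n" using n by (auto simp: \<rho>_def)
    have "real n * r = real n * x + of_int (int n * \<lfloor>r\<rfloor>)" by (simp add: x_def frac_def algebra_simps)
    then have "\<lfloor>real n * r\<rfloor> = \<lfloor>real n * x\<rfloor> + int n * \<lfloor>r\<rfloor>" by (metis floor_add_int)
    moreover have "0 \<le> \<lfloor>real n * x\<rfloor>" "\<lfloor>real n * x\<rfloor> < int n" using x01 n by (auto simp: floor_less_iff)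
    ultimately have \<rho>x: "\<rho> n = \<lfloor>real n * x\<rfloor>" by (simp add: \<rho>_def)
    have 1: "\<bar>cnt n - 2 * of_int (min (\<rho> n) (int n - \<rho> n))\<bar> \<le> 1"
      unfolding cnt_def using n \<rho> by (intro interval_reflection_count) auto
    have "of_int (\<rho> n) \<le> real n * x" "real n * x < of_int (\<rho> n) + 1" unfolding \<rho>x by linarith+
    then have "\<bar>of_int (\<rho> n) - real n * x\<bar> \<le> 1" by linarith
    moreover have "real n * min x (1 - x) = min (real n * x) (real n - real n * x)"
      by (simp add: min_mult_distrib_left right_diff_distrib)
    moreover have "of_int (min (\<rho> n) (int n - \<rho> n)) = min (of_int (\<rho> n)) (real n - of_int (\<rho> n))"
      by (auto simp: min_def)
    moreover have "\<bar>min a (m - a) - min b (m - b)\<bar> \<le> 1" if "\<bar>a - b\<bar> \<le> 1" for a b m :: real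
      using that by (simp add: min_def) linarith
    ultimately have "\<bar>of_int (min (\<rho> n) (int n - \<rho> n)) - real n * min x (1 - x)\<bar> \<le> 1"
      by presburger
    \<comment> \<open>An error of 1 comes from the count and 2 * 1 from rounding
      \<open>real n * x\<close> to an integer.\<close>
    then have "\<bar>cnt n - real n * (2 * min x (1 - x))\<bar> \<le> 3" using 1 by (simp add: abs_le_iff)
    then have "\<bar>(cnt n - real n * (2 * min x (1 - x))) / real n\<bar> \<le> 3 / real n"
      using n by (simp add: abs_divide divide_right_mono)
    moreover have "(cnt n - real n * (2 * min x (1 - x))) / real n = cnt n / real n - 2 * min x (1 - x)"
      using n by (simp add: diff_divide_distrib)
    ultimately show ?thesis by simp
  qed
  have lim3: "(\<lambda>n. 3 / real n) \<longlonglongrightarrow> 0" by (rule lim_const_over_n)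
  have "(\<lambda>n. cnt n / real n - 2 * min x (1 - x)) \<longlonglongrightarrow> 0"
    by (rule Lim_null_comparison[OF _ lim3]) (use bd in \<open>auto intro!: eventually_sequentiallyI[of 1]\<close>)
  then have c: "(\<lambda>n. cnt n / real n) \<longlonglongrightarrow> 2 * min x (1 - x)" by (simp add: LIM_zero_iff)
  have "(\<lambda>n. 1 / real n) \<longlonglongrightarrow> 0" by (rule lim_const_over_n)
  then have "(\<lambda>n. 7/6 + 2 * (cnt n / real n - 1/2)^2 - 2/3 * (1 / real n)^2)
    \<longlonglongrightarrow> 7/6 + 2 * (2 * min x (1 - x) - 1/2)^2 - 2/3 * 0^2"
    by (intro tendsto_intros c)
  moreover have "7/6 + 2 * (2 * min x (1 - x) - 1/2)^2 - 2/3 * 0^2 = 7/6 + 8 * (min x (1 - x) - 1/4)^2"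
    by (simp add: power2_eq_square algebra_simps)
  ultimately have "(\<lambda>n. 7/6 + 2 * (cnt n / real n - 1/2)^2 - 2/3 * (1 / real n)^2) \<longlonglongrightarrow> 7/6 + 8 * (min x (1 - x) - 1/4)^2"
    by simp
  then show ?thesis
  proof (rule Lim_transform_eventually)
    show "\<forall>\<^sub>F n in sequentially. 7/6 + 2 * (cnt n / real n - 1/2)^2 - 2/3 * (1 / real n)^2
      = 8 * mainfun (int n) (fcoeff (2 * int n) (\<lambda>j. of_real (ind (2 * int n) (\<lfloor>real n * r\<rfloor> mod int n) (int n) j)))"
    proof (rule eventually_sequentiallyI[of 1])
      fix n :: nat assume "1 \<le> n"
      then show "7/6 + 2 * (cnt n / real n - 1/2)^2 - 2/3 * (1 / real n)^2
        = 8 * mainfun (int n) (fcoeff (2 * int n) (\<lambda>j. of_real (ind (2 * int n) (\<lfloor>real n * r\<rfloor> mod int n) (int n) j)))"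
        using mainfun_interval[of "int n" "\<rho> n"] by (simp add: cnt_def \<rho>_def power_divide)
    qed
  qed
qed

lemma interval_N4_tendsto:
  fixes S :: "nat set" and r :: real
  assumes S: "\<forall>n\<in>S. odd n \<and> squarefree n \<and> n > 1"
    and lim: "((\<lambda>n. ln (real n) ^ 7 / real (smallest_prime_factor n)) \<longlongrightarrow> 0) (inf at_top (principal S))"
  defines "x \<equiv> frac r"
  shows "((\<lambda>n. interval_N4 r n / (real n)^2) \<longlongrightarrow> 7/6 + 8 * (min x (1 - x) - 1/4)^2) (inf at_top (principal S))"
proof -
  let ?F = "inf at_top (principal S)"
  let ?m = "\<lambda>n. 8 * mainfun (int n) (fcoeff (2 * int n) (\<lambda>j. of_real (ind (2 * int n) (\<lfloor>real n * r\<rfloor> mod int n) (int n) j)))"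
  define q where "q n = real (smallest_prime_factor n)" for n
  define c where "c n = real (card (prime_factors n))" for n :: nat
  have main: "(?m \<longlongrightarrow> 7/6 + 8 * (min x (1 - x) - 1/4)^2) ?F"
    unfolding x_def by (rule tendsto_mono[OF _ interval_mainfun_tendsto]) simp
  have inS: "\<forall>\<^sub>F n in ?F. n \<in> S" by (simp add: eventually_inf_principal)
  have ev: "\<forall>\<^sub>F n in ?F. P n" if "\<forall>\<^sub>F n in at_top. P n" for P
    using that by (simp add: eventually_inf_principal eventually_mono)
  have ln1: "\<forall>\<^sub>F n in ?F. ln (real n) \<ge> 1"
    by (rule ev) (use filterlim_compose[OF ln_at_top filterlim_real_sequentially] in \<open>simp add: filterlim_at_top\<close>)
  have qpos: "q n > 0" if "n \<in> S" for n
  proof -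
    have "prime_factors n \<noteq> {}" using S that by (auto simp: prime_factorization_empty_iff)
    then have "smallest_prime_factor n \<in> prime_factors n" unfolding smallest_prime_factor_def by (intro Min_in) auto
    then show ?thesis by (auto simp: q_def in_prime_factors_iff prime_gt_0_nat)
  qed
  have qev: "\<forall>\<^sub>F n in ?F. q n > 0" using inS by (rule eventually_mono) (rule qpos)
  have lim': "((\<lambda>n. ln (real n) ^ 7 / q n) \<longlongrightarrow> 0) ?F" using lim by (simp add: q_def)
  have q0: "((\<lambda>n. 1 / q n) \<longlongrightarrow> 0) ?F"
  proof (rule Lim_null_comparison[OF _ lim'])
    show "\<forall>\<^sub>F n in ?F. norm (1 / q n) \<le> ln (real n) ^ 7 / q n"
      using ln1 qev by eventually_elim (auto intro!: divide_right_mono one_le_power)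
  qed
  \<comment> \<open>As there are at most \<open>2 * ln n\<close> prime factors, the square of this
    quotient is at most 4 times the quantity assumed to vanish, once
    \<open>ln n >= 1\<close>.\<close>
  have c0: "((\<lambda>n. c n / sqrt (q n)) \<longlongrightarrow> 0) ?F"
  proof -
    have "((\<lambda>n. sqrt (4 * (ln (real n) ^ 7 / q n))) \<longlongrightarrow> sqrt (4 * 0)) ?F"
      by (intro tendsto_intros lim')
    then have s: "((\<lambda>n. sqrt (4 * (ln (real n) ^ 7 / q n))) \<longlongrightarrow> 0) ?F" by simp
    show ?thesis
    proof (rule Lim_null_comparison[OF _ s])
      show "\<forall>\<^sub>F n in ?F. norm (c n / sqrt (q n)) \<le> sqrt (4 * (ln (real n) ^ 7 / q n))"
        using ln1 inS
      proof eventually_elim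
        case (elim n)
        have "c n \<le> 2 * ln (real n)" unfolding c_def using elim S by (intro card_prime_factors_le) auto
        then have "(c n)^2 \<le> (2 * ln (real n))^2" by (intro power_mono) (auto simp: c_def)
        also have "\<dots> \<le> 4 * ln (real n) ^ 7"
          using power_increasing[of 2 7 "ln (real n)"] elim by (simp add: power_mult_distrib)
        finally have "(c n)^2 / q n \<le> 4 * (ln (real n) ^ 7 / q n)" using qpos[OF elim(2)] by (simp add: divide_right_mono)
        moreover have "norm (c n / sqrt (q n)) = sqrt ((c n)^2 / q n)"
          using qpos[OF elim(2)] by (simp add: c_def real_sqrt_divide)
        ultimately show ?case by simp
      qed
    qed
  qed
  have "((\<lambda>n. interval_N4 r n / (real n)^2 - ?m n) \<longlongrightarrow> 0) ?F"
  proof (rule tendstoI)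
    fix \<epsilon> :: real assume \<epsilon>: "\<epsilon> > 0"
    \<comment> \<open>Order of choices: \<open>\<eta>\<close>, then \<open>\<delta>\<close>
      depending on \<open>\<eta>\<close>, then \<open>n\<close> large. Four contributions are kept
      below \<open>\<epsilon> / 8\<close>: the terms linear in \<open>\<eta>\<close>, the tents, the
      quotient \<open>\<delta> / \<eta>\<close>, and the error \<open>errf\<close>. Here 640 = 120 *
      4 + 80 * 2, as the error is at most 1.\<close>
    define \<eta> where "\<eta> = min 1 (\<epsilon> / 5120)"
    have \<eta>: "0 < \<eta>" "\<eta> \<le> 1" "640 * \<eta> \<le> \<epsilon> / 8" using \<epsilon> by (auto simp: \<eta>_def min_def)
    define K where "K = 73728 / \<eta>^4"
    have K: "K > 0" using \<eta> by (simp add: K_def)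
    define \<delta> where "\<delta> = min (1/4) (min (\<epsilon> / (24 * K)) (\<eta> * \<epsilon> / 640))"
    have \<delta>: "0 < \<delta>" "\<delta> \<le> 1/4" "\<delta> \<le> \<epsilon> / (24 * K)" "\<delta> \<le> \<eta> * \<epsilon> / 640" using \<epsilon> K \<eta> by (auto simp: \<delta>_def)
    have \<delta>1: "K * (3 * \<delta>^2) \<le> \<epsilon> / 8"
    proof -
      have "\<delta>^2 \<le> \<delta>" using \<delta> by (simp add: power2_eq_square mult_left_le)
      then have "K * (3 * \<delta>^2) \<le> K * (3 * \<delta>)" using K by (intro mult_left_mono) auto
      also have "\<dots> \<le> \<epsilon> / 8" using \<delta>(3) K by (simp add: field_simps)
      finally show ?thesis .
    qed
    have \<delta>2: "80 * (\<delta> / \<eta>) \<le> \<epsilon> / 8" using \<delta>(4) \<eta> by (simp add: field_simps)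
    define b where "b = min 1 (\<epsilon> / (8 * (K + 8)))"
    have b: "b > 0" using \<epsilon> K by (simp add: b_def)
    have e: "\<forall>\<^sub>F n in ?F. errf (c n) (q n) \<delta> < b"
      using errf_tendsto_0[OF c0 q0 qev, of \<delta>] b by (rule order_tendstoD)
    have big: "\<forall>\<^sub>F n in ?F. real n \<ge> 1 / \<delta>"
      by (rule ev) (use filterlim_real_sequentially in \<open>simp add: filterlim_at_top\<close>)
    show "\<forall>\<^sub>F n in ?F. dist (interval_N4 r n / (real n)^2 - ?m n) 0 < \<epsilon>"
      using e big inS
    proof eventually_elim
      case (elim n)
      have n: "odd n" "squarefree n" "n > 1" using S elim(3) by auto
      obtain g where "jacobi_setup (int ` prime_factors n) (int (smallest_prime_factor n)) g"
        using jacobi_setup_exists[OF n] by blast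
      then interpret jacobi_setup "int ` prime_factors n" "int (smallest_prime_factor n)" g .
      have nn: "jacobi_setup.n (int ` prime_factors n) = int n"
        unfolding n_def using n by (intro prod_prime_factors_squarefree) auto
      have NN: "N = 2 * int n" by (simp add: N_def nn)
      define E where "E = err \<delta>"
      have E: "E = errf (c n) (q n) \<delta>"
        by (simp add: E_def err_eq c_def q_def card_image)
      \<comment> \<open>Since \<open>\<delta> * real n >= 1\<close>, rounding up at most doubles the
        value; with \<open>\<delta> <= 1/4\<close> this gives \<open>2 * w <= n\<close>.\<close>
      define w where "w = \<lceil>\<delta> * real n\<rceil>"
      have dn: "\<delta> * real n \<ge> 1" using elim(2) \<delta>(1) by (simp add: field_simps)
      have w: "\<delta> * real n \<le> of_int w" "of_int w < \<delta> * real n + 1" unfolding w_def by linarith+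
      have "of_int (2 * w) \<le> 4 * (\<delta> * real n)" using w dn by simp
      also have "\<dots> \<le> real n" using mult_right_mono[OF \<delta>(2), of "real n"] by simp
      finally have w2: "2 * w \<le> int n" by linarith
      have w0: "w > 0" using w(1) dn by linarith
      have "\<bar>interval_N4 r n / (real n)^2 - ?m n\<bar>
        \<le> 120 * \<eta> * (3 + E) + K * (3 * \<delta>^2 + E) + 8 * E + 80 * (\<delta> / \<eta> + 2 * \<eta>)"
        using interval_moment[of w \<delta> \<eta> "\<lfloor>real n * r\<rfloor> mod int n"] w w0 w2 dn \<delta>(1) \<eta>
        unfolding nn NN E_def K_def interval_N4_def by simp
      also have "\<dots> < \<epsilon>"
      proof -
        have E1: "E \<le> 1" "E \<le> \<epsilon> / (8 * (K + 8))" using elim(1) by (auto simp: E b_def)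
        have "120 * \<eta> * (3 + E) \<le> 120 * \<eta> * 4" using E1 \<eta> by (intro mult_left_mono) auto
        moreover have "(K + 8) * E \<le> \<epsilon> / 8" using E1(2) K by (simp add: field_simps)
        then have "K * E + 8 * E \<le> \<epsilon> / 8" by (simp add: distrib_right)
        moreover have "K * (3 * \<delta>^2 + E) = K * (3 * \<delta>^2) + K * E" by (simp add: distrib_left)
        moreover have "80 * (\<delta> / \<eta> + 2 * \<eta>) = 80 * (\<delta> / \<eta>) + 160 * \<eta>" by simp
        ultimately show ?thesis using \<delta>1 \<delta>2 \<eta>(3) \<epsilon> by linarith
      qed
      finally show ?case by (simp add: dist_real_def)
    qed
  qed
  from tendsto_add[OF this main] show ?thesis by simp
qed

text \<open>Both expressions depend on \<open>r\<close> through its distance to the nearest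
  integer.\<close>

lemma f_lim_eq: "f_lim r = 1 / (1/6 + 8 * (min (frac r) (1 - frac r) - 1/4)^2)"
proof -
  define s where "s = r - of_int \<lceil>r - 1/2\<rceil>"
  have s: "-1/2 < s" "s \<le> 1/2" unfolding s_def by linarith+
  have "\<bar>s\<bar> = min (frac r) (1 - frac r)"
  proof (cases "s \<ge> 0")
    case True
    have "frac r = s" using True s by (subst frac_unique_iff) (auto simp: s_def)
    then show ?thesis using True s by simp
  next
    case False
    have "frac r = s + 1" using False s by (subst frac_unique_iff) (auto simp: s_def)
    then show ?thesis using False s by simp
  qed
  then show ?thesis by (simp add: f_lim_def Let_def s_def)
qed

theorem theorem6:
  fixes S :: "nat set" and r :: real
  assumes "infinite S"
    and "\<forall>n\<in>S. odd n \<and> squarefree n \<and> n > 1"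
    and "((\<lambda>n. ln (real n) ^ 7 / real (smallest_prime_factor n)) \<longlongrightarrow> 0)
           (inf at_top (principal S))"
  shows "((\<lambda>n. merit_factor (rotation n r (char_poly_J n) + rotation n r (poly_V n)))
           \<longlongrightarrow> f_lim r) (inf at_top (principal S))"
proof -
  let ?F = "inf at_top (principal S)" and ?v = "(min (frac r) (1 - frac r) - 1/4)^2"
  \<comment> \<open>The reciprocal of the merit factor is the normalised fourth moment minus 1, and
    7/6 - 1 is the constant 1/6 of \<open>f_lim\<close>; the limit is positive, so reciprocals
    converge.\<close>
  have "((\<lambda>n. 1 / (interval_N4 r n / (real n)^2 - 1)) \<longlongrightarrow> 1 / (7/6 + 8 * ?v - 1)) ?F"
  proof (intro tendsto_intros interval_N4_tendsto assms(2,3))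
    have "?v \<ge> 0" by simp
    then show "7/6 + 8 * ?v - 1 \<noteq> 0" by linarith
  qed
  then have lim: "((\<lambda>n. 1 / (interval_N4 r n / (real n)^2 - 1)) \<longlongrightarrow> f_lim r) ?F"
    by (simp add: f_lim_eq)
  have "\<forall>\<^sub>F n in ?F. n \<in> S" by (simp add: eventually_inf_principal)
  then have "\<forall>\<^sub>F n in ?F. 1 / (interval_N4 r n / (real n)^2 - 1)
      = merit_factor (rotation n r (char_poly_J n) + rotation n r (poly_V n))"
    by (rule eventually_mono) (use assms(2) merit_factor_rotated in simp)
  with lim show ?thesis by (rule Lim_transform_eventually)
qed

end
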